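(* Let $n\ge1$, let $J=\{k_1<\cdots<k_p\}\subset\{0,\ldots,n-1\}$ be nonempty, and set $k_{p+1}:=n$. Let $w$ be the longest element in $W_n^J$. Then $$\mathfrak C_w=\mathrm{Pf}\left[\vartheta_{\widetilde B_p}\cdots\vartheta_{\widetilde B_2}\vartheta_{\widetilde B_1}\right],$$ where for each $i=1,\ldots,p$, $$\widetilde B_i=(k_i,\ldots,k_i\,;\ 2k_i+1,2k_i+2,\ldots,k_i+k_{i+1}\,;\ k_i,k_i+1,\ldots,k_{i+1}-1)\in\mathbb Z^{3(k_{i+1}-k_i)}.$$
   Context: **Group.** $W_\infty$ is the group (under composition) of permutations $w$ of $\{1,2,\ldots\}\cup\{\bar1,\bar2,\ldots\}$, where $\bar i=-i$, with $w(\bar i)=\overline{w(i)}$ for all $i$ and $w(i)\ne i$ for only finitely many $i$. It is a Coxeter group with generators $s_0=(1,\bar1)$ and $s_i=(i,i+1)(\bar i,\overline{i+1})$ for $i\ge1$; $\ell$ is the length. $W_n=\{w\in W_\infty\mid w(i)=i\ \forall i>n\}$. For $J\subset\{0,\ldots,n-1\}$, $W^J=\{w\in W_\infty\mid \ell(w)<\ell(ws_i)\ \forall i\ge0,\ i\notin J\}$ (minimum-length representatives of the cosets of the subgroup generated by the $s_i$, $i\notin J$) and $W_n^J=W_n\cap W^J$, which has a unique element of maximal length. **Ring and operators.** $x,z,t$ are infinite sequences of variables. $Q_r(x)$ is defined by $\sum_{r\ge0}Q_r(x)u^r=\prod_{i\ge1}\frac{1+x_iu}{1-x_iu}$, $\Gamma=\mathbb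 Z[Q_1(x),Q_2(x),\ldots]$, and $\mathcal R_\infty=\Gamma[t_1,t_2,\ldots,z_1,z_2,\ldots]$. For $i\ge1$, $s_i^z$ is the ring automorphism of $\mathcal R_\infty$ exchanging $z_i,z_{i+1}$ and fixing the other $z_j$, all $t_j$ and all $Q_r(x)$; $s_0^z$ is the ring automorphism fixing all $t_j$ and all $z_j$ with $j\ge2$, with $s_0^z(z_1)=-z_1$ and $\sum_r s_0^z(Q_r(x))u^r=\frac{1+z_1u}{1-z_1u}\prod_{i\ge1}\frac{1+x_iu}{1-x_iu}$. Let $\omega$ be the ring automorphism with $\omega(t_i)=-z_i$, $\omega(z_i)=-t_i$, $\omega(Q_r(x))=Q_r(x)$, and put $s_i^t=\omega s_i^z\omega$ $(i\ge0)$. Put $\alpha_0=2t_1$, $\alpha_i=t_{i+1}-t_i$ $(i\ge1)$, and $\partial_if=\frac{f-s_i^zf}{\omega(\alpha_i)}$, $\delta_if=\frac{f-s_i^tf}{\alpha_i}$. **Double Schubert polynomials.** $\{\mathfrak C_w=\mathfrak C_w(z,t;x)\mid w\in W_\infty\}$ is the unique $\mathbb Z[t]$-basis of $\mathcal R_\infty$ such that for all $i\ge0$: $\partial_i\mathfrak C_w=\mathfrak C_{ws_i}$ if $\ell(ws_i)<\ell(w)$ and $0$ otherwise; $\delta_i\mathfrak C_w=\mathfrak C_{s_iw}$ if $\ell(s_iw)<\ell(w)$ and $0$ otherwise; and $\mathfrak C_w$ has no constant term except $\mathfrak C_e=1$. **Theta polynomials.** For integers $\kappa,l\ge0$, $\sum_{r\ge0}{}_\kappa\vartheta_r^{(l)}u^r=\prod_{i\ge1}\frac{1+x_iu}{1-x_iu}\prod_{i=1}^\kappa(1+z_iu)\prod_{i=1}^l(1-t_iu)$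 and $\sum_{r\ge0}{}_\kappa\vartheta_r^{(-l)}u^r=\prod_{i\ge1}\frac{1+x_iu}{1-x_iu}\prod_{i=1}^\kappa(1+z_iu)\prod_{i=1}^l\frac1{1+t_iu}$; ${}_\kappa\vartheta_r^{(l)}=0$ for $r<0$. For $B=(\kappa_1,\ldots,\kappa_b;r_1,\ldots,r_b;l_1,\ldots,l_b)\in\mathbb Z^{3b}$ we write formally $\vartheta_B:={}_{\kappa_b}\vartheta_{r_b}^{(l_b)}\cdots{}_{\kappa_1}\vartheta_{r_1}^{(l_1)}$ (note the reversed order); inside $\mathrm{Pf}[\cdots]$ it stands for this ordered list of entries. **Multi Schur-Pfaffian.** For sequences of variables $c^{(i)}=(c_r^{(i)})_{r\in\mathbb Z}$, $1\le i\le m$: $\mathrm{Pf}[c_r^{(1)}]=c_r^{(1)}$; $\mathrm{Pf}[c_{r_1}^{(1)}c_{r_2}^{(2)}]=c_{r_1}^{(1)}c_{r_2}^{(2)}+2\sum_{s=1}^{r_2}(-1)^sc_{r_1+s}^{(1)}c_{r_2-s}^{(2)}$; for even $m\ge4$, $\mathrm{Pf}[c_{r_1}^{(1)}\cdots c_{r_m}^{(m)}]=\sum_{s=2}^m(-1)^s\mathrm{Pf}[c_{r_1}^{(1)}c_{r_s}^{(s)}]\,\mathrm{Pf}[c_{r_2}^{(2)}\cdots\widehat{c_{r_s}^{(s)}}\cdots c_{r_m}^{(m)}]$; for odd $m\ge3$, $\mathrm{Pf}[c_{r_1}^{(1)}\cdots c_{r_m}^{(m)}]=\sum_{s=1}^m(-1)^{s-1}c_{r_s}^{(s)}\mathrm{Pf}[c_{r_1}^{(1)}\cdots\widehat{c_{r_s}^{(s)}}\cdots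 c_{r_m}^{(m)}]$. $\mathrm{Pf}[{}_{\kappa_1}\vartheta_{r_1}^{(l_1)}\cdots{}_{\kappa_m}\vartheta_{r_m}^{(l_m)}]$ is obtained by first expanding $\mathrm{Pf}[c_{r_1}^{(1)}\cdots c_{r_m}^{(m)}]$ and then substituting ${}_{\kappa_i}\vartheta_s^{(l_i)}$ for $c_s^{(i)}$ for all $i$ and all $s\in\mathbb Z$. *)

theory Defs
  imports
    "HOL-Library.FuncSet"
    "HOL-Library.Poly_Mapping"
    "HOL-Combinatorics.Permutations"
    "HOL-Computational_Algebra.Formal_Power_Series"
begin

section \<open>Formal power series with integer coefficients in a set of variables\<close>

text \<open>
  The elements of \<open>\<Gamma>\<close> are power series of bounded degree in infinitely many variables, so
  \<open>\<Gamma>[t,z]\<close> is realised as a subring of the ring of all formal power series over the integers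
  in the variables x, z and t.  An element is an arbitrary integer-valued function on monomials,
  and a monomial is a finitely supported function from variables to exponents.
\<close>

typedef 'v mps = "UNIV :: (('v \<Rightarrow>\<^sub>0 nat) \<Rightarrow> int) set"
  morphisms mcoeff Abs_mps
  by simp

lemma mcoeff_Abs_mps [simp]: "mcoeff (Abs_mps f) = f"
  by (simp add: Abs_mps_inverse)

lemma mps_eqI: "(\<And>m. mcoeff f m = mcoeff g m) \<Longrightarrow> f = g"
  by (simp add: mcoeff_inject[symmetric] fun_eq_iff)

definition msplits :: "('v \<Rightarrow>\<^sub>0 nat) \<Rightarrow> (('v \<Rightarrow>\<^sub>0 nat) \<times> ('v \<Rightarrow>\<^sub>0 nat)) set"
  where "msplits m = {(a, b). a + b = m}"

lemma finite_mle:
  fixes m :: "'v \<Rightarrow>\<^sub>0 nat"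
  shows "finite {a :: 'v \<Rightarrow>\<^sub>0 nat. \<forall>v. Poly_Mapping.lookup a v \<le> Poly_Mapping.lookup m v}"
    (is "finite ?A")
proof (rule finite_imageD)
  let ?K = "Poly_Mapping.keys m"
  let ?M = "Max (Poly_Mapping.lookup m ` ?K)"
  let ?F = "{f. \<forall>v. (v \<in> ?K \<longrightarrow> f v \<in> {..?M}) \<and> (v \<notin> ?K \<longrightarrow> f v = 0)}"
  have "Poly_Mapping.lookup a \<in> ?F" if "a \<in> ?A" for a
  proof -
    have le: "Poly_Mapping.lookup a v \<le> Poly_Mapping.lookup m v" for v
      using that by blast
    have "Poly_Mapping.lookup m v \<le> ?M" if "v \<in> ?K" for v
      using that by (intro Max_ge finite_imageI finite_keys imageI)
    then have "Poly_Mapping.lookup a v \<in> {..?M}" if "v \<in> ?K" for v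
      using le that unfolding atMost_iff by (blast intro: order_trans)
    moreover have "Poly_Mapping.lookup a v = 0" if "v \<notin> ?K" for v
      using le[of v] that unfolding in_keys_iff by linarith
    ultimately show ?thesis by blast
  qed
  then have "Poly_Mapping.lookup ` ?A \<subseteq> ?F" by (rule image_subsetI)
  moreover have "finite ?F"
    by (rule finite_set_of_finite_funs) (rule finite_keys, rule finite_atMost)
  ultimately show "finite (Poly_Mapping.lookup ` ?A)"
    by (rule finite_subset)
  show "inj_on Poly_Mapping.lookup ?A"
    by (rule inj_onI) (rule poly_mapping_eqI, simp)
qed

lemma finite_msplits [simp]: "finite (msplits m)"
proof -
  let ?A = "{a :: 'a \<Rightarrow>\<^sub>0 nat. \<forall>v. Poly_Mapping.lookup a v \<le> Poly_Mapping.lookup m v}"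
  have "msplits m \<subseteq> ?A \<times> ?A"
    by (auto simp: msplits_def lookup_add)
  then show ?thesis
    by (rule finite_subset) (simp add: finite_mle)
qed

instantiation mps :: (type) comm_ring_1
begin

definition "0 = Abs_mps (\<lambda>m. 0)"
definition "1 = Abs_mps (\<lambda>m. if m = 0 then 1 else 0)"
definition "f + g = Abs_mps (\<lambda>m. mcoeff f m + mcoeff g m)"
definition "- f = Abs_mps (\<lambda>m. - mcoeff f m)"
definition "f - g = Abs_mps (\<lambda>m. mcoeff f m - mcoeff g m)"
definition "f * g = Abs_mps (\<lambda>m. \<Sum>(a, b)\<in>msplits m. mcoeff f a * mcoeff g b)"

instance
proof
  fix f g h :: "'a mps"
  show "f * g = g * f"
  proof (rule mps_eqI)
    fix m
    have "(\<Sum>(a, b)\<in>msplits m. mcoeff f a * mcoeff g b) = (\<Sum>(a, b)\<in>msplits m. mcoeff g a * mcoeff f b)"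
      by (rule sum.reindex_bij_witness[of _ prod.swap prod.swap])
         (auto simp: msplits_def add.commute)
    then show "mcoeff (f * g) m = mcoeff (g * f) m"
      by (simp add: times_mps_def)
  qed
  show "(f * g) * h = f * (g * h)"
  proof (rule mps_eqI)
    fix m
    have "mcoeff ((f * g) * h) m =
        (\<Sum>x\<in>msplits m. \<Sum>y\<in>msplits (fst x). mcoeff f (fst y) * mcoeff g (snd y) * mcoeff h (snd x))"
      by (simp add: times_mps_def case_prod_unfold sum_distrib_right)
    also have "\<dots> = (\<Sum>(x, y)\<in>(SIGMA x:msplits m. msplits (fst x)).
        mcoeff f (fst y) * mcoeff g (snd y) * mcoeff h (snd x))"
      by (rule sum.Sigma) auto
    also have "\<dots> = (\<Sum>(x, y)\<in>(SIGMA x:msplits m. msplits (snd x)).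
        mcoeff f (fst x) * (mcoeff g (fst y) * mcoeff h (snd y)))"
      by (rule sum.reindex_bij_witness
            [of _ "\<lambda>(x, y). ((fst x + fst y, snd y), (fst x, fst y))"
                  "\<lambda>(x, y). ((fst y, snd y + snd x), (snd y, snd x))"])
         (auto simp: msplits_def add.assoc mult.assoc)
    also have "\<dots> = (\<Sum>x\<in>msplits m. \<Sum>y\<in>msplits (snd x).
        mcoeff f (fst x) * (mcoeff g (fst y) * mcoeff h (snd y)))"
      by (rule sum.Sigma[symmetric]) auto
    also have "\<dots> = mcoeff (f * (g * h)) m"
      by (simp add: times_mps_def case_prod_unfold sum_distrib_left)
    finally show "mcoeff ((f * g) * h) m = mcoeff (f * (g * h)) m" .
  qed
  show "1 * f = f"
  proof (rule mps_eqI)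
    fix m
    have "(\<Sum>(a, b)\<in>msplits m. mcoeff 1 a * mcoeff f b) = (\<Sum>(a, b)\<in>{(0, m)}. mcoeff 1 a * mcoeff f b)"
      by (rule sum.mono_neutral_right[OF finite_msplits]) (auto simp: msplits_def one_mps_def split: if_splits)
    then show "mcoeff (1 * f) m = mcoeff f m"
      by (simp add: times_mps_def one_mps_def)
  qed
  show "(f + g) * h = f * h + g * h"
    by (rule mps_eqI) (simp add: times_mps_def plus_mps_def case_prod_unfold distrib_right sum.distrib)
  show "(0 :: 'a mps) \<noteq> 1"
  proof
    assume "(0 :: 'a mps) = 1"
    then have "mcoeff (0 :: 'a mps) 0 = mcoeff 1 0" by simp
    then show False by (simp add: zero_mps_def one_mps_def)
  qed
qed (auto intro!: mps_eqI simp: zero_mps_def plus_mps_def uminus_mps_def minus_mps_def)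

end

definition mvar :: "'v \<Rightarrow> 'v mps"
  where "mvar v = Abs_mps (\<lambda>m. if m = Poly_Mapping.single v 1 then 1 else 0)"

text \<open>The series \<open>1 / (1 - a u)\<close> in the variable u.\<close>

definition fps_geom :: "'a::comm_ring_1 \<Rightarrow> 'a fps"
  where "fps_geom a = Abs_fps (\<lambda>r. a ^ r)"

lemma fps_geom_inverse: "(1 - fps_const a * fps_X) * fps_geom a = 1"
proof (rule fps_ext)
  fix r
  show "fps_nth ((1 - fps_const a * fps_X) * fps_geom a) r = fps_nth 1 r"
    by (cases r) (simp_all add: fps_geom_def left_diff_distrib mult.assoc)
qed


section \<open>The ring and its operators\<close>

text \<open>Only the variables with positive index are used.\<close>

datatype xzt = VarX nat | VarZ nat | VarT nat

type_synonym ring_elt = "xzt mps"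

abbreviation xv :: "nat \<Rightarrow> ring_elt" where "xv i \<equiv> mvar (VarX i)"
abbreviation zv :: "nat \<Rightarrow> ring_elt" where "zv i \<equiv> mvar (VarZ i)"
abbreviation tv :: "nat \<Rightarrow> ring_elt" where "tv i \<equiv> mvar (VarT i)"

text \<open>
  The infinite product over \<open>i \<ge> 1\<close> of \<open>(1 + x\<^sub>i u) / (1 - x\<^sub>i u)\<close>: each coefficient of the
  partial products is eventually constant, and the infinite product collects these values.
\<close>

definition Q :: "nat \<Rightarrow> ring_elt"
  where "Q r = Abs_mps (\<lambda>m. THE c. eventually
    (\<lambda>N. mcoeff (fps_nth (\<Prod>i=1..N. (1 + fps_const (xv i) * fps_X) * fps_geom (xv i)) r) m = c)
    sequentially)"

definition Qgf :: "ring_elt fps"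
  where "Qgf = Abs_fps Q"

inductive_set subring_gen :: "'a::comm_ring_1 set \<Rightarrow> 'a set" for S where
  gen: "a \<in> S \<Longrightarrow> a \<in> subring_gen S"
| one: "1 \<in> subring_gen S"
| diff: "a \<in> subring_gen S \<Longrightarrow> b \<in> subring_gen S \<Longrightarrow> a - b \<in> subring_gen S"
| mult: "a \<in> subring_gen S \<Longrightarrow> b \<in> subring_gen S \<Longrightarrow> a * b \<in> subring_gen S"

definition Gam :: "ring_elt set"
  where "Gam = subring_gen (Q ` {1..})"

definition Rinf :: "ring_elt set"
  where "Rinf = subring_gen (Gam \<union> tv ` {1..} \<union> zv ` {1..})"

definition Zt :: "ring_elt set"
  where "Zt = subring_gen (tv ` {1..})"

definition is_ring_aut :: "(ring_elt \<Rightarrow> ring_elt) \<Rightarrow> bool"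
  where "is_ring_aut \<phi> \<longleftrightarrow> bij_betw \<phi> Rinf Rinf \<and> \<phi> 1 = 1 \<and>
    (\<forall>f\<in>Rinf. \<forall>g\<in>Rinf. \<phi> (f + g) = \<phi> f + \<phi> g \<and> \<phi> (f * g) = \<phi> f * \<phi> g)"

text \<open>
  The ring automorphism of \<open>Rinf\<close> with prescribed images of the variables t and z and of the
  generating function of the \<open>Q r\<close>.  The values outside \<open>Rinf\<close> are fixed by
  \<^const>\<open>extensional\<close> and are never used.
\<close>

definition ring_aut :: "(nat \<Rightarrow> ring_elt) \<Rightarrow> (nat \<Rightarrow> ring_elt) \<Rightarrow> ring_elt fps \<Rightarrow> ring_elt \<Rightarrow> ring_elt"
  where "ring_aut \<tau> \<zeta> q = (THE \<phi>. \<phi> \<in> extensional Rinf \<and> is_ring_aut \<phi> \<and>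
    (\<forall>i\<ge>1. \<phi> (tv i) = \<tau> i) \<and> (\<forall>i\<ge>1. \<phi> (zv i) = \<zeta> i) \<and> Abs_fps (\<lambda>r. \<phi> (Q r)) = q)"

definition sz :: "nat \<Rightarrow> ring_elt \<Rightarrow> ring_elt"
  where "sz i = (if i = 0
    then ring_aut tv (zv(1 := - zv 1)) ((1 + fps_const (zv 1) * fps_X) * fps_geom (zv 1) * Qgf)
    else ring_aut tv (zv \<circ> transpose i (i + 1)) Qgf)"

definition om :: "ring_elt \<Rightarrow> ring_elt"
  where "om = ring_aut (\<lambda>i. - zv i) (\<lambda>i. - tv i) Qgf"

definition st :: "nat \<Rightarrow> ring_elt \<Rightarrow> ring_elt"
  where "st i = om \<circ> sz i \<circ> om"

definition alpha :: "nat \<Rightarrow> ring_elt"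
  where "alpha i = (if i = 0 then 2 * tv 1 else tv (i + 1) - tv i)"

definition ddz :: "nat \<Rightarrow> ring_elt \<Rightarrow> ring_elt"
  where "ddz i f = (THE g. g \<in> Rinf \<and> om (alpha i) * g = f - sz i f)"

definition ddt :: "nat \<Rightarrow> ring_elt \<Rightarrow> ring_elt"
  where "ddt i f = (THE g. g \<in> Rinf \<and> alpha i * g = f - st i f)"


section \<open>The infinite hyperoctahedral group\<close>

text \<open>The barred number \<open>i\<close> is the integer \<open>- i\<close>; composition is \<open>\<circ>\<close>.\<close>

definition Winf :: "(int \<Rightarrow> int) set"
  where "Winf = {w. w permutes - {0} \<and> (\<forall>i. w (- i) = - w i) \<and> finite {i. w i \<noteq> i}}"

definition gen_s :: "nat \<Rightarrow> int \<Rightarrow> int"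
  where "gen_s i = (if i = 0 then transpose 1 (- 1)
    else transpose (int i) (int i + 1) \<circ> transpose (- int i) (- (int i + 1)))"

definition len :: "(int \<Rightarrow> int) \<Rightarrow> nat"
  where "len w = (LEAST l. \<exists>is. length is = l \<and> w = foldr (\<circ>) (map gen_s is) id)"

definition Wn :: "nat \<Rightarrow> (int \<Rightarrow> int) set"
  where "Wn n = {w \<in> Winf. \<forall>i>int n. w i = i}"

definition WJ :: "nat set \<Rightarrow> (int \<Rightarrow> int) set"
  where "WJ J = {w \<in> Winf. \<forall>i. i \<notin> J \<longrightarrow> len w < len (w \<circ> gen_s i)}"

definition WnJ :: "nat \<Rightarrow> nat set \<Rightarrow> (int \<Rightarrow> int) set"
  where "WnJ n J = Wn n \<inter> WJ J"


section \<open>Double Schubert polynomials\<close>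

definition is_Zt_basis :: "((int \<Rightarrow> int) \<Rightarrow> ring_elt) \<Rightarrow> bool"
  where "is_Zt_basis C \<longleftrightarrow> C ` Winf \<subseteq> Rinf \<and>
    (\<forall>f\<in>Rinf. \<exists>!a. range a \<subseteq> Zt \<and> {w. a w \<noteq> 0} \<subseteq> Winf \<and> finite {w. a w \<noteq> 0} \<and>
      f = (\<Sum>w | a w \<noteq> 0. a w * C w))"

text \<open>The properties that characterise the family of double Schubert polynomials on \<open>Winf\<close>.\<close>

definition double_Schubert :: "((int \<Rightarrow> int) \<Rightarrow> ring_elt) \<Rightarrow> bool"
  where "double_Schubert C \<longleftrightarrow> is_Zt_basis C \<and>
    (\<forall>w\<in>Winf. \<forall>i. ddz i (C w) = (if len (w \<circ> gen_s i) < len w then C (w \<circ> gen_s i) else 0)) \<and>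
    (\<forall>w\<in>Winf. \<forall>i. ddt i (C w) = (if len (gen_s i \<circ> w) < len w then C (gen_s i \<circ> w) else 0)) \<and>
    C id = 1 \<and> (\<forall>w\<in>Winf. w \<noteq> id \<longrightarrow> mcoeff (C w) 0 = 0)"


section \<open>Theta polynomials and the multi Schur-Pfaffian\<close>

definition theta_gf :: "nat \<Rightarrow> int \<Rightarrow> ring_elt fps"
  where "theta_gf \<kappa> l = Qgf * (\<Prod>i=1..\<kappa>. 1 + fps_const (zv i) * fps_X) *
    (if l \<ge> 0 then \<Prod>i=1..nat l. 1 - fps_const (tv i) * fps_X
     else \<Prod>i=1..nat (- l). fps_geom (- tv i))"

definition theta :: "nat \<Rightarrow> int \<Rightarrow> int \<Rightarrow> ring_elt"
  where "theta \<kappa> l r = (if r < 0 then 0 else fps_nth (theta_gf \<kappa> l) (nat r))"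

text \<open>Remove the entry in position s, counted from 1.\<close>

definition omit :: "nat \<Rightarrow> 'a list \<Rightarrow> 'a list"
  where "omit s xs = take (s - 1) xs @ drop s xs"

lemma length_omit [simp]: "1 \<le> s \<Longrightarrow> s \<le> length xs \<Longrightarrow> length (omit s xs) = length xs - 1"
  by (simp add: omit_def)

text \<open>
  An entry is a pair of a sequence c and an index r, not just the value \<open>c r\<close>, because the
  expansion involves other members of the sequence.  Since the expansion is a polynomial in the
  \<open>c r\<close>, substituting ring elements for the variables afterwards is the same as running the
  recursion on the sequences of substituted elements.  The value at the empty list is not used
  by the recursion.
\<close>

function Pf :: "((int \<Rightarrow> 'a::comm_ring_1) \<times> int) list \<Rightarrow> 'a" where
  "Pf [] = 1"
| "Pf [(c, r)] = c r"
| "Pf [(c, r), (d, q)] = c r * d q + 2 * (\<Sum>s=1..nat q. (- 1) ^ s * c (r + int s) * d (q - int s))"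
| "Pf (e1 # e2 # e3 # es) =
    (let xs = e1 # e2 # e3 # es; m = length xs in
     if even m then \<Sum>s=2..m. (- 1) ^ s * Pf [e1, xs ! (s - 1)] * Pf (tl (omit s xs))
     else \<Sum>s=1..m. (- 1) ^ (s - 1) * (case xs ! (s - 1) of (c, r) \<Rightarrow> c r) * Pf (omit s xs))"
  by pat_completeness auto
termination
  by (relation "measure length") simp_all

text \<open>A triple of sequences of equal length is a list of triples \<open>(\<kappa>, r, l)\<close>.\<close>

definition vartheta :: "(nat \<times> int \<times> int) list \<Rightarrow> ((int \<Rightarrow> ring_elt) \<times> int) list"
  where "vartheta B = rev (map (\<lambda>(\<kappa>, r, l). (theta \<kappa> l, r)) B)"

definition Btilde :: "(nat \<Rightarrow> nat) \<Rightarrow> nat \<Rightarrow> (nat \<times> int \<times> int) list"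
  where "Btilde k i = zip (replicate (k (i + 1) - k i) (k i))
    (zip [2 * int (k i) + 1 .. int (k i) + int (k (i + 1))] [int (k i) .. int (k (i + 1)) - 1])"

end

theory Submission
  imports Defs
begin

text \<open>
  The divided differences act on theta polynomials by lowering \<open>\<kappa>\<close> or \<open>l\<close>.  Let f be the
  Pfaffian in question for the longest element \<open>w\<^sub>0\<close> of \<open>W\<^sub>n\<close>.  It satisfies
  \<open>\<partial>\<^sub>i f = \<delta>\<^sub>i f\<close> for all i, because the two sides differ by a multiple of a Pfaffian with two
  equal adjacent entries.  Write \<open>g = f - C w\<^sub>0\<close> in the Schubert basis and let v be of maximal
  length in its support.  As \<open>\<partial>\<^sub>i g = \<delta>\<^sub>i g\<close>, the coefficient of \<open>C v\<close> is killed by all \<open>\<delta>\<^sub>i\<close>,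
  hence is symmetric in infinitely many variables and thus an integer; this integer is the constant
  term of \<open>\<partial> g\<close> along a reduced word of the inverse of v, and it vanishes for reasons of degree.
  So \<open>f = C w\<^sub>0\<close>.  Lowering the entries of f one at a time by operators \<open>\<partial>\<^sub>i\<close> with i not in J leads
  to the Pfaffian for J, so this is \<open>C v\<close> for some v, and v is the longest element of \<open>W\<^sub>n\<^sup>J\<close>.
\<close>

text \<open>The axioms on \<open>C\<close> are all that is available, so \<open>C (w0 n)\<close>
  must be recognised from divided differences alone. The operators \<open>ddz\<close> are linear
  over \<open>Zt\<close> and cannot pin down coefficients in \<open>Zt\<close>; hence the detour
  through the symmetry of \<open>ddz\<close> and \<open>ddt\<close>. Its source is that the entries
  of f are the triples (e, e, 2 e + 1), symmetric under \<open>om\<close>, while \<open>om\<close>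
  conjugates the two families of operators. The degree 2 e + 1 has two roles: it exceeds e + e,
  which makes the pairing of an entry with itself vanish, and it is the number of steps from first
  index e down to - e - 1 and degree 0, where an entry disappears, using only letters up to e. These
  odd numbers add up to the square of n, the length of \<open>w0 n\<close>. The operators are given
  by \<open>THE\<close> on the subring \<open>Rinf\<close>. They are compared with explicit
  substitutions on all power series, where linear forms can be cancelled coefficient by coefficient.
  The substitution for the generator of index 0 merges two variables, so it is an involution on
  \<open>Rinf\<close> but not on all series.\<close>

lemma mcoeff_zero [simp]: "mcoeff 0 m = 0"
  by (simp add: zero_mps_def)

lemma mcoeff_one: "mcoeff 1 m = (if m = 0 then 1 else 0)"
  by (simp add: one_mps_def)

lemma mcoeff_add [simp]: "mcoeff (f + g) m = mcoeff f m + mcoeff g m"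
  by (simp add: plus_mps_def)

lemma mcoeff_diff [simp]: "mcoeff (f - g) m = mcoeff f m - mcoeff g m"
  by (simp add: minus_mps_def)

lemma mcoeff_uminus [simp]: "mcoeff (- f) m = - mcoeff f m"
  by (simp add: uminus_mps_def)

lemma mcoeff_mult: "mcoeff (f * g) m = (\<Sum>(a, b)\<in>msplits m. mcoeff f a * mcoeff g b)"
  by (simp add: times_mps_def)

lemma mcoeff_sum: "mcoeff (sum f A) m = (\<Sum>x\<in>A. mcoeff (f x) m)"
  by (induction A rule: infinite_finite_induct) auto

lemma add_eq_0_poly_mapping_iff:
  fixes a b :: "'v \<Rightarrow>\<^sub>0 nat"
  shows "a + b = 0 \<longleftrightarrow> a = 0 \<and> b = 0"
  by (auto simp: poly_mapping_eq_iff lookup_add fun_eq_iff)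

lemma msplits_0: "msplits (0 :: 'v \<Rightarrow>\<^sub>0 nat) = {(0, 0)}"
  by (auto simp: msplits_def add_eq_0_poly_mapping_iff)

lemma mcoeff_mult_0: "mcoeff (f * g) 0 = mcoeff f 0 * mcoeff g 0"
  by (simp add: mcoeff_mult msplits_0)

lemma mcoeff_mvar_mult:
  "mcoeff (mvar v * f) m =
    (if Poly_Mapping.lookup m v = 0 then 0 else mcoeff f (m - Poly_Mapping.single v 1))"
proof -
  let ?s = "Poly_Mapping.single v (1::nat)"
  have "mcoeff (mvar v * f) m = (\<Sum>(a, b)\<in>msplits m. (if a = ?s then 1 else 0) * mcoeff f b)"
    by (simp add: mcoeff_mult mvar_def)
  also have "\<dots> = (\<Sum>(a, b)\<in>{(a, b). a = ?s \<and> a + b = m}. mcoeff f b)"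
    by (rule sum.mono_neutral_cong_right[OF finite_msplits])
       (auto simp: msplits_def simp del: One_nat_def split: if_splits)
  also have "{(a, b). a = ?s \<and> a + b = m} = (if Poly_Mapping.lookup m v = 0 then {} else {(?s, m - ?s)})"
  proof -
    have "Poly_Mapping.lookup m v > 0" if "?s + b = m" for b
      using that by (auto simp: lookup_add)
    moreover have "?s + (m - ?s) = m" if "Poly_Mapping.lookup m v \<noteq> 0"
      using that by (auto intro!: poly_mapping_eqI simp: lookup_add lookup_minus lookup_single when_def)
    ultimately show ?thesis by auto
  qed
  finally show ?thesis by simp
qed

lemma mcoeff_mvar_mult_add: "mcoeff (mvar v * f) (Poly_Mapping.single v 1 + m) = mcoeff f m"
  by (simp add: mcoeff_mvar_mult lookup_add)

lemma mcoeff_of_int_mult [simp]: "mcoeff (of_int c * f) m = c * mcoeff f m"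
proof (cases c rule: int_cases2)
  case (nonneg j)
  have "mcoeff (of_nat j * f) m = of_nat j * mcoeff f m"
    by (induction j) (auto simp: algebra_simps)
  with nonneg show ?thesis by simp
next
  case (nonpos j)
  have "mcoeff (of_nat j * f) m = of_nat j * mcoeff f m"
    by (induction j) (auto simp: algebra_simps)
  with nonpos show ?thesis by simp
qed

text \<open>Integer coefficients have no 2-torsion. This turns the identities \<open>D = - D\<close>
  that sign changes of Pfaffians produce into \<open>D = 0\<close>.\<close>

lemma mps_double_eq_0:
  fixes f :: "'v mps"
  assumes "2 * f = 0"
  shows "f = 0"
proof (rule mps_eqI)
  fix m
  have "mcoeff (of_int 2 * f) m = 0" using assms by simp
  then show "mcoeff f m = mcoeff 0 m" unfolding mcoeff_of_int_mult by simp
qed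

section \<open>Total degree and order of vanishing\<close>

definition tdeg :: "('v \<Rightarrow>\<^sub>0 nat) \<Rightarrow> nat"
  where "tdeg m = (\<Sum>v\<in>Poly_Mapping.keys m. Poly_Mapping.lookup m v)"

lemma tdeg_superset:
  "finite A \<Longrightarrow> Poly_Mapping.keys m \<subseteq> A \<Longrightarrow> tdeg m = (\<Sum>v\<in>A. Poly_Mapping.lookup m v)"
  unfolding tdeg_def by (rule sum.mono_neutral_left) (auto simp: in_keys_iff)

lemma tdeg_add: "tdeg (a + b) = tdeg a + tdeg b"
proof -
  let ?A = "Poly_Mapping.keys a \<union> Poly_Mapping.keys b"
  have "Poly_Mapping.keys (a + b) \<subseteq> ?A" by (rule Poly_Mapping.keys_add)
  then show ?thesis
    by (simp add: tdeg_superset[of ?A] lookup_add sum.distrib)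
qed

lemma tdeg_single [simp]: "tdeg (Poly_Mapping.single v c) = c"
  by (cases "c = 0") (auto simp: tdeg_def)

lemma tdeg_0 [simp]: "tdeg 0 = 0"
  by (simp add: tdeg_def)

text \<open>The degree argument at the end only has to make a constant term vanish, so a lower bound
  on the degrees of the monomials is enough and no homogeneity is tracked.\<close>

definition ord_ge :: "nat \<Rightarrow> 'v mps \<Rightarrow> bool"
  where "ord_ge d f \<longleftrightarrow> (\<forall>m. tdeg m < d \<longrightarrow> mcoeff f m = 0)"

lemma ord_ge_0 [simp]: "ord_ge 0 f"
  by (simp add: ord_ge_def)

lemma ord_ge_zero [simp]: "ord_ge d 0"
  by (simp add: ord_ge_def)

lemma ord_ge_add: "ord_ge d f \<Longrightarrow> ord_ge d g \<Longrightarrow> ord_ge d (f + g)"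
  by (simp add: ord_ge_def)

lemma ord_ge_diff: "ord_ge d f \<Longrightarrow> ord_ge d g \<Longrightarrow> ord_ge d (f - g)"
  by (simp add: ord_ge_def)

lemma ord_ge_uminus: "ord_ge d f \<Longrightarrow> ord_ge d (- f)"
  by (simp add: ord_ge_def)

lemma ord_ge_sum: "(\<And>x. x \<in> A \<Longrightarrow> ord_ge d (f x)) \<Longrightarrow> ord_ge d (sum f A)"
  by (simp add: ord_ge_def mcoeff_sum)

lemma ord_ge_mono: "ord_ge d f \<Longrightarrow> d' \<le> d \<Longrightarrow> ord_ge d' f"
  by (auto simp: ord_ge_def)

lemma ord_ge_mult:
  assumes "ord_ge d f" "ord_ge e g"
  shows "ord_ge (d + e) (f * g)"
  unfolding ord_ge_def
proof (intro allI impI)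
  fix m :: "'a \<Rightarrow>\<^sub>0 nat" assume m: "tdeg m < d + e"
  have "mcoeff f a * mcoeff g b = 0" if "a + b = m" for a b
  proof -
    have "tdeg a < d \<or> tdeg b < e" using m that tdeg_add[of a b] by auto
    then show ?thesis using assms by (auto simp: ord_ge_def)
  qed
  then show "mcoeff (f * g) m = 0"
    unfolding mcoeff_mult by (intro sum.neutral) (auto simp: msplits_def)
qed

lemma ord_ge_mult_left: "ord_ge d g \<Longrightarrow> ord_ge d (f * g)"
  using ord_ge_mult[of 0 f d g] by simp

lemma ord_ge_power: "ord_ge d f \<Longrightarrow> ord_ge (d * k) (f ^ k)"
  by (induction k) (auto intro: ord_ge_mult)

lemma ord_ge_mvar: "ord_ge 1 (mvar v)"
  by (auto simp: ord_ge_def mvar_def)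

lemma ord_ge_all_imp_eq_0: "(\<And>d. ord_ge d f) \<Longrightarrow> f = 0"
  by (rule mps_eqI) (metis lessI mcoeff_zero ord_ge_def)

text \<open>
  Multiplication by a linear form raises the order by exactly one; this also shows that these
  linear forms are not zero divisors.
\<close>

lemma ord_ge_cancel_diff:
  assumes "ord_ge (Suc d) ((mvar a - mvar b) * g)" "a \<noteq> b"
  shows "ord_ge d g"
  unfolding ord_ge_def
proof (intro allI impI)
  let ?s = "\<lambda>v. Poly_Mapping.single v (1::nat)"
  fix m :: "'a \<Rightarrow>\<^sub>0 nat"
  show "tdeg m < d \<Longrightarrow> mcoeff g m = 0"
  \<comment> \<open>The coefficient of the product at \<open>mvar a\<close> times m relates the
    coefficient of g at m to the one where a factor b is traded for a. The trade keeps the degree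
    and lowers the exponent of b, so the recursion stops at exponent 0.\<close>
  proof (induction "Poly_Mapping.lookup m b" arbitrary: m rule: less_induct)
    case less
    have "mcoeff ((mvar a - mvar b) * g) (?s a + m) = 0"
      using assms(1) less.prems by (auto simp: ord_ge_def tdeg_add)
    then have *: "mcoeff g m = mcoeff (mvar b * g) (?s a + m)"
      by (simp add: left_diff_distrib mcoeff_mvar_mult_add del: One_nat_def)
    show ?case
    proof (cases "Poly_Mapping.lookup m b = 0")
      case True
      then show ?thesis
        using * assms(2) by (simp add: mcoeff_mvar_mult lookup_add lookup_single)
    next
      case False
      let ?m = "?s a + m - ?s b"
      have lk: "Poly_Mapping.lookup ?m b = Poly_Mapping.lookup m b - 1"
        using assms(2) by (simp add: lookup_add lookup_minus lookup_single)
      have "?s b + ?m = ?s a + m"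
        using False by (auto intro!: poly_mapping_eqI simp: lookup_add lookup_minus lookup_single when_def)
      then have "tdeg ?m = tdeg m"
        using tdeg_add[of "?s b" ?m] tdeg_add[of "?s a" m] by simp
      then have "mcoeff g ?m = 0"
        using less.hyps[of ?m] less.prems False lk by simp
      then show ?thesis
        using * by (simp add: mcoeff_mvar_mult)
    qed
  qed
qed

lemma ord_ge_cancel_double:
  assumes "ord_ge (Suc d) (2 * mvar a * g)"
  shows "ord_ge d g"
  unfolding ord_ge_def
proof (intro allI impI)
  fix m :: "'a \<Rightarrow>\<^sub>0 nat" assume "tdeg m < d"
  then have "mcoeff (2 * (mvar a * g)) (Poly_Mapping.single a 1 + m) = 0"
    using assms by (auto simp: ord_ge_def tdeg_add mult.assoc)
  then show "mcoeff g m = 0"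
    unfolding mcoeff_of_int_mult[of 2, simplified] mcoeff_mvar_mult_add by simp
qed


section \<open>Monomial substitutions\<close>

text \<open>Substituting \<open>\<epsilon> v\<close> times the variable \<open>\<rho> v\<close> for
  v sends the monomial m to \<open>mono_coef \<epsilon> m\<close> times
  \<open>mono_map \<rho> m\<close>. Signs serve the reflections, and the value 0 of
  \<open>\<epsilon>\<close> serves the truncation in x.\<close>

definition mono_map :: "('v \<Rightarrow> 'w) \<Rightarrow> ('v \<Rightarrow>\<^sub>0 nat) \<Rightarrow> ('w \<Rightarrow>\<^sub>0 nat)"
  where "mono_map \<rho> m = (\<Sum>v\<in>Poly_Mapping.keys m. Poly_Mapping.single (\<rho> v) (Poly_Mapping.lookup m v))"

definition mono_coef :: "('v \<Rightarrow> int) \<Rightarrow> ('v \<Rightarrow>\<^sub>0 nat) \<Rightarrow> int"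
  where "mono_coef \<epsilon> m = (\<Prod>v\<in>Poly_Mapping.keys m. \<epsilon> v ^ Poly_Mapping.lookup m v)"

lemma mono_map_superset:
  "finite A \<Longrightarrow> Poly_Mapping.keys m \<subseteq> A \<Longrightarrow>
    mono_map \<rho> m = (\<Sum>v\<in>A. Poly_Mapping.single (\<rho> v) (Poly_Mapping.lookup m v))"
  unfolding mono_map_def by (rule sum.mono_neutral_left) (auto simp: in_keys_iff)

lemma mono_coef_superset:
  "finite A \<Longrightarrow> Poly_Mapping.keys m \<subseteq> A \<Longrightarrow>
    mono_coef \<epsilon> m = (\<Prod>v\<in>A. \<epsilon> v ^ Poly_Mapping.lookup m v)"
  unfolding mono_coef_def by (rule prod.mono_neutral_left) (auto simp: in_keys_iff)

lemma mono_map_add: "mono_map \<rho> (a + b) = mono_map \<rho> a + mono_map \<rho> b"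
proof -
  let ?A = "Poly_Mapping.keys a \<union> Poly_Mapping.keys b"
  have "Poly_Mapping.keys (a + b) \<subseteq> ?A" by (rule Poly_Mapping.keys_add)
  then show ?thesis
    by (simp add: mono_map_superset[of ?A] lookup_add sum.distrib single_add)
qed

lemma mono_coef_add: "mono_coef \<epsilon> (a + b) = mono_coef \<epsilon> a * mono_coef \<epsilon> b"
proof -
  let ?A = "Poly_Mapping.keys a \<union> Poly_Mapping.keys b"
  have "Poly_Mapping.keys (a + b) \<subseteq> ?A" by (rule Poly_Mapping.keys_add)
  then show ?thesis
    by (simp add: mono_coef_superset[of ?A] lookup_add prod.distrib power_add)
qed

lemma mono_map_0 [simp]: "mono_map \<rho> 0 = 0"
  by (simp add: mono_map_def)

lemma mono_coef_0 [simp]: "mono_coef \<epsilon> 0 = 1"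
  by (simp add: mono_coef_def)

lemma mono_map_single [simp]: "mono_map \<rho> (Poly_Mapping.single v c) = Poly_Mapping.single (\<rho> v) c"
  by (cases "c = 0") (auto simp: mono_map_def)

lemma mono_coef_single [simp]: "mono_coef \<epsilon> (Poly_Mapping.single v c) = \<epsilon> v ^ c"
  by (cases "c = 0") (auto simp: mono_coef_def)

lemma tdeg_mono_map [simp]: "tdeg (mono_map \<rho> m) = tdeg m"
proof -
  have "tdeg (\<Sum>v\<in>A. Poly_Mapping.single (\<rho> v) (g v)) = (\<Sum>v\<in>A. g v)" if "finite A" for A and g :: "_ \<Rightarrow> nat"
    using that by (induction A) (auto simp: tdeg_add)
  then show ?thesis by (simp add: mono_map_def tdeg_def[of m])
qed

lemma lookup_le_lookup_mono_map:
  "Poly_Mapping.lookup m v \<le> Poly_Mapping.lookup (mono_map \<rho> m) (\<rho> v)"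
proof (cases "v \<in> Poly_Mapping.keys m")
  case True
  have "Poly_Mapping.lookup (mono_map \<rho> m) (\<rho> v) =
      (\<Sum>u\<in>Poly_Mapping.keys m. Poly_Mapping.lookup (Poly_Mapping.single (\<rho> u) (Poly_Mapping.lookup m u)) (\<rho> v))"
    by (simp add: mono_map_def lookup_sum)
  also have "\<dots> \<ge> Poly_Mapping.lookup (Poly_Mapping.single (\<rho> v) (Poly_Mapping.lookup m v)) (\<rho> v)"
    using True by (intro member_le_sum) auto
  finally show ?thesis by simp
qed (simp add: in_keys_iff)

text \<open>Injectivity would be too strong: the substitution for index 0 sends both
  \<open>VarX 1\<close> and \<open>VarZ 1\<close> to \<open>VarZ 1\<close>. Finite fibres suffice
  for the coefficients of the image to be finite sums.\<close>

definition finite_fibres :: "('v \<Rightarrow> 'w) \<Rightarrow> bool"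
  where "finite_fibres \<rho> \<longleftrightarrow> (\<forall>u. finite (\<rho> -` {u}))"

lemma finite_fibres_inj: "inj \<rho> \<Longrightarrow> finite_fibres \<rho>"
  by (auto simp: finite_fibres_def intro: finite_vimageI)

text \<open>Substitution preserves the total degree, which bounds the exponents, and only the
  finitely many variables above the support of \<open>m'\<close> can occur.\<close>

lemma finite_mono_fibre [simp]:
  fixes \<rho> :: "'v \<Rightarrow> 'w"
  assumes "finite_fibres \<rho>"
  shows "finite {m. mono_map \<rho> m = m'}"
proof -
  let ?K = "\<rho> -` Poly_Mapping.keys m'"
  let ?d = "tdeg m'"
  have "?K = (\<Union>u\<in>Poly_Mapping.keys m'. \<rho> -` {u})" by auto
  then have "finite ?K" using assms by (auto simp: finite_fibres_def)
  then have fin: "finite {f. \<forall>v. (v \<in> ?K \<longrightarrow> f v \<in> {..?d}) \<and> (v \<notin> ?K \<longrightarrow> f v = (0::nat))}"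
    by (intro finite_set_of_finite_funs) auto
  have "Poly_Mapping.lookup ` {m. mono_map \<rho> m = m'} \<subseteq>
      {f. \<forall>v. (v \<in> ?K \<longrightarrow> f v \<in> {..?d}) \<and> (v \<notin> ?K \<longrightarrow> f v = 0)}"
  proof (rule image_subsetI)
    fix m :: "'v \<Rightarrow>\<^sub>0 nat" assume "m \<in> {m. mono_map \<rho> m = m'}"
    then have m: "mono_map \<rho> m = m'" by simp
    have "Poly_Mapping.lookup m v \<le> ?d" for v
    proof (cases "v \<in> Poly_Mapping.keys m")
      case True
      then have "Poly_Mapping.lookup m v \<le> tdeg m"
        unfolding tdeg_def by (intro member_le_sum) auto
      then show ?thesis using m tdeg_mono_map[of \<rho> m] by simp
    qed (simp add: in_keys_iff)
    moreover have "Poly_Mapping.lookup m v = 0" if "v \<notin> ?K" for v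
      using that lookup_le_lookup_mono_map[of m v \<rho>] m by (simp add: in_keys_iff)
    ultimately show "Poly_Mapping.lookup m \<in> {f. \<forall>v. (v \<in> ?K \<longrightarrow> f v \<in> {..?d}) \<and> (v \<notin> ?K \<longrightarrow> f v = 0)}"
      by auto
  qed
  then have "finite (Poly_Mapping.lookup ` {m. mono_map \<rho> m = m'})"
    using fin by (rule finite_subset)
  then show ?thesis
    by (rule finite_imageD) (rule inj_onI, rule poly_mapping_eqI, simp)
qed

text \<open>
  The sums are finite if \<open>\<rho>\<close> has finite fibres; otherwise some of them are 0 by convention.
\<close>

definition msubst :: "('v \<Rightarrow> 'w) \<Rightarrow> ('v \<Rightarrow> int) \<Rightarrow> 'v mps \<Rightarrow> 'w mps"
  where "msubst \<rho> \<epsilon> f = Abs_mps (\<lambda>m. \<Sum>m' | mono_map \<rho> m' = m. mono_coef \<epsilon> m' * mcoeff f m')"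

lemma mcoeff_msubst:
  "mcoeff (msubst \<rho> \<epsilon> f) m = (\<Sum>m' | mono_map \<rho> m' = m. mono_coef \<epsilon> m' * mcoeff f m')"
  by (simp add: msubst_def)

lemma msubst_add: "msubst \<rho> \<epsilon> (f + g) = msubst \<rho> \<epsilon> f + msubst \<rho> \<epsilon> g"
  by (rule mps_eqI) (simp add: mcoeff_msubst sum.distrib distrib_left)

lemma msubst_one:
  assumes "finite_fibres \<rho>"
  shows "msubst \<rho> \<epsilon> 1 = 1"
proof (rule mps_eqI)
  fix m :: "'b \<Rightarrow>\<^sub>0 nat"
  have 0: "m' = 0" if "mono_map \<rho> m' = 0" for m' :: "'a \<Rightarrow>\<^sub>0 nat"
  proof (rule poly_mapping_eqI)
    fix v show "Poly_Mapping.lookup m' v = Poly_Mapping.lookup 0 v"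
      using lookup_le_lookup_mono_map[of m' v \<rho>] that by simp
  qed
  have "mcoeff (msubst \<rho> \<epsilon> 1) m = (\<Sum>m' | mono_map \<rho> m' = m. if m' = 0 then 1 else 0)"
    unfolding mcoeff_msubst mcoeff_one by (rule sum.cong) auto
  also have "\<dots> = mcoeff 1 m"
    using assms 0 by (auto simp: mcoeff_one)
  finally show "mcoeff (msubst \<rho> \<epsilon> 1) m = mcoeff 1 m" .
qed

text \<open>A monomial in the fibre of m together with a factorisation of it is the same as a
  factorisation of m together with a preimage of each factor.\<close>

lemma msubst_mult:
  assumes ff: "finite_fibres \<rho>"
  shows "msubst \<rho> \<epsilon> (f * g) = msubst \<rho> \<epsilon> f * msubst \<rho> \<epsilon> g"
proof (rule mps_eqI)
  fix m
  let ?F = "\<lambda>a b. mono_coef \<epsilon> a * mcoeff f a * (mono_coef \<epsilon> b * mcoeff g b)"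
  let ?fib = "\<lambda>m. {m'. mono_map \<rho> m' = m}"
  have "mcoeff (msubst \<rho> \<epsilon> (f * g)) m = (\<Sum>m'\<in>?fib m. \<Sum>(a, b)\<in>msplits m'. ?F a b)"
    unfolding mcoeff_msubst mcoeff_mult sum_distrib_left
    by (intro sum.cong) (auto simp: msplits_def mono_coef_add)
  also have "\<dots> = (\<Sum>(m', a, b)\<in>(SIGMA m':?fib m. msplits m'). ?F a b)"
    using ff by (subst sum.Sigma) (auto intro!: sum.cong)
  also have "\<dots> = (\<Sum>(q, a, b)\<in>(SIGMA q:msplits m. ?fib (fst q) \<times> ?fib (snd q)). ?F a b)"
    by (rule sum.reindex_bij_witness[of _ "\<lambda>(q, a, b). (a + b, a, b)"
          "\<lambda>(m', a, b). ((mono_map \<rho> a, mono_map \<rho> b), a, b)"])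
       (auto simp: msplits_def mono_map_add)
  also have "\<dots> = (\<Sum>q\<in>msplits m. \<Sum>(a, b)\<in>?fib (fst q) \<times> ?fib (snd q). ?F a b)"
    using ff by (subst sum.Sigma) (auto intro!: sum.cong)
  also have "\<dots> = mcoeff (msubst \<rho> \<epsilon> f * msubst \<rho> \<epsilon> g) m"
    unfolding mcoeff_mult mcoeff_msubst
    by (intro sum.cong) (auto simp: sum_product sum.cartesian_product)
  finally show "mcoeff (msubst \<rho> \<epsilon> (f * g)) m = mcoeff (msubst \<rho> \<epsilon> f * msubst \<rho> \<epsilon> g) m" .
qed

lemma mono_map_comp: "mono_map \<rho>' (mono_map \<rho> m) = mono_map (\<rho>' \<circ> \<rho>) m"
proof -
  have "mono_map \<rho>' (\<Sum>v\<in>A. Poly_Mapping.single (\<rho> v) (h v)) =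
      (\<Sum>v\<in>A. Poly_Mapping.single (\<rho>' (\<rho> v)) (h v))" if "finite A" for A h
    using that by induction (auto simp: mono_map_add)
  then show ?thesis by (simp add: mono_map_def[of \<rho>] mono_map_def[of "\<rho>' \<circ> \<rho>"])
qed

lemma mono_coef_comp:
  "mono_coef \<epsilon>' (mono_map \<rho> m) * mono_coef \<epsilon> m = mono_coef (\<lambda>v. \<epsilon>' (\<rho> v) * \<epsilon> v) m"
proof -
  have "mono_coef \<epsilon>' (\<Sum>v\<in>A. Poly_Mapping.single (\<rho> v) (h v)) = (\<Prod>v\<in>A. \<epsilon>' (\<rho> v) ^ h v)"
    if "finite A" for A h
    using that by induction (auto simp: mono_coef_add)
  then have "mono_coef \<epsilon>' (mono_map \<rho> m) = (\<Prod>v\<in>Poly_Mapping.keys m. \<epsilon>' (\<rho> v) ^ Poly_Mapping.lookup m v)"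
    by (simp add: mono_map_def)
  then show ?thesis
    by (simp add: mono_coef_def power_mult_distrib prod.distrib)
qed

lemma msubst_msubst:
  assumes "finite_fibres \<rho>" "finite_fibres \<rho>'"
  shows "msubst \<rho>' \<epsilon>' (msubst \<rho> \<epsilon> f) = msubst (\<rho>' \<circ> \<rho>) (\<lambda>v. \<epsilon>' (\<rho> v) * \<epsilon> v) f"
proof (rule mps_eqI)
  fix m
  let ?fib = "\<lambda>\<rho> m. {m'. mono_map \<rho> m' = m}"
  have "mcoeff (msubst \<rho>' \<epsilon>' (msubst \<rho> \<epsilon> f)) m =
      (\<Sum>m'\<in>?fib \<rho>' m. \<Sum>a\<in>?fib \<rho> m'. mono_coef \<epsilon>' m' * (mono_coef \<epsilon> a * mcoeff f a))"
    unfolding mcoeff_msubst sum_distrib_left ..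
  also have "\<dots> = (\<Sum>(m', a)\<in>(SIGMA m':?fib \<rho>' m. ?fib \<rho> m'). mono_coef \<epsilon>' m' * (mono_coef \<epsilon> a * mcoeff f a))"
    using assms by (subst sum.Sigma) auto
  also have "\<dots> = (\<Sum>a\<in>?fib (\<rho>' \<circ> \<rho>) m. mono_coef (\<lambda>v. \<epsilon>' (\<rho> v) * \<epsilon> v) a * mcoeff f a)"
    by (rule sum.reindex_bij_witness[of _ "\<lambda>a. (mono_map \<rho> a, a)" snd])
       (auto simp: mono_map_comp mono_coef_comp[symmetric])
  finally show "mcoeff (msubst \<rho>' \<epsilon>' (msubst \<rho> \<epsilon> f)) m =
      mcoeff (msubst (\<rho>' \<circ> \<rho>) (\<lambda>v. \<epsilon>' (\<rho> v) * \<epsilon> v) f) m"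
    by (simp add: mcoeff_msubst)
qed

lemma mono_map_id [simp]: "mono_map id m = m"
proof (rule poly_mapping_eqI)
  fix v
  have "Poly_Mapping.lookup (mono_map id m) v =
      (\<Sum>u\<in>Poly_Mapping.keys m. if u = v then Poly_Mapping.lookup m u else 0)"
    by (simp add: mono_map_def lookup_sum lookup_single when_def)
  then show "Poly_Mapping.lookup (mono_map id m) v = Poly_Mapping.lookup m v"
    by (auto simp: in_keys_iff)
qed

lemma msubst_id: "msubst id (\<lambda>v. 1) f = f"
  by (rule mps_eqI) (simp add: mcoeff_msubst mono_coef_def)

lemma msubst_mvar:
  assumes "finite_fibres \<rho>"
  shows "msubst \<rho> \<epsilon> (mvar v) = of_int (\<epsilon> v) * mvar (\<rho> v)"
proof (rule mps_eqI)
  fix m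
  let ?s = "Poly_Mapping.single v (1::nat)"
  have "mcoeff (msubst \<rho> \<epsilon> (mvar v)) m =
      (\<Sum>m' | mono_map \<rho> m' = m. if m' = ?s then \<epsilon> v else 0)"
    unfolding mcoeff_msubst by (rule sum.cong) (auto simp: mvar_def simp del: One_nat_def)
  also have "\<dots> = mcoeff (of_int (\<epsilon> v) * mvar (\<rho> v)) m"
    unfolding mcoeff_of_int_mult using assms by (auto simp: mvar_def simp del: One_nat_def)
  finally show "mcoeff (msubst \<rho> \<epsilon> (mvar v)) m = mcoeff (of_int (\<epsilon> v) * mvar (\<rho> v)) m" .
qed

section \<open>Ring homomorphisms between whole types\<close>

locale rhom =
  fixes \<phi> :: "'a::comm_ring_1 \<Rightarrow> 'b::comm_ring_1"
  assumes one [simp]: "\<phi> 1 = 1"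
    and add: "\<phi> (f + g) = \<phi> f + \<phi> g"
    and mult: "\<phi> (f * g) = \<phi> f * \<phi> g"
begin

lemma zero [simp]: "\<phi> 0 = 0"
  using add[of 0 0] by simp

lemma uminus: "\<phi> (- f) = - \<phi> f"
  using add[of f "- f"] by (simp add: eq_neg_iff_add_eq_0 add.commute)

lemma diff: "\<phi> (f - g) = \<phi> f - \<phi> g"
  using add[of f "- g"] by (simp add: uminus)

lemma sum: "\<phi> (sum h A) = (\<Sum>x\<in>A. \<phi> (h x))"
  by (induction A rule: infinite_finite_induct) (auto simp: add)

lemma prod: "\<phi> (prod h A) = (\<Prod>x\<in>A. \<phi> (h x))"
  by (induction A rule: infinite_finite_induct) (auto simp: mult)

lemma power: "\<phi> (f ^ n) = \<phi> f ^ n"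
  by (induction n) (auto simp: mult)

lemma two: "\<phi> 2 = 2"
  using add[of 1 1] by simp

end

lemma rhom_msubst: "finite_fibres \<rho> \<Longrightarrow> rhom (msubst \<rho> \<epsilon>)"
  by unfold_locales (auto simp: msubst_one msubst_add msubst_mult)

section \<open>Generating functions\<close>

definition fps_lift :: "('a \<Rightarrow> 'b) \<Rightarrow> 'a fps \<Rightarrow> 'b fps"
  where "fps_lift \<phi> F = Abs_fps (\<lambda>r. \<phi> (fps_nth F r))"

lemma fps_lift_nth [simp]: "fps_nth (fps_lift \<phi> F) r = \<phi> (fps_nth F r)"
  by (simp add: fps_lift_def)

lemma (in rhom) rhom_fps_lift: "rhom (fps_lift \<phi>)"
  by unfold_locales (auto intro!: fps_ext simp: add fps_mult_nth sum mult fps_one_nth)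

lemma (in rhom) fps_lift_const [simp]: "fps_lift \<phi> (fps_const c) = fps_const (\<phi> c)"
  by (rule fps_ext) auto

lemma (in rhom) fps_lift_X [simp]: "fps_lift \<phi> fps_X = fps_X"
  by (rule fps_ext) (auto simp: fps_X_def)

definition fps_lin :: "'a::comm_ring_1 \<Rightarrow> 'a fps"
  where "fps_lin a = 1 + fps_const a * fps_X"

lemma (in rhom) fps_lift_lin [simp]: "fps_lift \<phi> (fps_lin a) = fps_lin (\<phi> a)"
proof -
  interpret L: rhom "fps_lift \<phi>" by (rule rhom_fps_lift)
  show ?thesis by (simp add: fps_lin_def L.add L.mult)
qed

lemma (in rhom) fps_lift_geom [simp]: "fps_lift \<phi> (fps_geom a) = fps_geom (\<phi> a)"
  by (rule fps_ext) (auto simp: fps_geom_def power)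

lemma fps_lin_neg_geom: "fps_lin (- a) * fps_geom a = 1"
  using fps_geom_inverse[of a] by (simp add: fps_lin_def flip: fps_const_neg)

lemma fps_geom_0 [simp]: "fps_geom 0 = 1"
  by (rule fps_ext) (auto simp: fps_geom_def power_0_left fps_one_nth)

lemma fps_lin_0 [simp]: "fps_lin 0 = 1"
  by (simp add: fps_lin_def)

lemma fps_lin_nth_0 [simp]: "fps_nth (fps_lin a) 0 = 1"
  by (simp add: fps_lin_def)

lemma fps_geom_nth_0 [simp]: "fps_nth (fps_geom a) 0 = 1"
  by (simp add: fps_geom_def)

text \<open>The substitution of -u for u. The product of a generating function with its image
  carries the quadratic relations among the coefficients.\<close>

definition fps_neg_arg :: "'a::comm_ring_1 fps \<Rightarrow> 'a fps"
  where "fps_neg_arg F = Abs_fps (\<lambda>r. (- 1) ^ r * fps_nth F r)"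

lemma fps_neg_arg_nth [simp]: "fps_nth (fps_neg_arg F) r = (- 1) ^ r * fps_nth F r"
  by (simp add: fps_neg_arg_def)

interpretation neg_arg: rhom fps_neg_arg
proof
  fix F G :: "'a fps"
  have "(- 1) ^ r * (\<Sum>i\<le>r. fps_nth F i * fps_nth G (r - i)) =
      (\<Sum>i\<le>r. (- 1) ^ i * fps_nth F i * ((- 1) ^ (r - i) * fps_nth G (r - i)))" for r
    unfolding sum_distrib_left
  proof (rule sum.cong[OF refl])
    fix i assume "i \<in> {..r}"
    then have "(- 1 :: 'a) ^ r = (- 1) ^ i * (- 1) ^ (r - i)" by (simp add: power_add[symmetric])
    then show "(- 1) ^ r * (fps_nth F i * fps_nth G (r - i)) = (- 1) ^ i * fps_nth F i * ((- 1) ^ (r - i) * fps_nth G (r - i))"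
      by (simp add: mult_ac)
  qed
  then show "fps_neg_arg (F * G) = fps_neg_arg F * fps_neg_arg G"
    by (intro fps_ext) (simp add: fps_mult_nth atMost_atLeast0)
qed (auto intro!: fps_ext simp: fps_one_nth algebra_simps)

lemma fps_neg_arg_lin [simp]: "fps_neg_arg (fps_lin a) = fps_lin (- a)"
  by (rule fps_ext) (auto simp: fps_lin_def fps_one_nth fps_X_def)

lemma fps_neg_arg_geom [simp]: "fps_neg_arg (fps_geom a) = fps_geom (- a)"
  by (rule fps_ext) (simp add: fps_geom_def power_mult_distrib[symmetric])

definition graded_ord :: "'v mps fps \<Rightarrow> bool"
  where "graded_ord F \<longleftrightarrow> (\<forall>r. ord_ge r (fps_nth F r))"

lemma graded_ord_mult: "graded_ord F \<Longrightarrow> graded_ord G \<Longrightarrow> graded_ord (F * G)"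
  unfolding graded_ord_def fps_mult_nth
proof (intro allI ord_ge_sum)
  fix r i :: nat assume *: "\<forall>r. ord_ge r (fps_nth F r)" "\<forall>r. ord_ge r (fps_nth G r)" and "i \<in> {0..r}"
  then show "ord_ge r (fps_nth F i * fps_nth G (r - i))"
    using ord_ge_mult[of i "fps_nth F i" "r - i" "fps_nth G (r - i)"] by auto
qed

lemma graded_ord_one: "graded_ord 1"
  by (simp add: graded_ord_def fps_one_nth)

lemma graded_ord_prod: "(\<And>i. i \<in> A \<Longrightarrow> graded_ord (F i)) \<Longrightarrow> graded_ord (prod F A)"
  by (induction A rule: infinite_finite_induct) (auto intro: graded_ord_mult graded_ord_one)

lemma graded_ord_lin: "ord_ge 1 a \<Longrightarrow> graded_ord (fps_lin a)"
  by (auto simp: graded_ord_def fps_lin_def fps_one_nth fps_X_def)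

lemma graded_ord_geom: "ord_ge 1 a \<Longrightarrow> graded_ord (fps_geom a)"
  using ord_ge_power[of 1 a] by (auto simp: graded_ord_def fps_geom_def)

definition fps_coeffs_in :: "'a set \<Rightarrow> 'a fps \<Rightarrow> bool"
  where "fps_coeffs_in S F \<longleftrightarrow> (\<forall>r. fps_nth F r \<in> S)"

text \<open>
  Truncation to finitely many x-variables turns the infinite product into a finite one, which
  transfers identities from the finite products to \<open>Q\<close>.
\<close>

definition x_trunc :: "nat \<Rightarrow> ring_elt \<Rightarrow> ring_elt"
  where "x_trunc N = msubst id (\<lambda>v. case v of VarX i \<Rightarrow> if i > N then 0 else 1 | _ \<Rightarrow> 1)"

lemma finite_fibres_id [simp]: "finite_fibres id"
  by (simp add: finite_fibres_inj)

interpretation x_trunc: rhom "x_trunc N" for N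
  unfolding x_trunc_def by (rule rhom_msubst) simp

definition x_bounded :: "nat \<Rightarrow> (xzt \<Rightarrow>\<^sub>0 nat) \<Rightarrow> bool"
  where "x_bounded N m \<longleftrightarrow> (\<forall>i. VarX i \<in> Poly_Mapping.keys m \<longrightarrow> i \<le> N)"

lemma mcoeff_x_trunc: "mcoeff (x_trunc N f) m = (if x_bounded N m then mcoeff f m else 0)"
proof -
  let ?e = "\<lambda>v. case v of VarX i \<Rightarrow> if i > N then 0 else 1 | _ \<Rightarrow> (1::int)"
  have "mono_coef ?e m = 1" if "x_bounded N m"
    unfolding mono_coef_def
    by (rule prod.neutral) (use that in \<open>auto simp: x_bounded_def split: xzt.splits\<close>)
  moreover have "mono_coef ?e m = 0" if "\<not> x_bounded N m"
  proof -
    from that obtain i where "VarX i \<in> Poly_Mapping.keys m" "i > N" by (auto simp: x_bounded_def)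
    then show ?thesis
      unfolding mono_coef_def by (intro prod_zero) (auto intro!: bexI[of _ "VarX i"] simp: in_keys_iff)
  qed
  ultimately show ?thesis by (simp add: x_trunc_def mcoeff_msubst)
qed

lemma ex_x_bounded: "\<exists>N. x_bounded N m"
proof -
  have "finite {i. VarX i \<in> Poly_Mapping.keys m}"
    using finite_vimageI[OF finite_keys[of m], of VarX] by (simp add: inj_def vimage_def)
  then obtain N where "\<forall>i\<in>{i. VarX i \<in> Poly_Mapping.keys m}. i \<le> N"
    using finite_nat_set_iff_bounded_le by auto
  then show ?thesis by (auto simp: x_bounded_def)
qed

text \<open>A monomial involves only finitely many x-variables and therefore survives some
  truncation.\<close>

lemma x_trunc_eqI:
  assumes "\<And>N. x_trunc N f = x_trunc N g"
  shows "f = g"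
proof (rule mps_eqI)
  fix m
  obtain N where N: "x_bounded N m" using ex_x_bounded by blast
  have "mcoeff (x_trunc N f) m = mcoeff (x_trunc N g) m" by (simp only: assms)
  with N show "mcoeff f m = mcoeff g m" by (simp add: mcoeff_x_trunc)
qed

lemma x_trunc_fps_eqI:
  assumes "\<And>N. fps_lift (x_trunc N) F = fps_lift (x_trunc N) G"
  shows "F = G"
proof (rule fps_ext, rule x_trunc_eqI)
  fix r N
  show "x_trunc N (fps_nth F r) = x_trunc N (fps_nth G r)"
    using assms[of N] fps_lift_nth by metis
qed

lemma x_trunc_xv: "x_trunc N (xv i) = (if i > N then 0 else xv i)"
  by (simp add: x_trunc_def msubst_mvar)

lemma x_trunc_zv [simp]: "x_trunc N (zv i) = zv i"
  by (simp add: x_trunc_def msubst_mvar)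

definition Qpart :: "nat \<Rightarrow> ring_elt fps"
  where "Qpart N = (\<Prod>i=1..N. fps_lin (xv i) * fps_geom (xv i))"

lemma x_trunc_Qpart: "N \<le> M \<Longrightarrow> fps_lift (x_trunc N) (Qpart M) = Qpart N"
proof -
  assume NM: "N \<le> M"
  interpret L: rhom "fps_lift (x_trunc N)" by (rule x_trunc.rhom_fps_lift)
  show ?thesis
    unfolding Qpart_def L.prod L.mult using NM
    by (intro prod.mono_neutral_cong_right) (auto simp: x_trunc_xv)
qed

lemma mcoeff_Qpart:
  assumes "x_bounded N m" "N \<le> M"
  shows "mcoeff (fps_nth (Qpart M) r) m = mcoeff (fps_nth (Qpart N) r) m"
proof -
  have "fps_nth (Qpart N) r = x_trunc N (fps_nth (Qpart M) r)"
    using x_trunc_Qpart[OF assms(2)] by (auto simp: fps_eq_iff)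
  with assms(1) show ?thesis by (simp add: mcoeff_x_trunc)
qed

text \<open>Factors with index beyond N do not change coefficients of monomials in the first N
  x-variables. The sequence in the definition of \<open>Q\<close> is thus constant from N on, and
  \<open>THE\<close> picks that value.\<close>

lemma mcoeff_Q:
  assumes "x_bounded N m"
  shows "mcoeff (Q r) m = mcoeff (fps_nth (Qpart N) r) m"
proof -
  have ev: "eventually (\<lambda>M. mcoeff (fps_nth (Qpart M) r) m = mcoeff (fps_nth (Qpart N) r) m) sequentially"
    unfolding eventually_sequentially using mcoeff_Qpart[OF assms] by blast
  have "(THE c. eventually (\<lambda>M. mcoeff (fps_nth (Qpart M) r) m = c) sequentially) =
      mcoeff (fps_nth (Qpart N) r) m"
  proof (rule the_equality, rule ev)
    fix c assume "eventually (\<lambda>M. mcoeff (fps_nth (Qpart M) r) m = c) sequentially"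
    with ev have "eventually (\<lambda>M. c = mcoeff (fps_nth (Qpart N) r) m) sequentially"
      by eventually_elim simp
    then show "c = mcoeff (fps_nth (Qpart N) r) m" by simp
  qed
  then show ?thesis by (simp add: Q_def Qpart_def fps_lin_def)
qed

lemma x_trunc_Qgf: "fps_lift (x_trunc N) Qgf = Qpart N"
proof (intro fps_ext mps_eqI)
  fix r m
  have "fps_nth (Qpart N) r = x_trunc N (fps_nth (Qpart N) r)"
    using x_trunc_Qpart[of N N] by (auto simp: fps_eq_iff)
  then have "mcoeff (fps_nth (Qpart N) r) m = mcoeff (x_trunc N (fps_nth (Qpart N) r)) m"
    by simp
  then show "mcoeff (fps_nth (fps_lift (x_trunc N) Qgf) r) m = mcoeff (fps_nth (Qpart N) r) m"
    by (auto simp: mcoeff_x_trunc mcoeff_Q Qgf_def split: if_splits)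
qed

lemma Q_0 [simp]: "Q 0 = 1"
proof (rule x_trunc_eqI)
  fix N
  have "fps_nth (Qpart N) 0 = 1"
    unfolding Qpart_def by (induction N) (auto simp: fps_mult_nth_0)
  then show "x_trunc N (Q 0) = x_trunc N 1"
    using arg_cong[OF x_trunc_Qgf[of N], of "\<lambda>F. fps_nth F 0"] by (simp add: Qgf_def)
qed

lemma Qgf_nth [simp]: "fps_nth Qgf r = Q r"
  by (simp add: Qgf_def)

lemma graded_ord_Qgf: "graded_ord Qgf"
  unfolding graded_ord_def ord_ge_def
proof (intro allI impI)
  fix r and m :: "xzt \<Rightarrow>\<^sub>0 nat" assume "tdeg m < r"
  obtain N where N: "x_bounded N m" using ex_x_bounded by blast
  have "graded_ord (Qpart N)"
    unfolding Qpart_def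
    by (intro graded_ord_prod graded_ord_mult graded_ord_lin graded_ord_geom ord_ge_mvar)
  then show "mcoeff (fps_nth Qgf r) m = 0"
    using N \<open>tdeg m < r\<close> unfolding Qgf_nth by (simp add: mcoeff_Q graded_ord_def ord_ge_def)
qed

text \<open>Replacing u by -u inverts each factor \<open>(1 + x u) / (1 - x u)\<close>, so the
  identity is clear for the finite products and is carried over by truncation.\<close>

lemma Qgf_neg_arg: "Qgf * fps_neg_arg Qgf = 1"
proof (rule x_trunc_fps_eqI)
  fix N
  interpret L: rhom "fps_lift (x_trunc N)" by (rule x_trunc.rhom_fps_lift)
  have "x_trunc N ((- 1) ^ r * f) = (- 1) ^ r * x_trunc N f" for r f
    by (simp add: x_trunc.mult x_trunc.power x_trunc.uminus)
  then have c: "fps_lift (x_trunc N) (fps_neg_arg Qgf) = fps_neg_arg (fps_lift (x_trunc N) Qgf)"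
    by (intro fps_ext) simp
  have "Qpart N * fps_neg_arg (Qpart N) =
      (\<Prod>i=1..N. (fps_lin (- xv i) * fps_geom (xv i)) * (fps_lin (- (- xv i)) * fps_geom (- xv i)))"
    unfolding Qpart_def neg_arg.prod neg_arg.mult prod.distrib[symmetric]
    by (intro prod.cong) (auto simp: mult_ac)
  also have "\<dots> = 1"
    unfolding fps_lin_neg_geom by simp
  finally show "fps_lift (x_trunc N) (Qgf * fps_neg_arg Qgf) = fps_lift (x_trunc N) 1"
    by (simp add: L.mult c x_trunc_Qgf)
qed

text \<open>Such a substitution commutes with truncation in x and visibly fixes the finite products.
  The conditions \<open>nX\<close> prevent other variables from landing on x-variables that a
  truncation would kill.\<close>

lemma msubst_Qgf_fixed:
  assumes ff: "finite_fibres \<rho>"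
    and X: "\<And>j. \<rho> (VarX j) = VarX j" "\<And>j. \<epsilon> (VarX j) = 1"
    and nX: "\<And>j. \<rho> (VarZ j) \<notin> range VarX" "\<And>j. \<rho> (VarT j) \<notin> range VarX"
  shows "fps_lift (msubst \<rho> \<epsilon>) Qgf = Qgf"
proof (rule x_trunc_fps_eqI)
  fix N
  interpret S: rhom "msubst \<rho> \<epsilon>" by (rule rhom_msubst[OF ff])
  interpret L: rhom "fps_lift (msubst \<rho> \<epsilon>)" by (rule S.rhom_fps_lift)
  let ?t = "\<lambda>v. case v of VarX i \<Rightarrow> if i > N then 0 else 1 | _ \<Rightarrow> (1::int)"
  have t1: "?t (\<rho> v) = ?t v" for v
  proof (cases v)
    case (VarZ j)
    then show ?thesis using nX(1)[of j] by (cases "\<rho> (VarZ j)") auto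
  next
    case (VarT j)
    then show ?thesis using nX(2)[of j] by (cases "\<rho> (VarT j)") auto
  qed (simp add: X)
  have "x_trunc N (msubst \<rho> \<epsilon> f) = msubst \<rho> \<epsilon> (x_trunc N f)" for f
    unfolding x_trunc_def using ff by (simp add: msubst_msubst t1 mult.commute)
  then have "fps_lift (x_trunc N) (fps_lift (msubst \<rho> \<epsilon>) Qgf) =
      fps_lift (msubst \<rho> \<epsilon>) (fps_lift (x_trunc N) Qgf)"
    by (intro fps_ext) simp
  also have "\<dots> = Qpart N"
    by (simp add: x_trunc_Qgf Qpart_def L.prod L.mult msubst_mvar[OF ff] X)
  finally show "fps_lift (x_trunc N) (fps_lift (msubst \<rho> \<epsilon>) Qgf) = fps_lift (x_trunc N) Qgf"
    by (simp add: x_trunc_Qgf)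
qed

section \<open>The automorphisms as explicit substitutions\<close>

definition Omega :: "ring_elt \<Rightarrow> ring_elt"
  where "Omega = msubst
    (\<lambda>v. case v of VarX j \<Rightarrow> VarX j | VarZ j \<Rightarrow> VarT j | VarT j \<Rightarrow> VarZ j)
    (\<lambda>v. case v of VarX j \<Rightarrow> 1 | VarZ j \<Rightarrow> -1 | VarT j \<Rightarrow> -1)"

text \<open>
  For \<open>i = 0\<close> the variable \<open>z\<^sub>1\<close> is inserted as a new first x-variable: this multiplies the
  generating function of the Q by \<open>(1 + z\<^sub>1 u) / (1 - z\<^sub>1 u)\<close>.
\<close>

definition sigma :: "nat \<Rightarrow> ring_elt \<Rightarrow> ring_elt"
  where "sigma i = (if i = 0
    then msubst (\<lambda>v. case v of VarX j \<Rightarrow> if j = 0 then VarX 0 else if j = 1 then VarZ 1 else VarX (j - 1) | _ \<Rightarrow> v)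
      (\<lambda>v. if v = VarZ 1 then -1 else 1)
    else msubst (\<lambda>v. case v of VarZ j \<Rightarrow> VarZ (transpose i (i + 1) j) | _ \<Rightarrow> v) (\<lambda>v. 1))"

lemma finite_fibres_Omega:
  "finite_fibres (\<lambda>v. case v of VarX j \<Rightarrow> VarX j | VarZ j \<Rightarrow> VarT j | VarT j \<Rightarrow> VarZ j)"
  by (rule finite_fibres_inj) (auto intro!: injI split: xzt.splits)

lemma finite_fibres_sigma_0:
  "finite_fibres (\<lambda>v. case v of VarX j \<Rightarrow> if j = 0 then VarX 0 else if j = 1 then VarZ 1 else VarX (j - 1) | _ \<Rightarrow> v)"
    (is "finite_fibres ?\<rho>")
  unfolding finite_fibres_def
proof
  fix u
  have "?\<rho> -` {u} \<subseteq> {u, VarX 1} \<union> (case u of VarX j \<Rightarrow> {VarX (Suc j)} | _ \<Rightarrow> {})"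
    by (auto split: xzt.splits if_splits)
  moreover have "finite ({u, VarX 1} \<union> (case u of VarX j \<Rightarrow> {VarX (Suc j)} | _ \<Rightarrow> {}))"
    by (auto split: xzt.splits)
  ultimately show "finite (?\<rho> -` {u})" by (rule finite_subset)
qed

lemma finite_fibres_sigma:
  "finite_fibres (\<lambda>v. case v of VarZ j \<Rightarrow> VarZ (transpose i (i + 1) j) | _ \<Rightarrow> v)"
  by (rule finite_fibres_inj) (auto intro!: injI split: xzt.splits simp: transpose_eq_iff)

interpretation Omega: rhom Omega
  unfolding Omega_def by (rule rhom_msubst[OF finite_fibres_Omega])

interpretation sigma: rhom "sigma i" for i
  unfolding sigma_def
  by (cases "i = 0") (simp_all add: rhom_msubst finite_fibres_sigma_0 finite_fibres_sigma[simplified])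

interpretation OmegaL: rhom "fps_lift Omega"
  by (rule Omega.rhom_fps_lift)

interpretation sigmaL: rhom "fps_lift (sigma i)" for i
  by (rule sigma.rhom_fps_lift)

lemma Omega_zv [simp]: "Omega (zv i) = - tv i" and Omega_tv [simp]: "Omega (tv i) = - zv i"
  by (simp_all add: Omega_def msubst_mvar finite_fibres_Omega)

lemma Omega_Omega [simp]: "Omega (Omega f) = f"
proof -
  have 1: "(\<lambda>v. case v of VarX j \<Rightarrow> VarX j | VarZ j \<Rightarrow> VarT j | VarT j \<Rightarrow> VarZ j) \<circ>
      (\<lambda>v. case v of VarX j \<Rightarrow> VarX j | VarZ j \<Rightarrow> VarT j | VarT j \<Rightarrow> VarZ j) = id"
    by (auto simp: fun_eq_iff split: xzt.splits)
  show ?thesis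
    unfolding Omega_def msubst_msubst[OF finite_fibres_Omega finite_fibres_Omega] 1
    by (subst msubst_id[symmetric]) (auto intro!: arg_cong2[where f = "msubst id"] split: xzt.splits)
qed

lemma Omega_Qgf [simp]: "fps_lift Omega Qgf = Qgf"
  unfolding Omega_def by (rule msubst_Qgf_fixed) (auto simp: finite_fibres_Omega)

lemma sigma_tv [simp]: "sigma i (tv j) = tv j"
  by (simp add: sigma_def msubst_mvar finite_fibres_sigma_0 finite_fibres_sigma[simplified])

lemma sigma_zv: "sigma i (zv j) = (if i = 0 then if j = 1 then - zv 1 else zv j else zv (transpose i (i + 1) j))"
  by (simp add: sigma_def msubst_mvar finite_fibres_sigma_0[simplified] finite_fibres_sigma[simplified])

lemma sigma_Qgf: "i > 0 \<Longrightarrow> fps_lift (sigma i) Qgf = Qgf"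
  unfolding sigma_def by (simp, rule msubst_Qgf_fixed) (auto simp: finite_fibres_sigma[simplified])

lemma sigma_0_Qgf: "fps_lift (sigma 0) Qgf = fps_lin (zv 1) * fps_geom (zv 1) * Qgf"
proof (rule x_trunc_fps_eqI)
  fix N
  interpret L: rhom "fps_lift (x_trunc N)" by (rule x_trunc.rhom_fps_lift)
  let ?\<rho> = "\<lambda>v. case v of VarX j \<Rightarrow> if j = 0 then VarX 0 else if j = 1 then VarZ 1 else VarX (j - 1) | _ \<Rightarrow> v"
  let ?\<epsilon> = "\<lambda>v. if v = VarZ 1 then -1 else (1::int)"
  let ?t = "\<lambda>N v. case v of VarX i \<Rightarrow> if i > N then 0 else 1 | _ \<Rightarrow> (1::int)"
  \<comment> \<open>One x-variable is turned into \<open>VarZ 1\<close> and the others move down by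
    one, so cutting at N after the substitution amounts to cutting at \<open>Suc N\<close> before
    it.\<close>
  have t1: "?t N (?\<rho> v) * ?\<epsilon> v = ?\<epsilon> v * ?t (Suc N) v" for v
    by (cases v) auto
  have "x_trunc N (sigma 0 f) = sigma 0 (x_trunc (Suc N) f)" for f
  proof -
    have "x_trunc N (sigma 0 f) = msubst ?\<rho> (\<lambda>v. ?t N (?\<rho> v) * ?\<epsilon> v) f"
      unfolding x_trunc_def sigma_def if_P[OF refl]
      by (subst msubst_msubst[OF finite_fibres_sigma_0 finite_fibres_id]) (simp only: id_comp)
    also have "\<dots> = sigma 0 (x_trunc (Suc N) f)"
      unfolding t1 x_trunc_def sigma_def if_P[OF refl]
      by (subst msubst_msubst[OF finite_fibres_id finite_fibres_sigma_0]) (simp only: comp_id id_apply)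
    finally show ?thesis .
  qed
  then have "fps_lift (x_trunc N) (fps_lift (sigma 0) Qgf) = fps_lift (sigma 0) (Qpart (Suc N))"
    unfolding x_trunc_Qgf[symmetric] by (intro fps_ext) simp
  also have "\<dots> = (\<Prod>i=1..Suc N. fps_lin (sigma 0 (xv i)) * fps_geom (sigma 0 (xv i)))"
    by (simp add: Qpart_def sigmaL.prod sigmaL.mult)
  also have "\<dots> = fps_lin (zv 1) * fps_geom (zv 1) * (\<Prod>i=Suc 1..Suc N. fps_lin (sigma 0 (xv i)) * fps_geom (sigma 0 (xv i)))"
    by (subst prod.atLeast_Suc_atMost)
       (simp_all add: sigma_def msubst_mvar finite_fibres_sigma_0[simplified])
  also have "(\<Prod>i=Suc 1..Suc N. fps_lin (sigma 0 (xv i)) * fps_geom (sigma 0 (xv i))) = Qpart N"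
    unfolding prod.shift_bounds_cl_Suc_ivl Qpart_def
    by (rule prod.cong) (auto simp: sigma_def msubst_mvar finite_fibres_sigma_0[simplified])
  finally show "fps_lift (x_trunc N) (fps_lift (sigma 0) Qgf) =
      fps_lift (x_trunc N) (fps_lin (zv 1) * fps_geom (zv 1) * Qgf)"
    by (simp add: L.mult x_trunc_Qgf)
qed

section \<open>The operators\<close>

lemma subring_gen_zero: "0 \<in> subring_gen S"
  using subring_gen.diff[OF subring_gen.one subring_gen.one] by simp

lemma subring_gen_uminus: "a \<in> subring_gen S \<Longrightarrow> - a \<in> subring_gen S"
  using subring_gen.diff[OF subring_gen_zero, of a] by simp

lemma subring_gen_add: "a \<in> subring_gen S \<Longrightarrow> b \<in> subring_gen S \<Longrightarrow> a + b \<in> subring_gen S"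
  using subring_gen.diff[OF _ subring_gen_uminus, of a S b] by simp

lemma subring_gen_sum: "(\<And>x. x \<in> A \<Longrightarrow> h x \<in> subring_gen S) \<Longrightarrow> sum h A \<in> subring_gen S"
  by (induction A rule: infinite_finite_induct) (auto intro: subring_gen_zero subring_gen_add)

lemma subring_gen_prod: "(\<And>x. x \<in> A \<Longrightarrow> h x \<in> subring_gen S) \<Longrightarrow> prod h A \<in> subring_gen S"
  by (induction A rule: infinite_finite_induct) (auto intro: subring_gen.intros)

lemma subring_gen_power: "a \<in> subring_gen S \<Longrightarrow> a ^ n \<in> subring_gen S"
  by (induction n) (auto intro: subring_gen.intros)

lemma subring_gen_two: "2 \<in> subring_gen S"
  using subring_gen_add[OF subring_gen.one subring_gen.one, of S] by simp

lemmas subring_closed = subring_gen.one subring_gen.mult subring_gen.diff subring_gen_zero subring_gen_uminus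
  subring_gen_add subring_gen_sum subring_gen_prod subring_gen_power subring_gen_two

lemmas Rinf_closed = subring_closed[where S = "Gam \<union> tv ` {1..} \<union> zv ` {1..}", folded Rinf_def]
lemmas Zt_closed = subring_closed[where S = "tv ` {1..}", folded Zt_def]

lemma Q_in_Rinf: "Q r \<in> Rinf"
proof (cases "r = 0")
  case False
  then have "Q r \<in> Gam" unfolding Gam_def by (intro subring_gen.gen) auto
  then show ?thesis unfolding Rinf_def by (intro subring_gen.gen) auto
qed (simp add: Rinf_closed)

lemma tv_in_Rinf: "i \<ge> 1 \<Longrightarrow> tv i \<in> Rinf" and zv_in_Rinf: "i \<ge> 1 \<Longrightarrow> zv i \<in> Rinf"
  unfolding Rinf_def by (auto intro: subring_gen.gen)

lemma tv_in_Zt: "i \<ge> 1 \<Longrightarrow> tv i \<in> Zt"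
  unfolding Zt_def by (auto intro: subring_gen.gen)

text \<open>Flattens the generation of \<open>Rinf\<close> in two stages through \<open>Gam\<close>,
  so that homomorphisms can be compared on the elements \<open>Q r\<close>, \<open>tv i\<close> and
  \<open>zv i\<close> alone.\<close>

lemma Rinf_induct [consumes 1, case_names Q tv zv one diff mult]:
  assumes "f \<in> Rinf"
    and "\<And>r. r \<ge> 1 \<Longrightarrow> P (Q r)" "\<And>i. i \<ge> 1 \<Longrightarrow> P (tv i)" "\<And>i. i \<ge> 1 \<Longrightarrow> P (zv i)" "P 1"
    and "\<And>a b. a \<in> Rinf \<Longrightarrow> P a \<Longrightarrow> b \<in> Rinf \<Longrightarrow> P b \<Longrightarrow> P (a - b)"
    and "\<And>a b. a \<in> Rinf \<Longrightarrow> P a \<Longrightarrow> b \<in> Rinf \<Longrightarrow> P b \<Longrightarrow> P (a * b)"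
  shows "P f"
  using assms(1) unfolding Rinf_def
proof (induction rule: subring_gen.induct)
  case (gen a)
  have Gam: "b \<in> Rinf \<and> P b" if "b \<in> Gam" for b
    using that unfolding Gam_def
    by induction (use assms in \<open>auto intro: Rinf_closed Q_in_Rinf\<close>)
  from gen show ?case using assms(3,4) Gam by auto
qed (use assms in \<open>auto simp: Rinf_def\<close>)

lemma Zt_induct [consumes 1, case_names tv one diff mult]:
  assumes "f \<in> Zt"
    and "\<And>i. i \<ge> 1 \<Longrightarrow> P (tv i)" "P 1"
    and "\<And>a b. a \<in> Zt \<Longrightarrow> P a \<Longrightarrow> b \<in> Zt \<Longrightarrow> P b \<Longrightarrow> P (a - b)"
    and "\<And>a b. a \<in> Zt \<Longrightarrow> P a \<Longrightarrow> b \<in> Zt \<Longrightarrow> P b \<Longrightarrow> P (a * b)"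
  shows "P f"
  using assms(1) unfolding Zt_def
  by (induction rule: subring_gen.induct) (use assms in \<open>auto simp: Zt_def\<close>)

lemma Zt_in_Rinf: "a \<in> Zt \<Longrightarrow> a \<in> Rinf"
  by (induction rule: Zt_induct) (auto intro: Rinf_closed tv_in_Rinf)

lemma rhom_eq_on_Rinf:
  assumes "rhom \<phi>" "rhom \<psi>" "f \<in> Rinf"
    and "\<And>r. r \<ge> 1 \<Longrightarrow> \<phi> (Q r) = \<psi> (Q r)"
    and "\<And>i. i \<ge> 1 \<Longrightarrow> \<phi> (tv i) = \<psi> (tv i)" "\<And>i. i \<ge> 1 \<Longrightarrow> \<phi> (zv i) = \<psi> (zv i)"
  shows "\<phi> f = \<psi> f"
proof -
  interpret A: rhom \<phi> by fact
  interpret B: rhom \<psi> by fact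
  show ?thesis
    using assms(3) by (induction rule: Rinf_induct) (simp_all add: assms A.diff B.diff A.mult B.mult)
qed

lemma rhom_Rinf_stable:
  assumes "rhom \<phi>" "f \<in> Rinf"
    and "\<And>r. r \<ge> 1 \<Longrightarrow> \<phi> (Q r) \<in> Rinf"
    and "\<And>i. i \<ge> 1 \<Longrightarrow> \<phi> (tv i) \<in> Rinf" "\<And>i. i \<ge> 1 \<Longrightarrow> \<phi> (zv i) \<in> Rinf"
  shows "\<phi> f \<in> Rinf"
proof -
  interpret A: rhom \<phi> by fact
  show ?thesis
    using assms(2) by (induction rule: Rinf_induct) (auto simp: assms A.diff A.mult intro: Rinf_closed)
qed

lemma fps_coeffs_in_mult:
  "fps_coeffs_in Rinf F \<Longrightarrow> fps_coeffs_in Rinf G \<Longrightarrow> fps_coeffs_in Rinf (F * G)"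
  by (auto simp: fps_coeffs_in_def fps_mult_nth intro: Rinf_closed)

lemma fps_coeffs_in_prod:
  "(\<And>i. i \<in> A \<Longrightarrow> fps_coeffs_in Rinf (F i)) \<Longrightarrow> fps_coeffs_in Rinf (prod F A)"
  by (induction A rule: infinite_finite_induct)
     (simp_all add: fps_coeffs_in_mult, simp_all add: fps_coeffs_in_def fps_one_nth Rinf_closed)

lemma fps_coeffs_in_lin: "a \<in> Rinf \<Longrightarrow> fps_coeffs_in Rinf (fps_lin a)"
  by (auto simp: fps_coeffs_in_def fps_lin_def fps_one_nth fps_X_def Rinf_closed)

lemma fps_coeffs_in_geom: "a \<in> Rinf \<Longrightarrow> fps_coeffs_in Rinf (fps_geom a)"
  by (auto simp: fps_coeffs_in_def fps_geom_def Rinf_closed)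

lemma fps_coeffs_in_Qgf: "fps_coeffs_in Rinf Qgf"
  by (simp add: fps_coeffs_in_def Q_in_Rinf)

lemma fps_coeffs_in_X: "fps_coeffs_in Rinf fps_X"
  by (auto simp: fps_coeffs_in_def fps_X_def Rinf_closed)

lemmas fps_coeffs_intros = fps_coeffs_in_mult fps_coeffs_in_prod fps_coeffs_in_lin fps_coeffs_in_geom
  fps_coeffs_in_Qgf fps_coeffs_in_X

lemma fps_coeffs_inD: "fps_coeffs_in Rinf F \<Longrightarrow> fps_nth F r \<in> Rinf"
  by (simp add: fps_coeffs_in_def)

text \<open>An involution of \<open>Rinf\<close> is bijective, and an automorphism is determined by
  its values on generators. Hence any total homomorphism with the prescribed values computes the
  \<open>THE\<close> in \<open>ring_aut\<close> on \<open>Rinf\<close>.\<close>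

lemma ring_aut_eq:
  assumes hom: "rhom \<phi>" and mem: "\<And>f. f \<in> Rinf \<Longrightarrow> \<phi> f \<in> Rinf"
    and inv: "\<And>f. f \<in> Rinf \<Longrightarrow> \<phi> (\<phi> f) = f"
    and \<tau>: "\<And>i. i \<ge> 1 \<Longrightarrow> \<phi> (tv i) = \<tau> i" and \<zeta>: "\<And>i. i \<ge> 1 \<Longrightarrow> \<phi> (zv i) = \<zeta> i"
    and q: "fps_lift \<phi> Qgf = q" and f: "f \<in> Rinf"
  shows "ring_aut \<tau> \<zeta> q f = \<phi> f"
proof -
  interpret rhom \<phi> by fact
  let ?P = "\<lambda>\<phi>. \<phi> \<in> extensional Rinf \<and> is_ring_aut \<phi> \<and>
    (\<forall>i\<ge>1. \<phi> (tv i) = \<tau> i) \<and> (\<forall>i\<ge>1. \<phi> (zv i) = \<zeta> i) \<and> Abs_fps (\<lambda>r. \<phi> (Q r)) = q"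
  have "bij_betw \<phi> Rinf Rinf"
    by (rule bij_betw_byWitness[where f' = \<phi>]) (auto simp: mem inv)
  then have "bij_betw (restrict \<phi> Rinf) Rinf Rinf"
    by (simp cong: bij_betw_cong)
  then have "is_ring_aut (restrict \<phi> Rinf)"
    by (auto simp: is_ring_aut_def Rinf_closed add mult)
  moreover have "Abs_fps (\<lambda>r. restrict \<phi> Rinf (Q r)) = q"
    using q by (simp add: fps_lift_def Q_in_Rinf)
  ultimately have P: "?P (restrict \<phi> Rinf)"
    using \<tau> \<zeta> by (auto simp: tv_in_Rinf zv_in_Rinf)
  have "\<psi> = restrict \<phi> Rinf" if P': "?P \<psi>" for \<psi>
  proof (rule extensionalityI)
    show "\<psi> \<in> extensional Rinf" "restrict \<phi> Rinf \<in> extensional Rinf" using P' by auto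
    fix f assume "f \<in> Rinf"
    then have "\<psi> f = \<phi> f"
    proof (induction rule: Rinf_induct)
      case (Q r)
      have "\<psi> (Q r) = fps_nth q r" using P' by auto
      also have "\<dots> = \<phi> (Q r)" using q by auto
      finally show ?case .
    next
      case (diff a b)
      have "\<psi> (a - b + b) = \<psi> (a - b) + \<psi> b"
        using P' Rinf_closed(3)[OF diff(1,2)] diff(2) unfolding is_ring_aut_def by blast
      then have "\<psi> (a - b) = \<psi> a - \<psi> b" by (simp add: algebra_simps)
      then show ?case using diff rhom.diff[OF hom, of a b] by simp
    next
      case (mult a b)
      then show ?case using P' rhom.mult[OF hom, of a b] by (simp add: is_ring_aut_def)
    qed (use P' \<tau> \<zeta> in \<open>auto simp: is_ring_aut_def\<close>)
    then show "\<psi> f = restrict \<phi> Rinf f" using \<open>f \<in> Rinf\<close> by simp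
  qed
  then have "ring_aut \<tau> \<zeta> q = restrict \<phi> Rinf"
    unfolding ring_aut_def using P by (intro the_equality) blast+
  then show ?thesis using f by simp
qed

lemma Omega_Q [simp]: "Omega (Q r) = Q r"
  using arg_cong[OF Omega_Qgf, of "\<lambda>F. fps_nth F r"] by (simp del: Omega_Qgf)

lemma sigma_Q: "i > 0 \<Longrightarrow> sigma i (Q r) = Q r"
  using arg_cong[OF sigma_Qgf, of i "\<lambda>F. fps_nth F r"] by simp

lemma sigma_0_Q: "sigma 0 (Q r) = fps_nth (fps_lin (zv 1) * fps_geom (zv 1) * Qgf) r"
  using arg_cong[OF sigma_0_Qgf, of "\<lambda>F. fps_nth F r"] by simp

lemma Omega_Rinf: "f \<in> Rinf \<Longrightarrow> Omega f \<in> Rinf"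
  by (rule rhom_Rinf_stable[OF Omega.rhom_axioms])
     (simp_all add: Rinf_closed Q_in_Rinf tv_in_Rinf zv_in_Rinf)

lemma transpose_Suc_ge_1: "i > 0 \<Longrightarrow> j \<ge> 1 \<Longrightarrow> transpose i (Suc i) j \<ge> 1"
  by (auto simp: transpose_def)

lemma sigma_Rinf: "f \<in> Rinf \<Longrightarrow> sigma i f \<in> Rinf"
proof (rule rhom_Rinf_stable[OF sigma.rhom_axioms])
  fix r :: nat
  show "sigma i (Q r) \<in> Rinf"
  proof (cases "i = 0")
    case True
    then show ?thesis
      unfolding True sigma_0_Q by (intro fps_coeffs_inD fps_coeffs_intros zv_in_Rinf) auto
  qed (simp add: sigma_Q Q_in_Rinf)
next
  fix j :: nat assume "j \<ge> 1"
  then show "sigma i (zv j) \<in> Rinf"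
    using transpose_Suc_ge_1[of i j] by (simp add: sigma_zv Rinf_closed zv_in_Rinf)
qed (simp_all add: tv_in_Rinf)

text \<open>Outside \<open>Rinf\<close> this fails for index 0, where \<open>xv 1\<close> goes to
  \<open>zv 1\<close> and then to \<open>- zv 1\<close>. On the elements \<open>Q r\<close> the
  factors picked up in the two applications are inverse to each other.\<close>

lemma sigma_sigma: "f \<in> Rinf \<Longrightarrow> sigma i (sigma i f) = f"
proof (rule rhom_eq_on_Rinf[where \<phi> = "\<lambda>f. sigma i (sigma i f)" and \<psi> = "\<lambda>f. f"])
  show "rhom (\<lambda>f. sigma i (sigma i f))"
    by unfold_locales (auto simp: sigma.add sigma.mult)
  show "rhom (\<lambda>f :: ring_elt. f)" by unfold_locales auto
  show "sigma i (sigma i (Q r)) = Q r" for r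
  proof (cases "i = 0")
    case True
    have "fps_lift (sigma 0) (fps_lift (sigma 0) Qgf) =
        (fps_lin (- zv 1) * fps_geom (zv 1)) * (fps_lin (- (- zv 1)) * fps_geom (- zv 1)) * Qgf"
      unfolding sigma_0_Qgf sigmaL.mult by (simp add: sigma_zv sigma_0_Qgf mult_ac)
    also have "\<dots> = Qgf" unfolding fps_lin_neg_geom by simp
    finally have "fps_nth (fps_lift (sigma 0) (fps_lift (sigma 0) Qgf)) r = Q r" by simp
    then show ?thesis by (simp add: True)
  qed (simp add: sigma_Q)
qed (auto simp: sigma_zv sigma.uminus)

lemma sz_eq: "f \<in> Rinf \<Longrightarrow> sz i f = sigma i f"
  unfolding sz_def using sigma_Qgf[of i] sigma_0_Qgf
  by (auto intro!: ring_aut_eq sigma.rhom_axioms sigma_Rinf sigma_sigma simp: sigma_zv fps_lin_def)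

lemma om_eq: "f \<in> Rinf \<Longrightarrow> om f = Omega f"
  unfolding om_def by (rule ring_aut_eq[OF Omega.rhom_axioms Omega_Rinf]) auto

definition tau :: "nat \<Rightarrow> ring_elt \<Rightarrow> ring_elt"
  where "tau i f = Omega (sigma i (Omega f))"

lemma st_eq: "f \<in> Rinf \<Longrightarrow> st i f = tau i f"
  by (simp add: st_def tau_def om_eq sz_eq Omega_Rinf sigma_Rinf)

interpretation tau: rhom "tau i" for i
  by unfold_locales (simp_all add: tau_def Omega.add Omega.mult sigma.add sigma.mult)

lemma tau_Rinf: "f \<in> Rinf \<Longrightarrow> tau i f \<in> Rinf"
  by (simp add: tau_def Omega_Rinf sigma_Rinf)

lemma tau_zv [simp]: "tau i (zv j) = zv j"
  by (simp add: tau_def sigma.uminus Omega.uminus)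

lemma tau_tv: "tau i (tv j) = (if i = 0 then if j = 1 then - tv 1 else tv j else tv (transpose i (i + 1) j))"
  by (auto simp: tau_def sigma_zv sigma.uminus Omega.uminus)

lemma tau_Q: "i > 0 \<Longrightarrow> tau i (Q r) = Q r"
  by (simp add: tau_def sigma_Q)

lemma tau_0_Qgf: "fps_lift (tau 0) Qgf = fps_lin (- tv 1) * fps_geom (- tv 1) * Qgf"
proof -
  have "fps_lift (tau 0) Qgf = fps_lift Omega (fps_lift (sigma 0) (fps_lift Omega Qgf))"
    by (rule fps_ext) (simp add: tau_def)
  then show ?thesis by (simp add: sigma_0_Qgf OmegaL.mult)
qed

section \<open>Simple roots and divided differences\<close>

lemma alpha_Rinf: "alpha i \<in> Rinf"
  by (auto simp: alpha_def intro!: Rinf_closed tv_in_Rinf)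

definition zalpha :: "nat \<Rightarrow> ring_elt"
  where "zalpha i = Omega (alpha i)"

lemma zalpha_eq: "zalpha i = (if i = 0 then - (2 * zv 1) else zv i - zv (i + 1))"
  by (simp add: zalpha_def alpha_def Omega.mult Omega.diff Omega.two)

lemma ord_ge_cancel_zalpha: "ord_ge (Suc d) (zalpha i * g) \<Longrightarrow> ord_ge d g"
proof (cases "i = 0")
  case True
  assume "ord_ge (Suc d) (zalpha i * g)"
  then have "ord_ge (Suc d) (- (zalpha i * g))" by (rule ord_ge_uminus)
  then show ?thesis using True by (intro ord_ge_cancel_double[of d "VarZ 1"]) (simp add: zalpha_eq)
next
  case False
  assume "ord_ge (Suc d) (zalpha i * g)"
  then show ?thesis using False by (intro ord_ge_cancel_diff[of d "VarZ i" "VarZ (i + 1)"]) (auto simp: zalpha_eq)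
qed

lemma zalpha_mult_eq_0: "zalpha i * g = 0 \<Longrightarrow> g = 0"
  by (rule ord_ge_all_imp_eq_0, rule ord_ge_cancel_zalpha[where i = i]) simp

lemma zalpha_mult_cancel: "zalpha i * g = zalpha i * h \<Longrightarrow> g = h"
  using zalpha_mult_eq_0[of i "g - h"] by (simp add: right_diff_distrib)

lemma alpha_mult_cancel:
  assumes "alpha i * g = alpha i * h" shows "g = h"
proof -
  have "Omega (alpha i * g) = Omega (alpha i * h)" by (simp only: assms)
  then have "Omega g = Omega h"
    by - (rule zalpha_mult_cancel[of i], simp add: zalpha_def Omega.mult)
  then have "Omega (Omega g) = Omega (Omega h)" by (simp only:)
  then show ?thesis by simp
qed

text \<open>Divisibility by the root is checked on generators and passes to products by the twisted
  Leibniz rule \<open>a b - s(a) s(b) = (a - s(a)) b + s(a) (b - s(b))\<close>, where s is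
  \<open>sigma i\<close>.\<close>

lemma ddz_ex: "f \<in> Rinf \<Longrightarrow> \<exists>g\<in>Rinf. zalpha i * g = f - sigma i f"
proof (induction rule: Rinf_induct)
  case (Q r)
  show ?case
  proof (cases "i = 0")
    case True
    \<comment> \<open>Writing \<open>-2 z u\<close> as \<open>(1 - z u) - (1 + z u)\<close> shows
      that the quotient for \<open>Q r\<close> is the coefficient of the r-th power of u in
      \<open>u Q(u) / (1 - z u)\<close>, with z for \<open>zv 1\<close>.\<close>
    have e: "fps_const (- (2 * zv 1)) * fps_X = fps_lin (- zv 1) - fps_lin (zv 1)"
      by (simp add: fps_lin_def flip: fps_const_neg fps_const_mult) (simp add: algebra_simps numeral_fps_const)
    have "fps_const (- (2 * zv 1)) * (fps_X * fps_geom (zv 1) * Qgf) =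
        (fps_const (- (2 * zv 1)) * fps_X) * fps_geom (zv 1) * Qgf"
      by (simp only: mult.assoc)
    also have "\<dots> = (fps_lin (- zv 1) - fps_lin (zv 1)) * fps_geom (zv 1) * Qgf"
      by (simp only: e)
    also have "\<dots> = Qgf - fps_lin (zv 1) * fps_geom (zv 1) * Qgf"
      by (simp only: left_diff_distrib fps_lin_neg_geom mult_1_left)
    finally have "fps_nth (fps_const (- (2 * zv 1)) * (fps_X * fps_geom (zv 1) * Qgf)) r =
        Q r - fps_nth (fps_lin (zv 1) * fps_geom (zv 1) * Qgf) r" by simp
    then have "zalpha i * fps_nth (fps_X * fps_geom (zv 1) * Qgf) r = Q r - sigma i (Q r)"
      by (simp add: True zalpha_eq sigma_0_Q del: fps_const_neg)
    moreover have "fps_nth (fps_X * fps_geom (zv 1) * Qgf) r \<in> Rinf"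
      by (intro fps_coeffs_inD fps_coeffs_intros zv_in_Rinf) auto
    ultimately show ?thesis by blast
  next
    case False
    then show ?thesis by (intro bexI[of _ 0]) (auto simp: sigma_Q Rinf_closed)
  qed
next
  case (zv j)
  consider "i = 0" "j = 1" | "i \<noteq> 0" "j = i" | "i \<noteq> 0" "j = i + 1" | "sigma i (zv j) = zv j"
    by (cases "i = 0"; cases "j = 1"; cases "j = i"; cases "j = i + 1") (auto simp: sigma_zv)
  then show ?case
  proof cases
    case 1
    then show ?thesis by (intro bexI[of _ "- 1"]) (auto simp: zalpha_eq sigma_zv Rinf_closed)
  next
    case 2
    then show ?thesis by (intro bexI[of _ 1]) (auto simp: zalpha_eq sigma_zv Rinf_closed)
  next
    case 3
    then show ?thesis by (intro bexI[of _ "- 1"]) (auto simp: zalpha_eq sigma_zv Rinf_closed)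
  next
    case 4
    then show ?thesis by (intro bexI[of _ 0]) (auto simp: Rinf_closed)
  qed
next
  case (diff a b)
  then obtain g h where "g \<in> Rinf" "zalpha i * g = a - sigma i a" "h \<in> Rinf" "zalpha i * h = b - sigma i b"
    by blast
  then show ?case
    by (intro bexI[of _ "g - h"]) (auto simp: Rinf_closed sigma.diff right_diff_distrib)
next
  case (mult a b)
  then obtain g h where "g \<in> Rinf" "zalpha i * g = a - sigma i a" "h \<in> Rinf" "zalpha i * h = b - sigma i b"
    by blast
  moreover from this have "zalpha i * (g * b + sigma i a * h) = (a - sigma i a) * b + sigma i a * (b - sigma i b)"
    by (metis (no_types, lifting) distrib_left mult.assoc mult.left_commute)
  ultimately show ?case
    using mult by (intro bexI[of _ "g * b + sigma i a * h"])
      (auto simp: Rinf_closed sigma.mult sigma_Rinf algebra_simps)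
qed (auto intro!: bexI[of _ 0] simp: Rinf_closed)

lemma ddz_THE:
  assumes "f \<in> Rinf"
  shows "ddz i f = (THE g. g \<in> Rinf \<and> zalpha i * g = f - sigma i f)"
  using assms by (simp add: ddz_def om_eq alpha_Rinf zalpha_def sz_eq)

lemma ddz_eqI: "f \<in> Rinf \<Longrightarrow> g \<in> Rinf \<Longrightarrow> zalpha i * g = f - sigma i f \<Longrightarrow> ddz i f = g"
  unfolding ddz_THE by (rule the_equality) (auto intro: zalpha_mult_cancel[of i])

lemma ddz_Rinf: "f \<in> Rinf \<Longrightarrow> ddz i f \<in> Rinf"
  and zalpha_mult_ddz: "f \<in> Rinf \<Longrightarrow> zalpha i * ddz i f = f - sigma i f"
  using ddz_ex[of f i] ddz_eqI[of f _ i] by auto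

text \<open>\<open>Omega\<close> conjugates \<open>sigma i\<close> to \<open>tau i\<close> and
  exchanges the two kinds of roots. Through this every property of \<open>ddz\<close> has a mirror
  image for \<open>ddt\<close>.\<close>

lemma ddt_eq:
  assumes "f \<in> Rinf"
  shows "ddt i f = Omega (ddz i (Omega f))"
  unfolding ddt_def
proof (rule the_equality)
  let ?g = "Omega (ddz i (Omega f))"
  have "Omega (zalpha i * ddz i (Omega f)) = Omega (Omega f - sigma i (Omega f))"
    using assms by (simp add: zalpha_mult_ddz Omega_Rinf)
  then have 1: "alpha i * ?g = f - st i f"
    using assms by (simp add: Omega.mult Omega.diff zalpha_def st_eq tau_def)
  with assms show "?g \<in> Rinf \<and> alpha i * ?g = f - st i f"
    by (simp add: Omega_Rinf ddz_Rinf)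
  show "h = ?g" if "h \<in> Rinf \<and> alpha i * h = f - st i f" for h
    using that 1 by - (rule alpha_mult_cancel[of i], simp)
qed

lemma ddt_Rinf: "f \<in> Rinf \<Longrightarrow> ddt i f \<in> Rinf"
  by (simp add: ddt_eq ddz_Rinf Omega_Rinf)

lemma alpha_mult_ddt: "f \<in> Rinf \<Longrightarrow> alpha i * ddt i f = f - tau i f"
  using arg_cong[OF zalpha_mult_ddz[OF Omega_Rinf[of f], of i], of Omega]
  by (simp add: ddt_eq Omega.mult Omega.diff zalpha_def tau_def)

lemma ddt_eqI: "f \<in> Rinf \<Longrightarrow> alpha i * g = f - tau i f \<Longrightarrow> ddt i f = g"
  by (rule alpha_mult_cancel[of i]) (simp add: alpha_mult_ddt)

lemma ddz_add: "f \<in> Rinf \<Longrightarrow> g \<in> Rinf \<Longrightarrow> ddz i (f + g) = ddz i f + ddz i g"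
  by (rule ddz_eqI) (auto simp: Rinf_closed ddz_Rinf distrib_left zalpha_mult_ddz sigma.add)

lemma ddz_diff: "f \<in> Rinf \<Longrightarrow> g \<in> Rinf \<Longrightarrow> ddz i (f - g) = ddz i f - ddz i g"
  by (rule ddz_eqI) (auto simp: Rinf_closed ddz_Rinf right_diff_distrib zalpha_mult_ddz sigma.diff)

lemma ddt_add: "f \<in> Rinf \<Longrightarrow> g \<in> Rinf \<Longrightarrow> ddt i (f + g) = ddt i f + ddt i g"
  by (simp add: ddt_eq Rinf_closed Omega.add ddz_add Omega_Rinf)

lemma ddt_diff: "f \<in> Rinf \<Longrightarrow> g \<in> Rinf \<Longrightarrow> ddt i (f - g) = ddt i f - ddt i g"
  by (simp add: ddt_eq Rinf_closed Omega.diff ddz_diff Omega_Rinf)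

lemma ddz_zero [simp]: "ddz i 0 = 0"
  by (rule ddz_eqI) (auto simp: Rinf_closed)

lemma ddt_zero [simp]: "ddt i 0 = 0"
  by (rule ddt_eqI) (auto simp: Rinf_closed)

lemma ddz_sum: "(\<And>x. x \<in> A \<Longrightarrow> h x \<in> Rinf) \<Longrightarrow> ddz i (sum h A) = (\<Sum>x\<in>A. ddz i (h x))"
  by (induction A rule: infinite_finite_induct) (auto simp: ddz_add Rinf_closed)

lemma ddt_sum: "(\<And>x. x \<in> A \<Longrightarrow> h x \<in> Rinf) \<Longrightarrow> ddt i (sum h A) = (\<Sum>x\<in>A. ddt i (h x))"
  by (induction A rule: infinite_finite_induct) (auto simp: ddt_add Rinf_closed)

lemma sigma_Zt: "a \<in> Zt \<Longrightarrow> sigma i a = a"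
  by (induction rule: Zt_induct) (auto simp: sigma.diff sigma.mult)

lemma ddz_Zt_mult:
  assumes "a \<in> Zt" "f \<in> Rinf"
  shows "ddz i (a * f) = a * ddz i f"
proof (rule ddz_eqI)
  show "zalpha i * (a * ddz i f) = a * f - sigma i (a * f)"
    using zalpha_mult_ddz[OF assms(2), of i] assms(1)
    by (simp add: sigma.mult sigma_Zt mult.left_commute[of "zalpha i"] right_diff_distrib)
qed (use assms in \<open>auto intro: Rinf_closed ddz_Rinf Zt_in_Rinf\<close>)

lemma ddt_mult:
  assumes "f \<in> Rinf" "g \<in> Rinf"
  shows "ddt i (f * g) = ddt i f * g + tau i f * ddt i g"
proof (rule ddt_eqI)
  have "alpha i * (ddt i f * g + tau i f * ddt i g) = (alpha i * ddt i f) * g + tau i f * (alpha i * ddt i g)"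
    by (simp add: algebra_simps)
  then show "alpha i * (ddt i f * g + tau i f * ddt i g) = f * g - tau i (f * g)"
    using assms by (simp add: alpha_mult_ddt tau.mult algebra_simps)
qed (use assms in \<open>auto intro: Rinf_closed\<close>)

lemma tau_Zt: "a \<in> Zt \<Longrightarrow> tau i a \<in> Zt"
proof (induction rule: Zt_induct)
  case (tv j)
  then show ?case
    using transpose_Suc_ge_1[of i j] by (simp add: tau_tv Zt_closed tv_in_Zt)
qed (auto simp: tau.diff tau.mult intro: Zt_closed)

lemma ddt_Zt: "a \<in> Zt \<Longrightarrow> ddt i a \<in> Zt"
proof (induction rule: Zt_induct)
  case (tv j)
  consider "i = 0" "j = 1" | "i \<noteq> 0" "j = i" | "i \<noteq> 0" "j = i + 1" | "tau i (tv j) = tv j"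
    by (cases "i = 0"; cases "j = 1"; cases "j = i"; cases "j = i + 1") (auto simp: tau_tv)
  then show ?case
  proof cases
    case 1
    then have "ddt i (tv j) = 1" by (intro ddt_eqI) (auto simp: alpha_def tau_tv tv_in_Rinf)
    then show ?thesis by (simp add: Zt_closed)
  next
    case 2
    then have "ddt i (tv j) = - 1" by (intro ddt_eqI) (auto simp: alpha_def tau_tv tv_in_Rinf)
    then show ?thesis by (simp add: Zt_closed)
  next
    case 3
    then have "ddt i (tv j) = 1" by (intro ddt_eqI) (auto simp: alpha_def tau_tv tv_in_Rinf)
    then show ?thesis by (simp add: Zt_closed)
  next
    case 4
    then have "ddt i (tv j) = 0" using tv by (intro ddt_eqI) (auto simp: tv_in_Rinf)
    then show ?thesis by (simp add: Zt_closed)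
  qed
next
  case one
  have "ddt i 1 = 0" by (rule ddt_eqI) (auto simp: Rinf_closed)
  then show ?case by (simp add: Zt_closed)
next
  case (diff a b)
  then show ?case by (simp add: ddt_diff Zt_in_Rinf Zt_closed)
next
  case (mult a b)
  then show ?case by (simp add: ddt_mult Zt_in_Rinf Zt_closed tau_Zt)
qed

text \<open>The two reflections act on disjoint sets of variables; on the \<open>Q r\<close> each
  contributes a factor that the other one fixes.\<close>

lemma sigma_tau_commute:
  assumes "f \<in> Rinf"
  shows "sigma i (tau j f) = tau j (sigma i f)"
proof (rule rhom_eq_on_Rinf[OF _ _ assms, of "\<lambda>f. sigma i (tau j f)" "\<lambda>f. tau j (sigma i f)"])
  show "rhom (\<lambda>f. sigma i (tau j f))" "rhom (\<lambda>f. tau j (sigma i f))"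
    by (unfold_locales; simp add: sigma.add sigma.mult tau.add tau.mult)+
  show "sigma i (tau j (tv k)) = tau j (sigma i (tv k))" for k
    by (auto simp: tau_tv sigma.uminus)
  show "sigma i (tau j (zv k)) = tau j (sigma i (zv k))" for k
    by (auto simp: sigma_zv tau.uminus)
  fix r
  interpret tauL: rhom "fps_lift (tau j)" for j by (rule tau.rhom_fps_lift)
  have t: "fps_lift (tau j) Qgf = (if j = 0 then fps_lin (- tv 1) * fps_geom (- tv 1) * Qgf else Qgf)" for j
    by (auto simp: tau_0_Qgf tau_Q intro!: fps_ext)
  have s: "fps_lift (sigma i) Qgf = (if i = 0 then fps_lin (zv 1) * fps_geom (zv 1) * Qgf else Qgf)" for i
    by (auto simp: sigma_0_Qgf sigma_Q intro!: fps_ext)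
  have "fps_lift (sigma i) (fps_lift (tau j) Qgf) = fps_lift (tau j) (fps_lift (sigma i) Qgf)"
    by (auto simp: s t sigmaL.mult tauL.mult sigma.uminus mult_ac)
  then have "fps_nth (fps_lift (sigma i) (fps_lift (tau j) Qgf)) r = fps_nth (fps_lift (tau j) (fps_lift (sigma i) Qgf)) r"
    by (simp only:)
  then show "sigma i (tau j (Q r)) = tau j (sigma i (Q r))" by simp
qed

lemma sigma_alpha [simp]: "sigma i (alpha j) = alpha j"
  by (simp add: alpha_def sigma.mult sigma.diff sigma.two)

lemma tau_zalpha [simp]: "tau i (zalpha j) = zalpha j"
  by (simp add: zalpha_eq tau.mult tau.diff tau.two tau.uminus)

text \<open>Each root is fixed by the other reflection, so both sides can be multiplied by both
  roots and compared through the commuting reflections; afterwards the roots cancel.\<close>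

lemma ddz_ddt_commute:
  assumes "f \<in> Rinf"
  shows "ddz i (ddt j f) = ddt j (ddz i f)"
proof -
  have "alpha j * (zalpha i * ddz i (ddt j f)) = alpha j * ddt j f - sigma i (alpha j * ddt j f)"
    using assms by (simp add: zalpha_mult_ddz ddt_Rinf sigma.mult right_diff_distrib)
  also have "\<dots> = zalpha i * ddz i f - tau j (zalpha i * ddz i f)"
    using assms by (simp add: alpha_mult_ddt zalpha_mult_ddz sigma.diff tau.diff sigma_tau_commute)
  also have "\<dots> = zalpha i * (alpha j * ddt j (ddz i f))"
    using assms by (simp add: alpha_mult_ddt ddz_Rinf tau.mult right_diff_distrib)
  finally have "alpha j * (zalpha i * ddz i (ddt j f)) = alpha j * (zalpha i * ddt j (ddz i f))"
    by (simp add: mult.left_commute)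
  then show ?thesis
    using alpha_mult_cancel zalpha_mult_cancel by blast
qed

lemma ord_ge_msubst: "ord_ge d f \<Longrightarrow> ord_ge d (msubst \<rho> \<epsilon> f)"
  by (auto simp: ord_ge_def mcoeff_msubst intro!: sum.neutral)

lemma ord_ge_sigma: "ord_ge d f \<Longrightarrow> ord_ge d (sigma i f)"
  by (simp add: sigma_def ord_ge_msubst)

lemma ord_ge_ddz: "f \<in> Rinf \<Longrightarrow> ord_ge (Suc d) f \<Longrightarrow> ord_ge d (ddz i f)"
  by (rule ord_ge_cancel_zalpha[where i = i]) (simp add: zalpha_mult_ddz ord_ge_diff ord_ge_sigma)

text \<open>
  Invariance under the transpositions of the \<open>t\<^sub>i\<close> would move a nonzero coefficient to monomials in
  arbitrarily late variables.
\<close>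

lemma Zt_invariant_const:
  assumes a: "a \<in> Zt" and inv: "\<And>i. ddt i a = 0" and eps: "mcoeff a 0 = 0"
  shows "a = 0"
proof (rule ccontr)
  assume "a \<noteq> 0"
  then obtain m where m: "mcoeff a m \<noteq> 0" by (metis mcoeff_zero mps_eqI)
  let ?B = "\<lambda>N f. \<forall>m. mcoeff f m \<noteq> 0 \<longrightarrow> Poly_Mapping.keys m \<subseteq> VarT ` {1..N}"
  have bmono: "?B M f" if "?B N f" "N \<le> M" for N M f
    using that by (fastforce simp: subset_iff image_iff)
  have "\<exists>N. ?B N a"
    using a
  proof (induction rule: Zt_induct)
    case (tv i)
    then show ?case by (intro exI[of _ i]) (auto simp: mvar_def split: if_splits)
  next
    case one
    then show ?case by (auto simp: mcoeff_one)
  next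
    case (diff a b)
    then obtain N M where NM: "?B N a" "?B M b" by blast
    have "?B (max N M) a" "?B (max N M) b"
      by (rule bmono[OF NM(1)], simp) (rule bmono[OF NM(2)], simp)
    then have "?B (max N M) (a - b)" by (metis diff_self mcoeff_diff)
    then show ?case by blast
  next
    case (mult a b)
    then obtain N M where NM: "?B N a" "?B M b" by blast
    have B: "?B (max N M) a" "?B (max N M) b"
      by (rule bmono[OF NM(1)], simp) (rule bmono[OF NM(2)], simp)
    have "?B (max N M) (a * b)"
    proof (intro allI impI)
      fix m assume "mcoeff (a * b) m \<noteq> 0"
      then obtain p where "p \<in> msplits m" "mcoeff a (fst p) * mcoeff b (snd p) \<noteq> 0"
        unfolding mcoeff_mult case_prod_unfold by (meson sum.not_neutral_contains_not_neutral)
      then have "fst p + snd p = m" "mcoeff a (fst p) \<noteq> 0" "mcoeff b (snd p) \<noteq> 0"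
        by (auto simp: msplits_def)
      then show "Poly_Mapping.keys m \<subseteq> VarT ` {1..max N M}"
        using B Poly_Mapping.keys_add[of "fst p" "snd p"] by blast
    qed
    then show ?case by blast
  qed
  then obtain N where N: "?B N a" by blast
  have shift: "\<exists>m. mcoeff a m \<noteq> 0 \<and> VarT (j + n) \<in> Poly_Mapping.keys m"
    if "mcoeff a m \<noteq> 0" "VarT j \<in> Poly_Mapping.keys m" for m j n
  proof (induction n)
    case (Suc n)
    then obtain m where m: "mcoeff a m \<noteq> 0" "VarT (j + n) \<in> Poly_Mapping.keys m" by blast
    let ?i = "j + n"
    \<comment> \<open>Index 0 has to be excluded because \<open>tau 0\<close> is a change of sign
      and not a swap; all variables in the support of a have positive index.\<close>
    have i: "?i > 0" using m N by force
    let ?\<rho> = "\<lambda>v. case v of VarT j \<Rightarrow> VarT (transpose ?i (Suc ?i) j) | _ \<Rightarrow> v"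
    have ff: "finite_fibres ?\<rho>"
      by (rule finite_fibres_inj) (auto intro!: injI split: xzt.splits simp: transpose_eq_iff)
    interpret S: rhom "msubst ?\<rho> (\<lambda>v. 1)" by (rule rhom_msubst[OF ff])
    have "fps_lift (msubst ?\<rho> (\<lambda>v. 1)) Qgf = Qgf"
      by (rule msubst_Qgf_fixed[OF ff]) auto
    then have SQ: "msubst ?\<rho> (\<lambda>v. 1) (Q r) = Q r" for r
      by (auto simp: fps_eq_iff)
    have "tau ?i a = msubst ?\<rho> (\<lambda>v. 1) a"
      by (rule rhom_eq_on_Rinf[OF tau.rhom_axioms S.rhom_axioms Zt_in_Rinf[OF a]])
         (use i in \<open>auto simp: tau_Q SQ tau_tv msubst_mvar[OF ff]\<close>)
    moreover have "tau ?i a = a"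
      using alpha_mult_ddt[OF Zt_in_Rinf[OF a], of ?i] inv by simp
    ultimately have "mcoeff a (mono_map ?\<rho> m) = mcoeff (msubst ?\<rho> (\<lambda>v. 1) a) (mono_map ?\<rho> m)"
      by simp
    also have "\<dots> = (\<Sum>m'\<in>{m}. mono_coef (\<lambda>v. 1) m' * mcoeff a m')"
    proof -
      have inv: "mono_map ?\<rho> (mono_map ?\<rho> m') = m'" for m'
      proof -
        have "?\<rho> \<circ> ?\<rho> = id" by (auto simp: fun_eq_iff split: xzt.splits)
        then show ?thesis by (simp add: mono_map_comp)
      qed
      have "m' = m" if "mono_map ?\<rho> m' = mono_map ?\<rho> m" for m'
        using arg_cong[OF that, of "mono_map ?\<rho>"] unfolding inv .
      then have "{m'. mono_map ?\<rho> m' = mono_map ?\<rho> m} = {m}"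
        by (intro set_eqI iffI CollectI; simp only: mem_Collect_eq singleton_iff)
      then show ?thesis by (simp add: mcoeff_msubst)
    qed
    also have "\<dots> = mcoeff a m" by (simp add: mono_coef_def)
    finally have "mcoeff a (mono_map ?\<rho> m) \<noteq> 0" using m by simp
    moreover have "VarT (j + Suc n) \<in> Poly_Mapping.keys (mono_map ?\<rho> m)"
      using lookup_le_lookup_mono_map[of m "VarT ?i" ?\<rho>] m(2) by (simp add: in_keys_iff)
    ultimately show ?case by blast
  qed (use that in auto)
  have "m \<noteq> 0" using m eps by auto
  then obtain v where v: "v \<in> Poly_Mapping.keys m" using keys_eq_empty by blast
  then obtain j where "VarT j \<in> Poly_Mapping.keys m" using N m by blast
  from shift[OF m this, of "Suc N"] obtain m' where
    "mcoeff a m' \<noteq> 0" "VarT (j + Suc N) \<in> Poly_Mapping.keys m'" by blast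
  then show False using N by force
qed

section \<open>Theta polynomials\<close>

definition lin_prod :: "(nat \<Rightarrow> 'a::comm_ring_1) \<Rightarrow> int \<Rightarrow> 'a fps"
  where "lin_prod v \<kappa> = (if \<kappa> \<ge> 0 then \<Prod>i=1..nat \<kappa>. fps_lin (v i) else \<Prod>i=1..nat (- \<kappa>). fps_geom (v i))"

text \<open>
  Negative values of \<open>\<kappa>\<close> are allowed as well: the family \<open>Theta\<close> is thereby closed under all
  divided differences, and the two sets of variables play symmetric roles.
\<close>

definition Theta_gf :: "int \<Rightarrow> int \<Rightarrow> ring_elt fps"
  where "Theta_gf \<kappa> l = Qgf * lin_prod zv \<kappa> * lin_prod (\<lambda>i. - tv i) l"

definition Theta :: "int \<Rightarrow> int \<Rightarrow> int \<Rightarrow> ring_elt"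
  where "Theta \<kappa> l r = (if r < 0 then 0 else fps_nth (Theta_gf \<kappa> l) (nat r))"

lemma theta_eq_Theta: "theta \<kappa> l = Theta (int \<kappa>) l"
  by (auto simp: fun_eq_iff theta_def Theta_def theta_gf_def Theta_gf_def lin_prod_def fps_lin_def
      simp flip: fps_const_neg)

lemma (in rhom) fps_lift_lin_prod: "fps_lift \<phi> (lin_prod v \<kappa>) = lin_prod (\<lambda>i. \<phi> (v i)) \<kappa>"
proof -
  interpret L: rhom "fps_lift \<phi>" by (rule rhom_fps_lift)
  show ?thesis by (simp add: lin_prod_def L.prod)
qed

lemma lin_prod_cong: "(\<And>i. i \<ge> 1 \<Longrightarrow> v i = v' i) \<Longrightarrow> lin_prod v \<kappa> = lin_prod v' \<kappa>"
  by (simp add: lin_prod_def)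

text \<open>The swap permutes the factors among themselves unless exactly one of the indices i and i
  + 1 is in range, which happens only for \<open>\<bar>\<kappa>\<bar> = int i\<close>.\<close>

lemma lin_prod_transpose:
  assumes "i \<ge> 1" "\<bar>\<kappa>\<bar> \<noteq> int i"
  shows "lin_prod (\<lambda>j. v (transpose i (i + 1) j)) \<kappa> = lin_prod v \<kappa>"
proof -
  have *: "(\<Prod>j=1..m. h (v (transpose i (i + 1) j))) = (\<Prod>j=1..m. h (v j))" if "m \<noteq> i" for m and h :: "'a \<Rightarrow> 'a fps"
    by (rule prod.reindex_bij_witness[of _ "transpose i (i + 1)" "transpose i (i + 1)"])
       (use that assms(1) in \<open>auto simp: transpose_def\<close>)
  from assms(2) have "nat \<kappa> \<noteq> i" if "\<kappa> \<ge> 0" using that by auto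
  moreover from assms(2) have "nat (- \<kappa>) \<noteq> i" if "\<kappa> < 0" using that by auto
  ultimately show ?thesis by (auto simp: lin_prod_def *[simplified])
qed

lemma lin_prod_of_nat: "lin_prod v (int m) = (\<Prod>i=1..m. fps_lin (v i))"
  and lin_prod_minus_of_nat: "lin_prod v (- int m) = (\<Prod>i=1..m. fps_geom (v i))"
  by (simp_all add: lin_prod_def)

lemma lin_prod_pos:
  assumes "\<kappa> > 0"
  shows "lin_prod v \<kappa> = lin_prod v (\<kappa> - 1) * fps_lin (v (nat \<kappa>))"
proof -
  obtain m where \<kappa>: "\<kappa> = int (Suc m)" using assms by (metis gr0_implies_Suc zero_less_imp_eq_int)
  have "\<kappa> - 1 = int m" "nat \<kappa> = Suc m" using \<kappa> by auto
  then show ?thesis unfolding \<kappa> by (simp only: lin_prod_of_nat) simp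
qed

lemma lin_prod_neg:
  assumes "\<kappa> \<le> 0"
  shows "lin_prod v (\<kappa> - 1) = lin_prod v \<kappa> * fps_geom (v (nat (1 - \<kappa>)))"
proof -
  obtain m where \<kappa>: "\<kappa> = - int m" using assms by (metis minus_minus nonneg_int_cases neg_0_le_iff_le)
  have "\<kappa> - 1 = - int (Suc m)" "nat (1 - \<kappa>) = Suc m" using \<kappa> by auto
  then show ?thesis unfolding \<kappa> by (simp only: lin_prod_minus_of_nat) simp
qed

lemma lin_prod_0 [simp]: "lin_prod v 0 = 1"
  by (simp add: lin_prod_def)

lemma Omega_Theta_gf: "fps_lift Omega (Theta_gf \<kappa> l) = Theta_gf l \<kappa>"
  by (simp add: Theta_gf_def OmegaL.mult Omega.fps_lift_lin_prod Omega.uminus mult_ac)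

lemma Omega_Theta [simp]: "Omega (Theta \<kappa> l r) = Theta l \<kappa> r"
  using arg_cong[OF Omega_Theta_gf[of \<kappa> l], of "\<lambda>F. fps_nth F (nat r)"] by (simp add: Theta_def)

lemma sigma_lin_prod_tv: "fps_lift (sigma i) (lin_prod (\<lambda>i. - tv i) l) = lin_prod (\<lambda>i. - tv i) l"
  by (simp add: sigma.fps_lift_lin_prod sigma.uminus)

lemma sigma_Theta_gf_Suc:
  assumes "i > 0"
  shows "fps_lift (sigma i) (Theta_gf \<kappa> l) =
    Qgf * lin_prod (\<lambda>j. zv (transpose i (i + 1) j)) \<kappa> * lin_prod (\<lambda>i. - tv i) l"
  using assms by (simp add: Theta_gf_def sigmaL.mult sigma_Qgf sigma_lin_prod_tv sigma.fps_lift_lin_prod sigma_zv)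

text \<open>Setting the first variable to 0, instead of shifting the indices of the others, keeps
  the remaining product in the shape of \<open>lin_prod\<close> with unchanged
  \<open>\<kappa>\<close>.\<close>

lemma prod_split_first:
  assumes "h 0 = (1 :: 'b::comm_monoid_mult)"
  shows "(\<Prod>i=1..Suc m. h (v i)) = h (v 1) * (\<Prod>i=1..Suc m. h (if i = 1 then 0 else v i))"
  unfolding One_nat_def
  by (subst (1 2) prod.atLeast_Suc_atMost) (auto simp: assms simp del: prod.cl_ivl_Suc)

lemma lin_prod_first_pos:
  assumes "\<kappa> > 0"
  shows "lin_prod v \<kappa> = fps_lin (v 1) * lin_prod (\<lambda>i. if i = 1 then 0 else v i) \<kappa>"
proof -
  obtain m where \<kappa>: "\<kappa> = int (Suc m)" using assms by (metis gr0_implies_Suc zero_less_imp_eq_int)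
  show ?thesis unfolding \<kappa> lin_prod_of_nat by (rule prod_split_first) simp
qed

lemma lin_prod_first_neg:
  assumes "\<kappa> < 0"
  shows "lin_prod v \<kappa> = fps_geom (v 1) * lin_prod (\<lambda>i. if i = 1 then 0 else v i) \<kappa>"
proof -
  obtain m where \<kappa>: "\<kappa> = - int (Suc m)" using assms that[of "nat (- \<kappa> - 1)"] by simp
  show ?thesis unfolding \<kappa> lin_prod_minus_of_nat by (rule prod_split_first) simp
qed

text \<open>For positive i, \<open>Qgf\<close> is fixed and the product in z is symmetric. For
  \<open>i = 0\<close> the factor \<open>(1 + z u) / (1 - z u)\<close> acquired by
  \<open>Qgf\<close> restores what the sign change did to the first factor: it turns
  \<open>1 - z u\<close> into \<open>1 + z u\<close> for positive \<open>\<kappa>\<close>, and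
  \<open>1 / (1 + z u)\<close> into \<open>1 / (1 - z u)\<close> for negative
  \<open>\<kappa>\<close>.\<close>

lemma sigma_Theta_gf:
  assumes "\<bar>\<kappa>\<bar> \<noteq> int i"
  shows "fps_lift (sigma i) (Theta_gf \<kappa> l) = Theta_gf \<kappa> l"
proof (cases "i = 0")
  case False
  then show ?thesis
    using lin_prod_transpose[of i \<kappa> zv] assms by (subst sigma_Theta_gf_Suc) (auto simp: Theta_gf_def)
next
  case True
  let ?R = "lin_prod (\<lambda>i. if i = 1 then 0 else zv i) \<kappa>" and ?T = "lin_prod (\<lambda>i. - tv i) l"
  have R: "lin_prod (\<lambda>i. if i = 1 then 0 else sigma 0 (zv i)) \<kappa> = ?R"
    by (intro lin_prod_cong) (simp add: sigma_zv)
  have z1: "sigma 0 (zv 1) = - zv 1" by (simp add: sigma_zv)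
  show ?thesis
  proof (cases "\<kappa> > 0")
    case pos: True
    have "fps_lift (sigma 0) (Theta_gf \<kappa> l) =
        fps_lin (zv 1) * fps_geom (zv 1) * Qgf * (fps_lin (- zv 1) * ?R) * ?T"
      unfolding Theta_gf_def sigmaL.mult sigma_0_Qgf sigma_lin_prod_tv sigma.fps_lift_lin_prod
        lin_prod_first_pos[OF pos, of "\<lambda>i. sigma 0 (zv i)"] R z1 ..
    also have "\<dots> = (fps_lin (- zv 1) * fps_geom (zv 1)) * (Qgf * (fps_lin (zv 1) * ?R) * ?T)"
      by (simp only: mult_ac)
    also have "\<dots> = Theta_gf \<kappa> l"
      unfolding fps_lin_neg_geom by (simp add: Theta_gf_def lin_prod_first_pos[OF pos, of zv])
    finally show ?thesis by (simp add: True)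
  next
    case False
    then have neg: "\<kappa> < 0" using assms True by auto
    have "fps_lift (sigma 0) (Theta_gf \<kappa> l) =
        fps_lin (zv 1) * fps_geom (zv 1) * Qgf * (fps_geom (- zv 1) * ?R) * ?T"
      unfolding Theta_gf_def sigmaL.mult sigma_0_Qgf sigma_lin_prod_tv sigma.fps_lift_lin_prod
        lin_prod_first_neg[OF neg, of "\<lambda>i. sigma 0 (zv i)"] R z1 ..
    also have "\<dots> = (fps_lin (- (- zv 1)) * fps_geom (- zv 1)) * (Qgf * (fps_geom (zv 1) * ?R) * ?T)"
      unfolding minus_minus by (simp only: mult_ac)
    also have "\<dots> = Theta_gf \<kappa> l"
      unfolding fps_lin_neg_geom by (simp add: Theta_gf_def lin_prod_first_neg[OF neg, of zv])
    finally show ?thesis by (simp add: True)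
  qed
qed

lemma fps_lin_diff: "fps_lin a - fps_lin b = fps_const (a - b) * fps_X"
  by (simp add: fps_lin_def left_diff_distrib flip: fps_const_sub)

lemma fps_geom_diff: "fps_geom a - fps_geom b = fps_const (a - b) * fps_X * (fps_geom a * fps_geom b)"
proof -
  have "fps_geom a - fps_geom b =
      (fps_lin (- b) * fps_geom b) * fps_geom a - (fps_lin (- a) * fps_geom a) * fps_geom b"
    unfolding fps_lin_neg_geom by simp
  also have "\<dots> = (fps_lin (- b) - fps_lin (- a)) * (fps_geom a * fps_geom b)"
    by (simp add: algebra_simps)
  also have "fps_lin (- b) - fps_lin (- a) = fps_const (a - b) * fps_X"
    by (simp add: fps_lin_diff)
  finally show ?thesis .
qed

text \<open>The difference of two linear factors is a root times u and removes a factor; the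
  difference of two geometric factors is a root times u times both of them and adds a factor. So
  \<open>\<kappa>\<close> drops by one on either side of 0, and at 0 the factor acquired by
  \<open>Qgf\<close> provides the first geometric factor.\<close>

lemma Theta_gf_ddz:
  assumes "\<bar>\<kappa>\<bar> = int i"
  shows "Theta_gf \<kappa> l - fps_lift (sigma i) (Theta_gf \<kappa> l) = fps_const (zalpha i) * fps_X * Theta_gf (\<kappa> - 1) l"
proof (cases "i = 0")
  case True
  let ?T = "lin_prod (\<lambda>i. - tv i) l"
  have \<kappa>: "\<kappa> = 0" using assms True by simp
  have 1: "lin_prod zv (- 1) = fps_geom (zv 1)" by (simp add: lin_prod_def)
  have "Theta_gf \<kappa> l - fps_lift (sigma i) (Theta_gf \<kappa> l) =
      (fps_lin (- zv 1) * fps_geom (zv 1)) * Qgf * ?T - fps_lin (zv 1) * fps_geom (zv 1) * Qgf * ?T"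
    unfolding fps_lin_neg_geom
    by (simp add: Theta_gf_def \<kappa> True sigmaL.mult sigma_0_Qgf sigma_lin_prod_tv)
  also have "\<dots> = (fps_lin (- zv 1) - fps_lin (zv 1)) * Theta_gf (\<kappa> - 1) l"
    by (simp add: \<kappa> Theta_gf_def 1) (simp add: algebra_simps)
  also have "fps_lin (- zv 1) - fps_lin (zv 1) = fps_const (zalpha i) * fps_X"
    by (simp add: fps_lin_diff zalpha_eq True flip: mult_2 del: fps_const_neg)
  finally show ?thesis .
next
  case False
  let ?T = "lin_prod (\<lambda>i. - tv i) l" and ?s = "\<lambda>j. zv (transpose i (i + 1) j)"
  have "lin_prod zv \<kappa> - lin_prod ?s \<kappa> = fps_const (zalpha i) * fps_X * lin_prod zv (\<kappa> - 1)"
  proof (cases "\<kappa> \<ge> 0")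
    case True
    then have \<kappa>: "\<kappa> = int i" using assms by simp
    have "lin_prod ?s (\<kappa> - 1) = lin_prod zv (\<kappa> - 1)"
      using False \<kappa> by (intro lin_prod_transpose) auto
    then have "lin_prod zv \<kappa> - lin_prod ?s \<kappa> = lin_prod zv (\<kappa> - 1) * (fps_lin (zv i) - fps_lin (zv (i + 1)))"
      using lin_prod_pos[of \<kappa> zv] lin_prod_pos[of \<kappa> ?s] False \<kappa> by (simp add: right_diff_distrib)
    then show ?thesis using False by (simp add: fps_lin_diff zalpha_eq mult_ac)
  next
    case neg: False
    then have \<kappa>: "\<kappa> = - int i" using assms by simp
    have "lin_prod ?s (\<kappa> + 1) = lin_prod zv (\<kappa> + 1)"
      using False \<kappa> by (intro lin_prod_transpose) auto
    then have "lin_prod zv \<kappa> - lin_prod ?s \<kappa> = lin_prod zv (\<kappa> + 1) * (fps_geom (zv i) - fps_geom (zv (i + 1)))"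
      using lin_prod_neg[of "\<kappa> + 1" zv] lin_prod_neg[of "\<kappa> + 1" ?s] False \<kappa> by (simp add: right_diff_distrib)
    also have "\<dots> = fps_const (zalpha i) * fps_X * (lin_prod zv (\<kappa> + 1) * fps_geom (zv i) * fps_geom (zv (i + 1)))"
      using False by (simp add: fps_geom_diff zalpha_eq mult_ac)
    also have "lin_prod zv (\<kappa> + 1) * fps_geom (zv i) * fps_geom (zv (i + 1)) = lin_prod zv (\<kappa> - 1)"
      using lin_prod_neg[of "\<kappa> + 1" zv] lin_prod_neg[of \<kappa> zv] False \<kappa> by (simp add: nat_add_distrib)
    finally show ?thesis .
  qed
  then have "Qgf * (lin_prod zv \<kappa> - lin_prod ?s \<kappa>) * ?T = Qgf * (fps_const (zalpha i) * fps_X * lin_prod zv (\<kappa> - 1)) * ?T"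
    by simp
  then show ?thesis
    using False by (subst sigma_Theta_gf_Suc) (auto simp: Theta_gf_def algebra_simps)
qed

lemma sigma_Theta: "\<bar>\<kappa>\<bar> \<noteq> int i \<Longrightarrow> sigma i (Theta \<kappa> l r) = Theta \<kappa> l r"
  using arg_cong[OF sigma_Theta_gf[of \<kappa> i l], of "\<lambda>F. fps_nth F (nat r)"] by (simp add: Theta_def)

lemma Theta_neg [simp]: "r < 0 \<Longrightarrow> Theta \<kappa> l r = 0"
  by (simp add: Theta_def)

lemma fps_const_X_mult_nth:
  "fps_nth (fps_const c * fps_X * F) r = (if r = 0 then 0 else c * fps_nth F (r - 1))"
  for c :: "'a::comm_ring_1"
  unfolding mult.assoc[of "fps_const c"] by simp

lemma Theta_ddz:
  assumes "\<bar>\<kappa>\<bar> = int i"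
  shows "Theta \<kappa> l r - sigma i (Theta \<kappa> l r) = zalpha i * Theta (\<kappa> - 1) l (r - 1)"
proof (cases "r < 0")
  case False
  then show ?thesis
    using arg_cong[OF Theta_gf_ddz[OF assms, of l], of "\<lambda>F. fps_nth F (nat r)"]
    unfolding fps_const_X_mult_nth by (auto simp: Theta_def nat_diff_distrib)
qed simp

text \<open>Beyond a common product the two series differ by \<open>(1 - t u) - (1 + z u)\<close>.
  This measures the failure of a lowered entry to be invariant under \<open>Omega\<close>.\<close>

lemma Theta_swap_diff:
  assumes "i \<ge> 1"
  shows "Theta (int i - 1) (int i) r - Theta (int i) (int i - 1) r =
    - (tv i + zv i) * Theta (int i - 1) (int i - 1) (r - 1)"
proof (cases "r < 0")
  case False
  let ?k = "int i - 1"
  let ?B = "Qgf * lin_prod zv ?k * lin_prod (\<lambda>i. - tv i) ?k"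
  have "Theta_gf ?k (int i) - Theta_gf (int i) ?k = ?B * (fps_lin (- tv i) - fps_lin (zv i))"
    using assms by (simp add: Theta_gf_def lin_prod_pos[of "int i"] algebra_simps)
  also have "\<dots> = fps_const (- (tv i + zv i)) * fps_X * Theta_gf ?k ?k"
    by (simp add: fps_lin_diff Theta_gf_def mult_ac del: fps_const_neg)
  finally have "fps_nth (Theta_gf ?k (int i) - Theta_gf (int i) ?k) (nat r) =
      (if nat r = 0 then 0 else - (tv i + zv i) * fps_nth (Theta_gf ?k ?k) (nat r - 1))"
    by (simp only: fps_const_X_mult_nth)
  then show ?thesis
    using False by (auto simp: Theta_def nat_diff_distrib)
qed simp

lemma lin_prod_nth_0 [simp]: "fps_nth (lin_prod v \<kappa>) 0 = 1"
proof -
  have "fps_nth (\<Prod>i=1..m. h i) 0 = 1" if "\<And>i. fps_nth (h i) 0 = 1" for m and h :: "nat \<Rightarrow> 'a fps"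
    by (induction m) (auto simp: fps_mult_nth_0 that)
  then show ?thesis by (simp add: lin_prod_def)
qed

lemma Theta_0 [simp]: "Theta \<kappa> l 0 = 1"
  by (simp add: Theta_def Theta_gf_def fps_mult_nth_0)

lemma Theta_Rinf: "Theta \<kappa> l r \<in> Rinf"
proof -
  have "fps_coeffs_in Rinf (Theta_gf \<kappa> l)"
    by (auto simp: Theta_gf_def lin_prod_def intro!: fps_coeffs_intros Rinf_closed tv_in_Rinf zv_in_Rinf)
  then show ?thesis by (auto simp: Theta_def Rinf_closed fps_coeffs_inD)
qed

lemma ord_ge_Theta: "ord_ge (nat r) (Theta \<kappa> l r)"
proof -
  have "graded_ord (Theta_gf \<kappa> l)"
    by (auto simp: Theta_gf_def lin_prod_def intro!: graded_ord_mult graded_ord_prod graded_ord_lin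
        graded_ord_geom graded_ord_Qgf ord_ge_mvar ord_ge_uminus)
  then show ?thesis by (auto simp: Theta_def graded_ord_def)
qed

text \<open>Each pair of factors equals \<open>1 - v\<^sup>2 u\<^sup>2\<close>, so the product has
  degree at most twice the number of pairs.\<close>

lemma fps_prod_lin_neg_lin_nth:
  "r > 2 * card A \<Longrightarrow> fps_nth (\<Prod>i\<in>A. fps_lin (v i) * fps_lin (- v i)) r = 0"
  if "finite A" for v :: "nat \<Rightarrow> 'a::comm_ring_1"
  using that
proof (induction A arbitrary: r)
  case (insert x A)
  have "fps_lin (v x) * fps_lin (- v x) = 1 - fps_const (v x * v x) * fps_X ^ 2"
    by (simp add: fps_lin_def algebra_simps power2_eq_square flip: fps_const_neg fps_const_mult)
  with insert show ?case
    by (simp add: left_diff_distrib mult.assoc fps_X_power_mult_nth)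
qed (simp add: fps_one_nth)

lemma lin_prod_neg_arg:
  "\<kappa> \<ge> 0 \<Longrightarrow> lin_prod v \<kappa> * fps_neg_arg (lin_prod v \<kappa>) = (\<Prod>i=1..nat \<kappa>. fps_lin (v i) * fps_lin (- v i))"
  by (simp add: lin_prod_def neg_arg.prod prod.distrib)

text \<open>
  For \<open>\<kappa>, l \<ge> 0\<close> the product of \<open>Theta_gf \<kappa> l\<close> with its image under \<open>u \<mapsto> - u\<close> is a polynomial of
  degree at most \<open>2 (\<kappa> + l)\<close>; its coefficient of \<open>u^(2r)\<close> is up to sign the left-hand side below.
\<close>

lemma Theta_quadratic:
  assumes "\<kappa> \<ge> 0" "l \<ge> 0" "int r > \<kappa> + l"
  shows "Theta \<kappa> l (int r) * Theta \<kappa> l (int r) +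
    2 * (\<Sum>s=1..r. (- 1) ^ s * Theta \<kappa> l (int r + int s) * Theta \<kappa> l (int r - int s)) = 0"
proof -
  let ?G = "Theta_gf \<kappa> l" and ?c = "\<lambda>j. fps_nth (Theta_gf \<kappa> l) j"
  \<comment> \<open>The z- and t-variables are strung into one family so that a single degree bound
    applies to all factors.\<close>
  let ?v = "\<lambda>i. if i \<le> nat \<kappa> then zv i else - tv (i - nat \<kappa>)"
  let ?w = "\<lambda>a. fps_lin a * fps_lin (- a)"
  have "?G * fps_neg_arg ?G = (Qgf * fps_neg_arg Qgf) *
      (lin_prod zv \<kappa> * fps_neg_arg (lin_prod zv \<kappa>)) *
      (lin_prod (\<lambda>i. - tv i) l * fps_neg_arg (lin_prod (\<lambda>i. - tv i) l))"
    by (simp add: Theta_gf_def neg_arg.mult mult_ac)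
  also have "\<dots> = (\<Prod>i=1..nat \<kappa>. ?w (zv i)) * (\<Prod>i=1..nat l. ?w (- tv i))"
    using assms by (simp add: Qgf_neg_arg lin_prod_neg_arg)
  also have "(\<Prod>i=1..nat \<kappa>. ?w (zv i)) = (\<Prod>i=1..nat \<kappa>. ?w (?v i))"
    by simp
  also have "(\<Prod>i=1..nat l. ?w (- tv i)) = (\<Prod>i=nat \<kappa> + 1..nat \<kappa> + nat l. ?w (?v i))"
    by (rule prod.reindex_bij_witness[of _ "\<lambda>i. i - nat \<kappa>" "\<lambda>i. i + nat \<kappa>"]) auto
  also have "(\<Prod>i=1..nat \<kappa>. ?w (?v i)) * (\<Prod>i=nat \<kappa> + 1..nat \<kappa> + nat l. ?w (?v i)) =
      (\<Prod>i=1..nat \<kappa> + nat l. ?w (?v i))"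
    by (rule prod.ub_add_nat[symmetric]) simp
  finally have "fps_nth (?G * fps_neg_arg ?G) (2 * r) = 0"
    using fps_prod_lin_neg_lin_nth[of "{1..nat \<kappa> + nat l}" "2 * r" ?v] assms by auto
  then have 0: "(\<Sum>i=0..2 * r. (- 1) ^ i * ?c i * ?c (2 * r - i)) = 0"
  proof -
    have "(- 1) ^ (2 * r - i) = (- 1 :: ring_elt) ^ i" if "i \<le> 2 * r" for i
      using that by (simp add: minus_one_power_iff)
    then have "(\<Sum>i=0..2 * r. (- 1) ^ i * ?c i * ?c (2 * r - i)) = fps_nth (?G * fps_neg_arg ?G) (2 * r)"
      unfolding fps_mult_nth fps_neg_arg_nth by (intro sum.cong) (auto simp: mult_ac)
    with \<open>fps_nth (?G * fps_neg_arg ?G) (2 * r) = 0\<close> show ?thesis by simp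
  qed
  let ?f = "\<lambda>i. (- 1) ^ i * ?c i * ?c (2 * r - i)"
  let ?S = "\<Sum>s=1..r. (- 1) ^ s * ?c (r + s) * ?c (r - s)"
  \<comment> \<open>The terms i and 2 r - i of the coefficient agree, so the two halves around the
    middle term give the factor 2. All signs are relative to \<open>(- 1) ^ r\<close>.\<close>
  have "{0..2 * r} = {0..<r} \<union> {r} \<union> {Suc r..2 * r}" by auto
  then have "sum ?f {0..2 * r} = sum ?f {0..<r} + ?f r + sum ?f {Suc r..2 * r}"
    by (simp, subst sum.union_disjoint, auto)
  also have "sum ?f {0..<r} = (\<Sum>s=1..r. (- 1) ^ r * ((- 1) ^ s * ?c (r + s) * ?c (r - s)))"
  proof (rule sum.reindex_bij_witness[of _ "\<lambda>s. r - s" "\<lambda>i. r - i"])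
    fix i assume "i \<in> {0..<r}"
    then have e: "(- 1) ^ r * (- 1) ^ (r - i) = (- 1 :: ring_elt) ^ i" "r + (r - i) = 2 * r - i" "r - (r - i) = i"
      by (auto simp: minus_one_power_iff)
    show "(- 1) ^ r * ((- 1) ^ (r - i) * ?c (r + (r - i)) * ?c (r - (r - i))) = ?f i"
      unfolding e(2,3) e(1)[symmetric] by (simp only: mult_ac)
  qed auto
  also have "\<dots> = (- 1) ^ r * ?S" by (simp add: sum_distrib_left)
  also have "sum ?f {Suc r..2 * r} = (\<Sum>s=1..r. (- 1) ^ r * ((- 1) ^ s * ?c (r + s) * ?c (r - s)))"
  proof (rule sum.reindex_bij_witness[of _ "\<lambda>s. r + s" "\<lambda>i. i - r"])
    fix i assume "i \<in> {Suc r..2 * r}"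
    then have "(- 1) ^ r * (- 1) ^ (i - r) = (- 1 :: ring_elt) ^ i" "r + (i - r) = i" "r - (i - r) = 2 * r - i"
      by (auto simp: power_add[symmetric])
    then show "(- 1) ^ r * ((- 1) ^ (i - r) * ?c (r + (i - r)) * ?c (r - (i - r))) = ?f i"
      by (simp only: mult.assoc[symmetric])
  qed auto
  also have "\<dots> = (- 1) ^ r * ?S" by (simp add: sum_distrib_left)
  finally have "(- 1) ^ r * (?c r * ?c r + 2 * ?S) = 0"
    using 0 by (simp add: algebra_simps)
  then have "(- 1) ^ r * ((- 1) ^ r * (?c r * ?c r + 2 * ?S)) = 0" by simp
  then have "?c r * ?c r + 2 * ?S = 0"
    by (simp add: mult.assoc[symmetric] power_add[symmetric] mult_2[symmetric])
  moreover have "?S = (\<Sum>s=1..r. (- 1) ^ s * Theta \<kappa> l (int r + int s) * Theta \<kappa> l (int r - int s))"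
    by (intro sum.cong) (auto simp: Theta_def nat_add_distrib nat_diff_distrib)
  ultimately show ?thesis by (simp add: Theta_def)
qed

section \<open>Pfaffians\<close>

definition drop_nth :: "nat \<Rightarrow> 'a list \<Rightarrow> 'a list"
  where "drop_nth j xs = take j xs @ drop (Suc j) xs"

lemma length_drop_nth [simp]: "j < length xs \<Longrightarrow> length (drop_nth j xs) = length xs - 1"
  by (simp add: drop_nth_def)

lemma nth_drop_nth: "j < length xs \<Longrightarrow> drop_nth j xs ! l = (if l < j then xs ! l else xs ! Suc l)"
  by (auto simp: drop_nth_def nth_append min_def)

lemma set_drop_nth: "set (drop_nth j xs) \<subseteq> set xs"
  by (auto simp: drop_nth_def dest: in_set_takeD in_set_dropD)

lemma map_drop_nth: "map f (drop_nth j xs) = drop_nth j (map f xs)"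
  by (simp add: drop_nth_def take_map drop_map)

lemma distinct_drop_nth: "distinct xs \<Longrightarrow> distinct (drop_nth j xs)"
  by (auto simp: drop_nth_def set_take_disj_set_drop_if_distinct)

lemma nth_notin_drop_nth: "distinct xs \<Longrightarrow> j < length xs \<Longrightarrow> xs ! j \<notin> set (drop_nth j xs)"
  by (auto simp: in_set_conv_nth nth_drop_nth nth_eq_iff_index_eq split: if_splits)

lemma nth_in_drop_nth: "i < length xs \<Longrightarrow> j < length xs \<Longrightarrow> i \<noteq> j \<Longrightarrow> xs ! i \<in> set (drop_nth j xs)"
proof (cases "i < j")
  case True
  assume "i < length xs" "j < length xs"
  with True show ?thesis by (auto simp: in_set_conv_nth nth_drop_nth intro!: exI[of _ i])
next
  case False
  assume "i < length xs" "j < length xs" "i \<noteq> j"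
  with False show ?thesis by (auto simp: in_set_conv_nth nth_drop_nth intro!: exI[of _ "i - 1"])
qed

lemma sorted_wrt_drop_nth: "sorted_wrt P xs \<Longrightarrow> sorted_wrt P (drop_nth j xs)"
proof (induction xs arbitrary: j)
  case (Cons x xs)
  then show ?case using set_drop_nth[of "j - 1" xs] by (cases j) (auto simp: drop_nth_def)
qed (simp add: drop_nth_def)

lemma drop_nth_drop_nth:
  assumes "l < j" "j < length xs"
  shows "drop_nth l (drop_nth j xs) = drop_nth (j - 1) (drop_nth l xs)"
  by (rule nth_equalityI) (use assms in \<open>auto simp: nth_drop_nth\<close>)

lemma drop_nth_append:
  "drop_nth j (xs @ ys) = (if j < length xs then drop_nth j xs @ ys else xs @ drop_nth (j - length xs) ys)"
  by (auto simp: drop_nth_def Suc_diff_le)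

lemma drop_nth_0_Cons [simp]: "drop_nth 0 (x # xs) = xs"
  and drop_nth_Suc_Cons [simp]: "drop_nth (Suc j) (x # xs) = x # drop_nth j xs"
  by (simp_all add: drop_nth_def)

text \<open>Expansion along the first row. Entries are addressed by labels and not by positions, so
  reordering the list reorders rows and columns. Only entries whose first label stands earlier in
  the list are read, and a list of odd length gives 0.\<close>

function pfaff :: "('b \<Rightarrow> 'b \<Rightarrow> 'a::comm_ring_1) \<Rightarrow> 'b list \<Rightarrow> 'a" where
  "pfaff M [] = 1"
| "pfaff M (x # ys) = (\<Sum>j<length ys. (- 1) ^ j * M x (ys ! j) * pfaff M (drop_nth j ys))"
  by pat_completeness auto
termination
  by (relation "measure (\<lambda>(M, xs). length xs)") auto

lemma pfaff_cong:
  "sorted_wrt (\<lambda>x y. M x y = M' x y) xs \<Longrightarrow> pfaff M xs = pfaff M' xs"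
proof (induction M xs rule: pfaff.induct)
  case (2 M x ys)
  have "pfaff M (drop_nth j ys) = pfaff M' (drop_nth j ys)" if "j < length ys" for j
    using that 2 by (simp add: sorted_wrt_drop_nth)
  with 2 show ?case by (auto intro!: sum.cong)
qed simp

lemma pfaff_cong_set:
  assumes "\<And>x y. x \<in> set xs \<Longrightarrow> y \<in> set xs \<Longrightarrow> x \<noteq> y \<Longrightarrow> M x y = M' x y" "distinct xs"
  shows "pfaff M xs = pfaff M' xs"
proof (rule pfaff_cong)
  have "sorted_wrt (\<noteq>) xs" using assms(2) by (simp add: sorted_wrt_iff_nth_less nth_eq_iff_index_eq)
  then show "sorted_wrt (\<lambda>x y. M x y = M' x y) xs"
    by (rule sorted_wrt_mono_rel[rotated]) (use assms in auto)
qed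

lemma pfaff_map: "pfaff M (map f xs) = pfaff (\<lambda>x y. M (f x) (f y)) xs"
proof (induction "length xs" arbitrary: xs rule: less_induct)
  case less
  show ?case
  proof (cases xs)
    case (Cons x ys)
    then have "pfaff M (map f (drop_nth j ys)) = pfaff (\<lambda>x y. M (f x) (f y)) (drop_nth j ys)" if "j < length ys" for j
      using less that by simp
    then show ?thesis by (simp add: Cons map_drop_nth[symmetric])
  qed simp
qed

lemma (in rhom) pfaff: "\<phi> (pfaff M xs) = pfaff (\<lambda>x y. \<phi> (M x y)) xs"
proof (induction "length xs" arbitrary: xs rule: less_induct)
  case less
  show ?case
  proof (cases xs)
    case (Cons x ys)
    then have "\<phi> (pfaff M (drop_nth j ys)) = pfaff (\<lambda>x y. \<phi> (M x y)) (drop_nth j ys)" if "j < length ys" for j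
      using less that by simp
    then show ?thesis by (simp add: Cons sum mult power uminus)
  qed simp
qed

text \<open>In every term of the expansion the label a occurs exactly once: either in the matrix
  entry in front or in the remaining Pfaffian, where induction applies.\<close>

lemma pfaff_linear:
  assumes "distinct xs" "a \<in> set xs"
    and "\<And>x y. x \<in> set xs \<Longrightarrow> y \<in> set xs \<Longrightarrow> x \<noteq> a \<Longrightarrow> y \<noteq> a \<Longrightarrow> M1 x y = M x y \<and> M2 x y = M x y"
    and "\<And>y. y \<in> set xs \<Longrightarrow> y \<noteq> a \<Longrightarrow> M a y = M1 a y + c * M2 a y \<and> M y a = M1 y a + c * M2 y a"
  shows "pfaff M xs = pfaff M1 xs + c * pfaff M2 xs"
  using assms
proof (induction "length xs" arbitrary: xs rule: less_induct)
  case less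
  obtain x ys where xs: "xs = x # ys" using less.prems(2) by (cases xs) auto
  have same: "pfaff M1 zs = pfaff M zs \<and> pfaff M2 zs = pfaff M zs"
    if "distinct zs" "set zs \<subseteq> set xs" "a \<notin> set zs" for zs
    using that less.prems(3) by (intro conjI pfaff_cong_set) (metis subsetD)+
  have "M x (ys ! j) * pfaff M (drop_nth j ys) =
      M1 x (ys ! j) * pfaff M1 (drop_nth j ys) + c * (M2 x (ys ! j) * pfaff M2 (drop_nth j ys))"
    if j: "j < length ys" for j
  proof -
    let ?zs = "drop_nth j ys"
    have zs: "distinct ?zs" "set ?zs \<subseteq> set xs" "length ?zs < length xs"
      using j less.prems(1) set_drop_nth[of j ys] by (auto simp: xs distinct_drop_nth)
    have yj: "ys ! j \<in> set xs" using j by (simp add: xs)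
    show ?thesis
    proof (cases "x = a \<or> ys ! j = a")
      case True
      have "a \<notin> set ?zs"
        using True less.prems(1) j nth_notin_drop_nth[of ys j] set_drop_nth[of j ys] by (auto simp: xs)
      note s = same[OF zs(1,2) this]
      have "x \<noteq> ys ! j" using less.prems(1) j by (auto simp: xs)
      with True have "M x (ys ! j) = M1 x (ys ! j) + c * M2 x (ys ! j)"
        using less.prems(4)[OF yj] less.prems(4)[of x] by (auto simp: xs)
      with s show ?thesis by (simp add: algebra_simps)
    next
      case False
      then have "a \<in> set ys" using less.prems(2) by (auto simp: xs)
      then obtain i where "i < length ys" "ys ! i = a" by (auto simp: in_set_conv_nth)
      with False have "a \<in> set ?zs" using nth_in_drop_nth[of i ys j] j by auto
      then have "pfaff M ?zs = pfaff M1 ?zs + c * pfaff M2 ?zs"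
        using zs less.prems(3,4) by (intro less.hyps) (auto simp: subset_iff)
      moreover have "M1 x (ys ! j) = M x (ys ! j) \<and> M2 x (ys ! j) = M x (ys ! j)"
        using less.prems(3)[of x "ys ! j"] yj False by (simp add: xs)
      ultimately show ?thesis by (simp add: algebra_simps)
    qed
  qed
  then have "pfaff M xs = (\<Sum>j<length ys. (- 1) ^ j * (M1 x (ys ! j) * pfaff M1 (drop_nth j ys) +
      c * (M2 x (ys ! j) * pfaff M2 (drop_nth j ys))))"
    by (simp add: xs mult.assoc)
  then show ?case
    by (simp add: xs sum.distrib sum_distrib_left algebra_simps)
qed

text \<open>D is the part of the expansion along two rows x and y in which they are not paired with
  each other. It is stated without skewness and also covers x = y, where it shows that D is its own
  negative.\<close>

lemma pfaff_double_expansion_swap: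
  fixes M :: "'b \<Rightarrow> 'b \<Rightarrow> 'a::comm_ring_1"
  defines "D \<equiv> \<lambda>x y zs. \<Sum>j<length zs. (- 1) ^ j * M x (zs ! j) *
    (\<Sum>l<length zs - 1. (- 1) ^ l * M y (drop_nth j zs ! l) * pfaff M (drop_nth l (drop_nth j zs)))"
  shows "D x y zs = - D y x zs"
proof -
  let ?A = "{..<length zs} \<times> {..<length zs - 1}"
  let ?f = "\<lambda>x y (j, l). (- 1) ^ (j + l) * (M x (zs ! j) * M y (drop_nth j zs ! l)) * pfaff M (drop_nth l (drop_nth j zs))"
  \<comment> \<open>The index l counts positions after removal of j. The involution describes the
    same two columns chosen in the opposite order; it changes j + l by one and thus the
    sign.\<close>
  let ?w = "\<lambda>(j::nat, l::nat). if l < j then (l, j - 1) else (Suc l, j)"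
  have D: "D x y zs = sum (?f x y) ?A" for x y
    unfolding D_def sum.cartesian_product[symmetric] sum_distrib_left
    by (intro sum.cong refl) (simp add: power_add mult_ac)
  have "sum (?f x y) ?A = (\<Sum>p\<in>?A. - ?f y x p)"
  proof (rule sum.reindex_bij_witness[of _ ?w ?w])
    fix p assume "p \<in> ?A"
    then obtain j l where p: "p = (j, l)" "j < length zs" "l < length zs - 1" by auto
    show "?w (?w p) = p" "?w (?w p) = p" using p by auto
    show "?w p \<in> ?A" "?w p \<in> ?A" using p by auto
    show "- ?f y x (?w p) = ?f x y p"
    proof (cases "l < j")
      case True
      then obtain j' where j': "j = Suc j'" "l \<le> j'" by (cases j) auto
      then show ?thesis
        using p drop_nth_drop_nth[of l j zs] by (simp add: nth_drop_nth mult_ac add.commute)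
    next
      case False
      then show ?thesis
        using p drop_nth_drop_nth[of j "Suc l" zs] by (simp add: nth_drop_nth mult_ac add.commute)
    qed
  qed
  then show ?thesis unfolding D by (simp add: sum_negf)
qed

definition skew :: "('b \<Rightarrow> 'b \<Rightarrow> 'a::comm_ring_1) \<Rightarrow> bool"
  where "skew M \<longleftrightarrow> (\<forall>x y. M x y = - M y x)"

lemma skewD: "skew M \<Longrightarrow> M x y = - M y x"
  unfolding skew_def by blast

text \<open>At the front, the pairing of the two labels changes sign by skewness and the rest by the
  double expansion. Further back, the expansion along the first row is reindexed by the swap and
  induction handles the terms that still contain both labels.\<close>

lemma pfaff_swap:
  assumes "skew M"
  shows "pfaff M (us @ x0 # y0 # vs) = - pfaff M (us @ y0 # x0 # vs)"
proof (induction "length us + length vs" arbitrary: us vs rule: less_induct)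
  case less
  show ?case
  proof (cases us)
    case Nil
    have e: "pfaff M (x # y # vs) = M x y * pfaff M vs - (\<Sum>j<length vs. (- 1) ^ j * M x (vs ! j) *
      (\<Sum>l<length vs - 1. (- 1) ^ l * M y (drop_nth j vs ! l) * pfaff M (drop_nth l (drop_nth j vs))))" for x y
      by (simp add: sum.lessThan_Suc_shift sum_negf mult.assoc del: sum.lessThan_Suc)
    show ?thesis
      using pfaff_double_expansion_swap[where zs = vs and M = M and x = x0 and y = y0] skewD[OF assms, of x0 y0]
      unfolding Nil append_Nil e by simp
  next
    case (Cons u us')
    let ?p = "length us'"
    let ?L = "us' @ x0 # y0 # vs" and ?R = "us' @ y0 # x0 # vs"
    let ?f = "\<lambda>zs j. (- 1) ^ j * M u (zs ! j) * pfaff M (drop_nth j zs)"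
    have "(\<Sum>j<length ?L. ?f ?L j) = (\<Sum>j<length ?L. - ?f ?R j)"
    proof (rule sum.reindex_bij_witness[of _ "transpose ?p (Suc ?p)" "transpose ?p (Suc ?p)"])
      fix j assume "j \<in> {..<length ?L}"
      then have j: "j < length ?L" by simp
      show "transpose ?p (Suc ?p) j \<in> {..<length ?L}" "transpose ?p (Suc ?p) j \<in> {..<length ?L}"
        using j by (auto simp: transpose_def)
      consider "j < ?p" | "j = ?p" | "j = Suc ?p" | k where "j = ?p + 2 + k" "k < length vs"
      proof -
        have "j - (?p + 2) < length vs \<and> j = ?p + 2 + (j - (?p + 2))" if "j > Suc ?p"
          using that j by auto
        then show thesis using that by (metis linorder_neqE_nat not_less_eq)
      qed
      then show "- ?f ?R (transpose ?p (Suc ?p) j) = ?f ?L j"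
      proof cases
        case 1
        have "pfaff M (drop_nth j us' @ x0 # y0 # vs) = - pfaff M (drop_nth j us' @ y0 # x0 # vs)"
          using 1 by (intro less.hyps) (simp add: Cons)
        with 1 show ?thesis by (simp add: drop_nth_append nth_append)
      next
        case 4
        have "pfaff M (us' @ x0 # y0 # drop_nth k vs) = - pfaff M (us' @ y0 # x0 # drop_nth k vs)"
          using 4 by (intro less.hyps) (simp add: Cons)
        with 4 show ?thesis by (simp add: drop_nth_append nth_append)
      qed (simp_all add: drop_nth_append nth_append)
    qed auto
    then show ?thesis by (simp add: Cons sum_negf)
  qed
qed

lemma pfaff_move_to_front:
  assumes "skew M"
  shows "pfaff M (us @ x0 # vs) = (- 1) ^ length us * pfaff M (x0 # us @ vs)"
proof (induction us arbitrary: vs rule: rev_induct)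
  case (snoc u us)
  have "pfaff M (us @ u # x0 # vs) = - pfaff M (us @ x0 # u # vs)"
    by (rule pfaff_swap[OF assms])
  also have "pfaff M (us @ x0 # u # vs) = (- 1) ^ length us * pfaff M (x0 # us @ u # vs)"
    by (rule snoc.IH)
  finally show ?case by simp
qed simp

text \<open>Renaming a to b and back leaves the matrix unchanged on these labels, while exchanging
  the two places changes the sign.\<close>

lemma pfaff_adjacent_equal:
  fixes M :: "'b \<Rightarrow> 'b \<Rightarrow> 'v mps"
  assumes "skew M"
    and "\<And>z. z \<in> set (us @ vs) \<Longrightarrow> M a z = M b z" "M a b = 0" "distinct (us @ a # b # vs)"
  shows "pfaff M (us @ a # b # vs) = 0"
proof -
  let ?t = "transpose a b"
  have "map ?t (us @ b # a # vs) = us @ a # b # vs"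
    using assms(4) by (auto intro!: map_idI simp: transpose_def)
  then have "pfaff M (us @ a # b # vs) = pfaff (\<lambda>x y. M (?t x) (?t y)) (us @ b # a # vs)"
    using pfaff_map[of M ?t "us @ b # a # vs"] by simp
  also have "\<dots> = pfaff M (us @ b # a # vs)"
  proof (rule pfaff_cong_set)
    have ab: "M b a = 0" using skewD[OF assms(1), of b a] assms(3) by simp
    have eq: "M z a = M z b" if "z \<in> set (us @ vs)" for z
      unfolding skewD[OF assms(1), of z a] skewD[OF assms(1), of z b] assms(2)[OF that] ..
    show "M (?t x) (?t y) = M x y"
      if "x \<in> set (us @ b # a # vs)" "y \<in> set (us @ b # a # vs)" "x \<noteq> y" for x y
      using that assms(2,3) eq ab by (auto simp: transpose_def)
  qed (use assms(4) in auto)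
  also have "\<dots> = - pfaff M (us @ a # b # vs)"
    using pfaff_swap[OF assms(1), of us a b vs] by simp
  finally show ?thesis by - (rule mps_double_eq_0, simp only: mult_2 eq_neg_iff_add_eq_0)
qed

section \<open>The multi Schur-Pfaffian as a matrix Pfaffian\<close>

type_synonym 'a entry = "(int \<Rightarrow> 'a) \<times> int"

definition pf_pair :: "'a::comm_ring_1 entry \<Rightarrow> 'a entry \<Rightarrow> 'a"
  where "pf_pair e e' = (case e of (c, r) \<Rightarrow> case e' of (d, q) \<Rightarrow>
    c r * d q + 2 * (\<Sum>s=1..nat q. (- 1) ^ s * c (r + int s) * d (q - int s)))"

definition entry_val :: "'a entry \<Rightarrow> 'a"
  where "entry_val e = fst e (snd e)"

text \<open>The expansion for odd length is the one for even length with a dummy first entry \<open>None\<close>.\<close>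

definition pf_mat :: "'a::comm_ring_1 entry option \<Rightarrow> 'a entry option \<Rightarrow> 'a"
  where "pf_mat x y = (case y of None \<Rightarrow> 0 | Some e' \<Rightarrow>
    (case x of None \<Rightarrow> entry_val e' | Some e \<Rightarrow> pf_pair e e'))"

lemma Pf_pair_eq: "Pf [e, e'] = pf_pair e e'"
  by (cases e; cases e') (simp add: pf_pair_def)

lemma omit_eq_drop_nth: "omit (Suc j) xs = drop_nth j xs"
  by (simp add: omit_def drop_nth_def)

lemma Pf_eq_pfaff_option:
  "Pf es = pfaff pf_mat ((if even (length es) then [] else [None]) @ map Some es)"
proof (induction "length es" arbitrary: es rule: less_induct)
  case less
  consider "es = []" | e where "es = [e]" | e e' where "es = [e, e']" | e1 e2 e3 es' where "es = e1 # e2 # e3 # es'"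
    by (metis Pf.cases)
  then show ?case
  proof cases
    case 2
    then show ?thesis by (cases e) (simp add: pf_mat_def entry_val_def drop_nth_def)
  next
    case 3
    then show ?thesis by (simp add: Pf_pair_eq pf_mat_def drop_nth_def)
  next
    case 4
    let ?ys = "e2 # e3 # es'"
    show ?thesis
    proof (cases "even (length es)")
      case True
      have IH: "Pf (drop_nth j ?ys) = pfaff pf_mat (map Some (drop_nth j ?ys))" if "j < length ?ys" for j
        using less[of "drop_nth j ?ys"] that True 4 by simp
      have "Pf es = (\<Sum>s=2..length es. (- 1) ^ s * Pf [e1, es ! (s - 1)] * Pf (tl (omit s es)))"
        using True by (simp add: 4 Let_def)
      also have "\<dots> = (\<Sum>j<length ?ys. (- 1) ^ j * Pf [e1, ?ys ! j] * Pf (drop_nth j ?ys))"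
      \<comment> \<open>The recursion counts from 1 and never pairs the first entry with itself, so
        its index s is position s - 2 in the tail.\<close>
      proof (rule sum.reindex_bij_witness[of _ "\<lambda>j. j + 2" "\<lambda>s. s - 2"])
        fix s assume "s \<in> {2..length es}"
        then obtain j where "s = Suc (Suc j)" by (metis Suc_le_D atLeastAtMost_iff numeral_2_eq_2 Suc_le_mono)
        then show "(- 1) ^ (s - 2) * Pf [e1, ?ys ! (s - 2)] * Pf (drop_nth (s - 2) ?ys) =
            (- 1) ^ s * Pf [e1, es ! (s - 1)] * Pf (tl (omit s es))"
          by (simp add: 4 omit_eq_drop_nth del: Pf.simps)
      qed (auto simp: 4)
      also have "\<dots> = (\<Sum>j<length ?ys. (- 1) ^ j * pf_mat (Some e1) (map Some ?ys ! j) * pfaff pf_mat (drop_nth j (map Some ?ys)))"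
        by (intro sum.cong refl) (simp only: lessThan_iff IH Pf_pair_eq nth_map map_drop_nth pf_mat_def option.case)
      also have "\<dots> = pfaff pf_mat (map Some es)"
        using list.map(2)[of Some e1 ?ys] by (simp only: 4 pfaff.simps(2) length_map)
      finally show ?thesis using True by simp
    next
      case False
      have IH: "Pf (drop_nth j es) = pfaff pf_mat (map Some (drop_nth j es))" if "j < length es" for j
        using less[of "drop_nth j es"] that False 4 by simp
      have "Pf es = (\<Sum>s=1..length es. (- 1) ^ (s - 1) * (case es ! (s - 1) of (c, r) \<Rightarrow> c r) * Pf (omit s es))"
        using False by (simp add: 4 Let_def)
      also have "\<dots> = (\<Sum>j<length es. (- 1) ^ j * entry_val (es ! j) * Pf (drop_nth j es))"
      proof (rule sum.reindex_bij_witness[of _ "\<lambda>j. j + 1" "\<lambda>s. s - 1"])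
        fix s assume "s \<in> {1..length es}"
        then obtain j where "s = Suc j" by (metis Suc_le_D atLeastAtMost_iff One_nat_def)
        then show "(- 1) ^ (s - 1) * entry_val (es ! (s - 1)) * Pf (drop_nth (s - 1) es) =
            (- 1) ^ (s - 1) * (case es ! (s - 1) of (c, r) \<Rightarrow> c r) * Pf (omit s es)"
          by (simp add: omit_eq_drop_nth entry_val_def case_prod_unfold)
      qed auto
      also have "\<dots> = (\<Sum>j<length es. (- 1) ^ j * pf_mat None (map Some es ! j) * pfaff pf_mat (drop_nth j (map Some es)))"
        by (intro sum.cong refl) (simp only: lessThan_iff IH nth_map map_drop_nth pf_mat_def option.case)
      also have "\<dots> = pfaff pf_mat (None # map Some es)"
        by (simp only: pfaff.simps(2) length_map)
      finally show ?thesis using False by simp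
    qed
  qed simp
qed

definition pf_label :: "'a entry list \<Rightarrow> nat \<Rightarrow> 'a entry option"
  where "pf_label es i = (if i = 0 then None else Some (es ! (i - 1)))"

text \<open>\<open>pf_mat\<close> itself is not skew, so its upper triangle is reflected to make
  exchanges of rows available. Labels are positions, with 0 for the dummy, and stay distinct even
  where entries coincide.\<close>

definition pf_matrix :: "'a::comm_ring_1 entry list \<Rightarrow> nat \<Rightarrow> nat \<Rightarrow> 'a"
  where "pf_matrix es i j = (if i < j then pf_mat (pf_label es i) (pf_label es j)
    else if j < i then - pf_mat (pf_label es j) (pf_label es i) else 0)"

lemma skew_pf_matrix: "skew (pf_matrix es)"
  by (auto simp: skew_def pf_matrix_def)

abbreviation pf_start :: "nat \<Rightarrow> nat"
  where "pf_start m \<equiv> (if even m then 1 else 0)"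

lemma Pf_eq_pfaff: "Pf es = pfaff (pf_matrix es) [pf_start (length es)..<Suc (length es)]"
proof -
  have "map Some es = map (pf_label es) [1..<Suc (length es)]"
    by (rule nth_equalityI) (auto simp: pf_label_def simp del: upt_Suc)
  moreover have "[None] = map (pf_label es) [0]" by (simp add: pf_label_def)
  ultimately have "(if even (length es) then [] else [None]) @ map Some es =
      map (pf_label es) [pf_start (length es)..<Suc (length es)]"
    by (auto simp: upt_conv_Cons simp del: upt_Suc)
  then have "Pf es = pfaff (\<lambda>i j. pf_mat (pf_label es i) (pf_label es j)) [pf_start (length es)..<Suc (length es)]"
    by (simp only: Pf_eq_pfaff_option pfaff_map)
  also have "\<dots> = pfaff (pf_matrix es) [pf_start (length es)..<Suc (length es)]"
    by (rule pfaff_cong, rule sorted_wrt_mono_rel[OF _ sorted_wrt_upt]) (simp add: pf_matrix_def)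
  finally show ?thesis .
qed

lemma (in rhom) Pf: "\<phi> (Pf es) = Pf (map (\<lambda>(c, r). (\<lambda>k. \<phi> (c k), r)) es)"
proof -
  let ?h = "\<lambda>(c, r). (\<lambda>k. \<phi> (c k), r)"
  have 1: "\<phi> (pf_mat x y) = pf_mat (map_option ?h x) (map_option ?h y)" for x y
    by (cases x; cases y)
       (auto simp: pf_mat_def pf_pair_def entry_val_def add mult two sum power uminus)
  have "map Some (map ?h es) = map (map_option ?h) (map Some es)" by simp
  then have "(if even (length es) then [] else [None]) @ map Some (map ?h es) =
      map (map_option ?h) ((if even (length es) then [] else [None]) @ map Some es)" by simp
  then show ?thesis
    by (simp only: Pf_eq_pfaff_option pfaff length_map pfaff_map 1)
qed

lemma pf_pair_linear_left:
  assumes "\<And>k. c k = c1 k + a * c2 (k - 1)"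
  shows "pf_pair (c, r) e = pf_pair (c1, r) e + a * pf_pair (c2, r - 1) e"
proof (cases e)
  case (Pair d q)
  have "r + int s - 1 = r - 1 + int s" for s by simp
  then show ?thesis
    by (simp add: Pair pf_pair_def assms algebra_simps sum.distrib sum_distrib_left)
qed

lemma pf_pair_linear_right:
  assumes "\<And>k. c k = c1 k + a * c2 (k - 1)" "\<And>k. k < 0 \<Longrightarrow> c2 k = 0"
  shows "pf_pair e (c, r) = pf_pair e (c1, r) + a * pf_pair e (c2, r - 1)"
proof (cases e)
  case (Pair d q)
  let ?S = "\<lambda>h. \<Sum>s=1..nat r. (- 1) ^ s * d (q + int s) * h (r - int s)"
  let ?T = "?S (\<lambda>k. c2 (k - 1))"
  \<comment> \<open>The two ranges differ at most by the term s = r, where \<open>c2\<close> is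
    taken at -1.\<close>
  have "(\<Sum>s=1..nat (r - 1). (- 1) ^ s * d (q + int s) * c2 (r - 1 - int s)) = ?T"
    by (rule sum.mono_neutral_cong_left) (auto simp: assms(2) algebra_simps)
  then have "pf_pair e (c2, r - 1) = d q * c2 (r - 1) + 2 * ?T"
    by (simp add: Pair pf_pair_def)
  moreover have "?S c = ?S c1 + a * ?T"
    by (simp add: assms(1) distrib_left sum.distrib sum_distrib_left mult_ac)
  then have "pf_pair e (c, r) = d q * (c1 r + a * c2 (r - 1)) + 2 * (?S c1 + a * ?T)"
    by (simp add: Pair pf_pair_def assms(1)[of r])
  moreover have "pf_pair e (c1, r) = d q * c1 r + 2 * ?S c1"
    by (simp add: Pair pf_pair_def)
  ultimately show ?thesis
    by (simp only: distrib_left mult_ac add_ac)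
qed

text \<open>An entry enters the matrix only through its own row and column, and these are linear in
  it. With the reflected entry as \<open>c1\<close> and a root as factor, this is the mechanism by
  which a divided difference passes to a single entry.\<close>

lemma Pf_linear:
  assumes "\<And>k. c k = c1 k + a * c2 (k - 1)" "\<And>k. k < 0 \<Longrightarrow> c2 k = 0"
  shows "Pf (us @ (c, r) # vs) = Pf (us @ (c1, r) # vs) + a * Pf (us @ (c2, r - 1) # vs)"
proof -
  let ?p = "Suc (length us)"
  let ?E = "\<lambda>e. us @ e # vs"
  let ?xs = "[pf_start (length (?E (c, r)))..<Suc (length (?E (c, r)))]"
  have p: "pf_label (?E e) ?p = Some e" for e by (simp add: pf_label_def)
  have np: "pf_label (?E e) i = pf_label (?E e') i" if "i \<noteq> ?p" for e e' i
    using that by (auto simp: pf_label_def nth_append nth_Cons split: nat.split)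
  have l: "pf_mat x (Some (c, r)) = pf_mat x (Some (c1, r)) + a * pf_mat x (Some (c2, r - 1))" for x
    using pf_pair_linear_right[of c c1 a c2, OF assms] by (auto simp: pf_mat_def entry_val_def assms(1) split: option.split)
  have r: "pf_mat (Some (c, r)) x = pf_mat (Some (c1, r)) x + a * pf_mat (Some (c2, r - 1)) x" for x
    using pf_pair_linear_left[of c c1 a c2, OF assms(1)] by (auto simp: pf_mat_def split: option.split)
  have "pfaff (pf_matrix (?E (c, r))) ?xs =
      pfaff (pf_matrix (?E (c1, r))) ?xs + a * pfaff (pf_matrix (?E (c2, r - 1))) ?xs"
  proof (rule pfaff_linear[where a = ?p])
    show "?p \<in> set ?xs" unfolding set_upt atLeastLessThan_iff by simp
    show "pf_matrix (?E (c1, r)) x y = pf_matrix (?E (c, r)) x y \<and>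
        pf_matrix (?E (c2, r - 1)) x y = pf_matrix (?E (c, r)) x y" if "x \<noteq> ?p" "y \<noteq> ?p" for x y
      using np[OF that(1), of "(c, r)" "(c1, r)"] np[OF that(1), of "(c, r)" "(c2, r - 1)"]
        np[OF that(2), of "(c, r)" "(c1, r)"] np[OF that(2), of "(c, r)" "(c2, r - 1)"]
      by (simp add: pf_matrix_def)
    show "pf_matrix (?E (c, r)) ?p y = pf_matrix (?E (c1, r)) ?p y + a * pf_matrix (?E (c2, r - 1)) ?p y \<and>
        pf_matrix (?E (c, r)) y ?p = pf_matrix (?E (c1, r)) y ?p + a * pf_matrix (?E (c2, r - 1)) y ?p"
      if "y \<noteq> ?p" for y
      using np[OF that, of "(c, r)" "(c1, r)"] np[OF that, of "(c, r)" "(c2, r - 1)"]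
      by (simp add: pf_matrix_def p l r algebra_simps)
  qed simp
  then show ?thesis by (simp add: Pf_eq_pfaff)
qed

lemma Pf_adjacent_equal:
  fixes c :: "int \<Rightarrow> 'v mps"
  assumes "pf_pair (c, r) (c, r) = 0"
  shows "Pf (us @ (c, r) # (c, r) # vs) = 0"
proof -
  let ?es = "us @ (c, r) # (c, r) # vs" and ?p = "Suc (length us)"
  let ?b = "pf_start (length ?es)"
  have l: "pf_label ?es ?p = Some (c, r)" "pf_label ?es (Suc ?p) = Some (c, r)"
    by (auto simp: pf_label_def nth_append)
  have xs: "[?b..<Suc (length ?es)] = [?b..<?p] @ ?p # Suc ?p # [Suc (Suc ?p)..<Suc (length ?es)]"
  proof -
    have "[?b..<Suc (length ?es)] = [?b..<?p] @ [?p..<Suc (length ?es)]"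
    proof -
      have "Suc (length ?es) = ?p + (length vs + 2)" "?b \<le> ?p" by auto
      then show ?thesis using upt_add_eq_append[of ?b ?p "length vs + 2"] by (simp only:)
    qed
    also have "[?p..<Suc (length ?es)] = ?p # Suc ?p # [Suc (Suc ?p)..<Suc (length ?es)]"
      by (simp add: upt_conv_Cons del: upt_Suc)
    finally show ?thesis .
  qed
  show ?thesis
    unfolding Pf_eq_pfaff xs
  proof (rule pfaff_adjacent_equal)
    show "pf_matrix ?es ?p (Suc ?p) = 0"
      by (simp add: pf_matrix_def l) (simp add: pf_mat_def assms)
    show "pf_matrix ?es ?p z = pf_matrix ?es (Suc ?p) z"
      if "z \<in> set ([?b..<?p] @ [Suc (Suc ?p)..<Suc (length ?es)])" for z
      using that by (auto simp: pf_matrix_def l simp del: upt_Suc)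
    show "distinct ([?b..<?p] @ ?p # Suc ?p # [Suc (Suc ?p)..<Suc (length ?es)])"
      unfolding xs[symmetric] by simp
  qed (rule skew_pf_matrix)
qed

text \<open>Pairing e with a last entry of degree 0 and value 1 yields \<open>entry_val e\<close>,
  exactly what the dummy gives. So for odd length the new entry becomes the dummy, and for even
  length the new entry and the dummy cancel as a pair.\<close>

lemma Pf_snoc_unit:
  fixes c :: "int \<Rightarrow> 'v mps"
  assumes "c 0 = 1"
  shows "Pf (es @ [(c, 0)]) = Pf es"
proof -
  let ?n = "length es"
  let ?es = "es @ [(c, 0)]"
  let ?P = "pf_matrix ?es" and ?u = "Suc (length es)" and ?us = "[1..<Suc (length es)]"
  have sub: "pf_label ?es i = pf_label es i" if "i \<le> ?n" for i
    using that by (auto simp: pf_label_def nth_append)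
  have P: "?P i j = pf_matrix es i j" if "i \<le> ?n" "j \<le> ?n" for i j
    using that by (simp add: pf_matrix_def sub)
  have ext: "pfaff ?P zs = pfaff (pf_matrix es) zs" if "set zs \<subseteq> {0..?n}" "distinct zs" for zs
    using that P by (intro pfaff_cong_set) (auto simp: subset_iff)
  have u: "?P ?u j = - ?P 0 j" if "j \<in> {1..?n}" for j
    using that assms
    by (simp add: pf_matrix_def) (simp add: pf_label_def pf_mat_def pf_pair_def entry_val_def nth_append case_prod_unfold)
  have row: "pfaff ?P (?u # zs) = - pfaff ?P (0 # zs)" if "set zs \<subseteq> {1..?n}" for zs
  proof -
    have "?P ?u (zs ! j) = - ?P 0 (zs ! j)" if "j < length zs" for j
      using u \<open>set zs \<subseteq> {1..?n}\<close> nth_mem[OF that] by blast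
    then show ?thesis by (simp add: sum_negf[symmetric] mult.assoc)
  qed
  have split: "[b..<Suc (length ?es)] = [b..<Suc ?n] @ ?u # []" if "b \<le> 1" for b
    using that by simp
  have set_us: "set ?us \<subseteq> {1..?n}" by auto
  show ?thesis
  proof (cases "even ?n")
    case False
    have "Pf ?es = pfaff ?P (?us @ ?u # [])"
      using False split[of 1] by (simp add: Pf_eq_pfaff del: upt_Suc pfaff.simps)
    also have "\<dots> = (- 1) ^ length ?us * pfaff ?P (?u # ?us @ [])"
      by (rule pfaff_move_to_front[OF skew_pf_matrix])
    also have "\<dots> = pfaff ?P (0 # ?us)"
      using False row[OF set_us] by (simp del: pfaff.simps upt_Suc)
    also have "0 # ?us = [0..<Suc ?n]" by (simp add: upt_conv_Cons del: upt_Suc)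
    also have "pfaff ?P [0..<Suc ?n] = Pf es"
      using False ext[of "[0..<Suc ?n]"] by (simp add: Pf_eq_pfaff atLeast0LessThan lessThan_Suc_atMost atLeast0AtMost del: upt_Suc pfaff.simps)
    finally show ?thesis .
  next
    case True
    have "Pf ?es = pfaff ?P ((0 # ?us) @ ?u # [])"
      using True split[of 0] by (simp add: Pf_eq_pfaff upt_conv_Cons del: upt_Suc pfaff.simps)
    also have "\<dots> = (- 1) ^ length (0 # ?us) * pfaff ?P (?u # (0 # ?us) @ [])"
      by (rule pfaff_move_to_front[OF skew_pf_matrix])
    also have "\<dots> = - pfaff ?P ([] @ ?u # 0 # ?us)"
      using True by (simp del: pfaff.simps upt_Suc)
    also have "\<dots> = pfaff ?P ([] @ 0 # ?u # ?us)"
      using pfaff_swap[OF skew_pf_matrix, of ?es "[]" ?u 0 ?us] by (simp only: minus_minus)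
    \<comment> \<open>In all terms but the first, the row of \<open>?u\<close> may be replaced by
      minus that of 0; this leaves a double expansion along two equal rows, which is its own
      negative.\<close>
    also have "\<dots> = ?P 0 ?u * pfaff ?P ?us - (\<Sum>j<length ?us. (- 1) ^ j * ?P 0 (?us ! j) * pfaff ?P (?u # drop_nth j ?us))"
      unfolding append_Nil pfaff.simps(2)[of ?P 0]
      by (simp add: sum.lessThan_Suc_shift sum_negf mult.assoc del: sum.lessThan_Suc upt_Suc pfaff.simps)
    also have "(\<Sum>j<length ?us. (- 1) ^ j * ?P 0 (?us ! j) * pfaff ?P (?u # drop_nth j ?us)) =
        - (\<Sum>j<length ?us. (- 1) ^ j * ?P 0 (?us ! j) * pfaff ?P (0 # drop_nth j ?us))"
      unfolding sum_negf[symmetric]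
      by (simp only: row[OF subset_trans[OF set_drop_nth set_us]] mult_minus_right)
    also have "(\<Sum>j<length ?us. (- 1) ^ j * ?P 0 (?us ! j) * pfaff ?P (0 # drop_nth j ?us)) = 0"
    proof -
      let ?D = "\<Sum>j<length ?us. (- 1) ^ j * ?P 0 (?us ! j) *
        (\<Sum>l<length ?us - 1. (- 1) ^ l * ?P 0 (drop_nth j ?us ! l) * pfaff ?P (drop_nth l (drop_nth j ?us)))"
      have "?D = - ?D" by (rule pfaff_double_expansion_swap)
      then have "?D = 0" by - (rule mps_double_eq_0, simp only: mult_2 eq_neg_iff_add_eq_0)
      then show ?thesis by (simp del: upt_Suc)
    qed
    also have "?P 0 ?u = 1"
      using assms by (simp add: pf_matrix_def pf_label_def pf_mat_def entry_val_def)
    also have "pfaff ?P ?us = Pf es"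
      using True ext[of ?us] by (simp add: Pf_eq_pfaff subset_iff del: upt_Suc pfaff.simps)
    finally show ?thesis by simp
  qed
qed

section \<open>Membership in \<open>Rinf\<close> and order bounds\<close>

lemma pfaff_Rinf:
  "(\<And>x y. x \<in> set xs \<Longrightarrow> y \<in> set xs \<Longrightarrow> M x y \<in> Rinf) \<Longrightarrow> pfaff M xs \<in> Rinf"
proof (induction M xs rule: pfaff.induct)
  case (2 M x ys)
  have "pfaff M (drop_nth j ys) \<in> Rinf" if "j < length ys" for j
    using that 2 set_drop_nth[of j ys] by (auto simp: subset_iff)
  then show ?case using 2 by (auto intro!: Rinf_closed)
qed (simp add: Rinf_closed)

lemma Pf_Rinf:
  assumes "\<And>c r k. (c, r) \<in> set es \<Longrightarrow> c k \<in> Rinf"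
  shows "Pf es \<in> Rinf"
proof -
  have pair: "pf_pair e e' \<in> Rinf" if "e \<in> set es" "e' \<in> set es" for e e'
  proof -
    obtain c r d q where e: "e = (c, r)" "e' = (d, q)" by (cases e; cases e')
    then have "c k \<in> Rinf" "d k \<in> Rinf" for k using that assms by blast+
    then show ?thesis by (auto simp: e pf_pair_def intro!: Rinf_closed)
  qed
  have val: "entry_val e \<in> Rinf" if "e \<in> set es" for e
    using that assms[of "fst e" "snd e"] by (simp add: entry_val_def)
  show ?thesis
    unfolding Pf_eq_pfaff_option
    by (rule pfaff_Rinf) (auto simp: pf_mat_def pair val Rinf_closed split: if_splits)
qed

text \<open>Every nonzero term of the full expansion uses each label exactly once, so the weights
  add up over the list.\<close>

lemma pfaff_ord_ge:
  "(\<And>x y. x \<in> set xs \<Longrightarrow> y \<in> set xs \<Longrightarrow> ord_ge (wt x + wt y) (M x y)) \<Longrightarrow> ord_ge (sum_list (map wt xs)) (pfaff M xs)"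
proof (induction M xs rule: pfaff.induct)
  case (2 M x ys)
  have "ord_ge (sum_list (map wt (x # ys))) (M x (ys ! j) * pfaff M (drop_nth j ys))" if "j < length ys" for j
  proof -
    have "ord_ge (sum_list (map wt (drop_nth j ys))) (pfaff M (drop_nth j ys))"
      using that 2 set_drop_nth[of j ys] by (auto simp: subset_iff)
    moreover have "ord_ge (wt x + wt (ys ! j)) (M x (ys ! j))" using that 2 by auto
    ultimately have "ord_ge (wt x + wt (ys ! j) + sum_list (map wt (drop_nth j ys))) (M x (ys ! j) * pfaff M (drop_nth j ys))"
      by (rule ord_ge_mult[rotated])
    moreover have "sum_list (map wt ys) = wt (ys ! j) + sum_list (map wt (drop_nth j ys))"
      using arg_cong[OF id_take_nth_drop[OF that], of "\<lambda>zs. sum_list (map wt zs)"] by (simp add: drop_nth_def)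
    ultimately show ?thesis by (simp add: add.assoc)
  qed
  note * = this
  show ?case
    unfolding pfaff.simps(2) mult.assoc by (rule ord_ge_sum, rule ord_ge_mult_left, rule *) simp
qed simp

lemma Pf_ord_ge:
  assumes "\<And>c r k. (c, r) \<in> set es \<Longrightarrow> ord_ge (nat k) (c k)" "\<And>c r. (c, r) \<in> set es \<Longrightarrow> r \<ge> 0"
  shows "ord_ge (\<Sum>(c, r)\<leftarrow>es. nat r) (Pf es)"
proof -
  let ?w = "\<lambda>x. case x of None \<Rightarrow> 0 | Some e \<Rightarrow> nat (snd e)"
  let ?xs = "(if even (length es) then [] else [None]) @ map Some es"
  have val: "ord_ge (nat (snd e)) (entry_val e)" if "e \<in> set es" for e
    using that assms(1)[of "fst e" "snd e"] by (simp add: entry_val_def)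
  have pair: "ord_ge (nat (snd e) + nat (snd e')) (pf_pair e e')" if "e \<in> set es" "e' \<in> set es" for e e'
  proof (cases e; cases e')
    fix c r d q assume e: "e = (c, r)" "e' = (d, q)"
    have r: "r \<ge> 0" "q \<ge> 0" using assms(2) that e by blast+
    have c: "ord_ge (nat k) (c k)" "ord_ge (nat k) (d k)" for k using assms(1) that e by blast+
    have "ord_ge (nat r + nat q) ((- 1) ^ s * c (r + int s) * d (q - int s))" if "s \<in> {1..nat q}" for s
    proof -
      have "nat r + nat q = nat (r + int s) + nat (q - int s)" using that r by auto
      then show ?thesis
        using ord_ge_mult[OF c(1)[of "r + int s"] c(2)[of "q - int s"]]
        by (simp add: mult.assoc ord_ge_mult_left)
    qed
    then show "ord_ge (nat (snd e) + nat (snd e')) (pf_pair e e')"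
      using ord_ge_mult[OF c(1)[of r] c(2)[of q]]
      by (auto simp: pf_pair_def e intro!: ord_ge_add ord_ge_mult_left[of _ _ 2] ord_ge_sum)
  qed
  have pair': "ord_ge (nat q + nat r) (pf_pair (d, q) (c, r))"
    if "(c, r) \<in> set es" "(d, q) \<in> set es" for c r d q
    using pair[OF that(2,1)] by simp
  have val': "ord_ge (nat r) (entry_val (c, r))" if "(c, r) \<in> set es" for c r
    using val[OF that] by simp
  have "ord_ge (sum_list (map ?w ?xs)) (pfaff pf_mat ?xs)"
    by (rule pfaff_ord_ge) (auto simp: pf_mat_def pair' val' split: if_splits)
  moreover have "sum_list (map ?w ?xs) = (\<Sum>(c, r)\<leftarrow>es. nat r)"
    by (simp add: o_def case_prod_unfold)
  ultimately show ?thesis by (simp only: Pf_eq_pfaff_option)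
qed

section \<open>Length in the hyperoctahedral group\<close>

lemma gen_s_eq:
  "gen_s i x = (if i = 0 then if x = 1 then - 1 else if x = - 1 then 1 else x
    else if x = int i then int i + 1 else if x = int i + 1 then int i
    else if x = - int i then - int i - 1 else if x = - int i - 1 then - int i else x)"
  by (auto simp: gen_s_def transpose_def)

lemma gen_s_gen_s [simp]: "gen_s i (gen_s i x) = x"
  by (auto simp: gen_s_eq)

lemma gen_s_comp_gen_s [simp]: "gen_s i \<circ> gen_s i = id"
  by (simp add: fun_eq_iff)

lemma comp_gen_s_gen_s [simp]: "w \<circ> gen_s i \<circ> gen_s i = w"
  by (simp add: fun_eq_iff)

lemma id_in_Winf: "id \<in> Winf"
  by (simp add: Winf_def permutes_id)

lemma gen_s_in_Winf: "gen_s i \<in> Winf"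
  unfolding Winf_def
proof (intro CollectI conjI allI)
  have "bij (gen_s i)" by (rule o_bij[of "gen_s i"]) auto
  then show "gen_s i permutes - {0}"
    unfolding permutes_def bij_iff by (auto simp: gen_s_eq)
  show "finite {x. gen_s i x \<noteq> x}"
    by (rule finite_subset[of _ "{- int i - 1..int i + 1}"]) (auto simp: gen_s_eq split: if_splits)
qed (auto simp: gen_s_eq)

lemma comp_in_Winf: "u \<in> Winf \<Longrightarrow> v \<in> Winf \<Longrightarrow> u \<circ> v \<in> Winf"
proof -
  assume uv: "u \<in> Winf" "v \<in> Winf"
  have "{i. (u \<circ> v) i \<noteq> i} \<subseteq> {i. u i \<noteq> i} \<union> {i. v i \<noteq> i}" by auto
  moreover have "finite ({i. u i \<noteq> i} \<union> {i. v i \<noteq> i})" using uv by (simp add: Winf_def)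
  ultimately have "finite {i. (u \<circ> v) i \<noteq> i}" by (rule finite_subset)
  then show ?thesis using uv by (auto simp: Winf_def intro: permutes_compose)
qed

lemma Winf_inj: "w \<in> Winf \<Longrightarrow> w x = w y \<longleftrightarrow> x = y"
  by (auto simp: Winf_def dest: permutes_inj injD)

lemma Winf_uminus: "w \<in> Winf \<Longrightarrow> w (- x) = - w x"
  by (auto simp: Winf_def)

lemma Winf_zero [simp]: "w \<in> Winf \<Longrightarrow> w 0 = 0"
  by (auto simp: Winf_def permutes_def)

definition wprod :: "nat list \<Rightarrow> int \<Rightarrow> int"
  where "wprod is = foldr (\<circ>) (map gen_s is) id"

lemma wprod_Nil [simp]: "wprod [] = id"
  by (simp add: wprod_def)

lemma wprod_Cons: "wprod (i # is) = gen_s i \<circ> wprod is"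
  by (simp add: wprod_def)

lemma wprod_append: "wprod (is @ js) = wprod is \<circ> wprod js"
  by (induction "is") (auto simp: wprod_Cons comp_assoc)

lemma wprod_snoc: "wprod (is @ [i]) = wprod is \<circ> gen_s i"
  by (simp add: wprod_append wprod_Cons)

lemma wprod_in_Winf: "wprod is \<in> Winf"
proof (induction "is")
  case (Cons i "is")
  then show ?case unfolding wprod_Cons by (rule comp_in_Winf[OF gen_s_in_Winf])
next
  case Nil
  show ?case unfolding wprod_Nil by (rule id_in_Winf)
qed

lemma wprod_rev: "wprod (rev is) \<circ> wprod is = id"
proof (induction "is")
  case (Cons i "is")
  have "wprod (rev (i # is)) \<circ> wprod (i # is) = wprod (rev is) \<circ> (gen_s i \<circ> gen_s i) \<circ> wprod is"
    unfolding rev.simps wprod_snoc wprod_Cons comp_assoc ..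
  then show ?case using Cons by simp
qed simp

section \<open>Inversions of signed permutations\<close>

definition inversions :: "(int \<Rightarrow> int) \<Rightarrow> (int \<times> int) set"
  where "inversions w = {(a, b). a \<noteq> 0 \<and> b \<noteq> 0 \<and> a < b \<and> w b < w a}"

definition negatives :: "(int \<Rightarrow> int) \<Rightarrow> int set"
  where "negatives w = {a. a > 0 \<and> w a < 0}"

text \<open>This is twice the length. Inversions on the nonzero integers are paired by sending (a,
  b) to (-b, -a); the self-paired ones are (-a, a) with \<open>w a < 0\<close>, and
  \<open>negatives\<close> counts these a second time. Keeping the doubled count avoids choosing
  representatives of the pairs.\<close>

definition inv_count :: "(int \<Rightarrow> int) \<Rightarrow> nat"
  where "inv_count w = card (inversions w) + card (negatives w)"

lemma inv_count_id [simp]: "inv_count id = 0"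
proof -
  have "inversions id = {}" "negatives id = {}" by (auto simp: inversions_def negatives_def)
  then show ?thesis by (simp add: inv_count_def)
qed

text \<open>Zero is skipped: for \<open>i = 0\<close> the neighbouring positions are -1 and 1, which
  gives descents the same form for all generators.\<close>

definition lo :: "nat \<Rightarrow> int"
  where "lo i = (if i = 0 then - 1 else int i)"

definition hi :: "nat \<Rightarrow> int"
  where "hi i = int i + 1"

lemma Winf_bound: "w \<in> Winf \<Longrightarrow> \<exists>M\<ge>0. \<forall>x. \<bar>x\<bar> > M \<longrightarrow> w x = x"
proof -
  assume "w \<in> Winf"
  then have fin: "finite {i. w i \<noteq> i}" by (simp add: Winf_def)
  let ?M = "Max (insert 0 (abs ` {i. w i \<noteq> i}))"
  have "w x = x" if "\<bar>x\<bar> > ?M" for x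
  proof (rule ccontr)
    assume "w x \<noteq> x"
    then have "\<bar>x\<bar> \<le> ?M" using fin by (intro Max_ge) auto
    with that show False by simp
  qed
  moreover have "?M \<ge> 0" using fin by (intro Max_ge) auto
  ultimately show ?thesis by blast
qed

lemma Winf_abs_le:
  assumes "w \<in> Winf" "\<forall>x. \<bar>x\<bar> > M \<longrightarrow> w x = x" "\<bar>x\<bar> \<le> M"
  shows "\<bar>w x\<bar> \<le> M"
proof (rule ccontr)
  assume "\<not> \<bar>w x\<bar> \<le> M"
  then have "w (w x) = w x" using assms(2) by simp
  then have "w x = x" using assms(1) by (simp add: Winf_inj)
  with \<open>\<not> \<bar>w x\<bar> \<le> M\<close> assms(3) show False by simp
qed

lemma inversions_bounded:
  assumes "w \<in> Winf" "\<forall>x. \<bar>x\<bar> > M \<longrightarrow> w x = x"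
  shows "inversions w \<subseteq> {(a, b). a \<in> {- M..M} - {0} \<and> b \<in> {- M..M} - {0} \<and> a < b}"
    and "negatives w \<subseteq> {1..M}"
proof -
  have le: "\<bar>w x\<bar> \<le> M" if "\<bar>x\<bar> \<le> M" for x using Winf_abs_le[OF assms that] .
  have out: "w x = x" if "\<bar>x\<bar> > M" for x using assms(2) that by blast
  have "\<bar>a\<bar> \<le> M \<and> \<bar>b\<bar> \<le> M" if "a < b" "w b < w a" for a b
  proof (rule ccontr)
    assume "\<not> ?thesis"
    then consider "\<bar>a\<bar> > M" "\<bar>b\<bar> > M" | "\<bar>a\<bar> > M" "\<bar>b\<bar> \<le> M" | "\<bar>a\<bar> \<le> M" "\<bar>b\<bar> > M" by linarith
    then show False
      using that le[of a] le[of b] out[of a] out[of b] by cases linarith+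
  qed
  then show "inversions w \<subseteq> {(a, b). a \<in> {- M..M} - {0} \<and> b \<in> {- M..M} - {0} \<and> a < b}"
    by (fastforce simp: inversions_def)
  have "a \<le> M" if "a > 0" "w a < 0" for a
    using that out[of a] by (cases "\<bar>a\<bar> > M") auto
  then show "negatives w \<subseteq> {1..M}" by (auto simp: negatives_def)
qed

lemma finite_inversions: "w \<in> Winf \<Longrightarrow> finite (inversions w)"
  and finite_negatives: "w \<in> Winf \<Longrightarrow> finite (negatives w)"
proof -
  assume w: "w \<in> Winf"
  then obtain M where M: "\<forall>x. \<bar>x\<bar> > M \<longrightarrow> w x = x" using Winf_bound by blast
  have "{(a, b). a \<in> {- M..M} - {0} \<and> b \<in> {- M..M} - {0} \<and> a < b} \<subseteq> {- M..M} \<times> {- M..M}" by auto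
  then show "finite (inversions w)"
    using inversions_bounded(1)[OF w M] by (meson finite_SigmaI finite_atLeastAtMost_int finite_subset subset_trans)
  show "finite (negatives w)"
    using inversions_bounded(2)[OF w M] by (meson finite_atLeastAtMost_int finite_subset)
qed

text \<open>Apart from the pairs in \<open>?E\<close>, the generator preserves the order of
  positions and carries inversions to inversions. At an ascent \<open>?E\<close> is new: two pairs
  for positive i, one pair and one negative for \<open>i = 0\<close>.\<close>

lemma inv_count_ascent:
  assumes w: "w \<in> Winf" and asc: "w (lo i) < w (hi i)"
  shows "inv_count (w \<circ> gen_s i) = inv_count w + 2"
proof -
  let ?s = "gen_s i"
  let ?E = "if i = 0 then {(- 1, 1)} else {(int i, int i + 1), (- int i - 1, - int i)}"
  let ?g = "\<lambda>(a, b). (?s a, ?s b)"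
  have mono: "?s a < ?s b" if "a < b" "a \<noteq> 0" "b \<noteq> 0" "(a, b) \<notin> ?E" for a b
    using that by (auto simp: gen_s_eq split: if_splits)
  have nz: "?s a \<noteq> 0" if "a \<noteq> 0" for a
    using that by (auto simp: gen_s_eq)
  have asc': "w (- int i - 1) < w (- int i)" if "i \<noteq> 0"
    using asc that Winf_uminus[OF w, of "int i + 1"] Winf_uminus[OF w, of "int i"] by (simp add: lo_def hi_def)
  have notE: "(a, b) \<notin> ?E" if "(a, b) \<in> inversions w" for a b
    using that asc asc' by (auto simp: inversions_def lo_def hi_def)
  have E: "?E \<subseteq> inversions (w \<circ> ?s)"
    using asc asc' by (auto simp: inversions_def lo_def hi_def gen_s_eq)
  have "inversions (w \<circ> ?s) = ?g ` inversions w \<union> ?E"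
  proof (rule subset_antisym; rule subrelI)
    fix a b assume ab: "(a, b) \<in> inversions (w \<circ> ?s)"
    show "(a, b) \<in> ?g ` inversions w \<union> ?E"
    proof (cases "(a, b) \<in> ?E")
      case False
      with ab have "(?s a, ?s b) \<in> inversions w"
        using mono[of a b] nz by (auto simp: inversions_def)
      then have "(a, b) \<in> ?g ` inversions w" by (rule rev_image_eqI) simp
      then show ?thesis by blast
    qed blast
  next
    fix a b assume ab: "(a, b) \<in> ?g ` inversions w \<union> ?E"
    show "(a, b) \<in> inversions (w \<circ> ?s)"
    proof (cases "(a, b) \<in> ?E")
      case True
      then show ?thesis using E by blast
    next
      case False
      then obtain a' b' where *: "a = ?s a'" "b = ?s b'" "(a', b') \<in> inversions w" using ab by auto
      then show ?thesis
        using notE[OF *(3)] mono[of a' b'] nz by (auto simp: inversions_def)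
    qed
  qed
  moreover have "?g ` inversions w \<inter> ?E = {}"
  proof -
    have swap: "?s y < ?s x" if "(x, y) \<in> ?E" for x y
      using that by (auto simp: gen_s_eq split: if_splits)
    show ?thesis
    proof (rule equals0I)
      fix p assume p: "p \<in> ?g ` inversions w \<inter> ?E"
      then obtain a b where ab: "p = (?s a, ?s b)" "(a, b) \<in> inversions w" by auto
      have "(?s a, ?s b) \<in> ?E" using p unfolding ab(1) by (rule IntD2)
      from swap[OF this] ab(2) show False by (simp add: inversions_def)
    qed
  qed
  moreover have "card (?g ` inversions w) = card (inversions w)"
    by (rule card_image) (rule inj_onI, auto, (metis gen_s_gen_s)+)
  ultimately have inv: "card (inversions (w \<circ> ?s)) = card (inversions w) + (if i = 0 then 1 else 2)"
    using finite_inversions[OF w] by (simp add: card_Un_disjoint)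
  have "card (negatives (w \<circ> ?s)) = card (negatives w) + (if i = 0 then 1 else 0)"
  proof (cases "i = 0")
    case True
    have "w 1 > 0" using asc True Winf_uminus[OF w, of 1] by (simp add: lo_def hi_def)
    then have "negatives (w \<circ> ?s) = insert 1 (negatives w)" "1 \<notin> negatives w"
      using True Winf_uminus[OF w, of 1] by (auto simp: negatives_def gen_s_eq split: if_splits)
    then show ?thesis using True finite_negatives[OF w] by simp
  next
    case False
    have pos: "?s a > 0 \<longleftrightarrow> a > 0" for a using False by (auto simp: gen_s_eq)
    have "negatives (w \<circ> ?s) = ?s ` negatives w"
    proof (intro set_eqI iffI)
      fix a assume "a \<in> negatives (w \<circ> ?s)"
      then have "?s a \<in> negatives w" by (simp add: negatives_def pos)
      then show "a \<in> ?s ` negatives w" by (rule rev_image_eqI) simp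
    qed (auto simp: negatives_def pos)
    then show ?thesis using False by (simp add: card_image inj_on_def) (metis card_image gen_s_gen_s inj_onI)
  qed
  with inv show ?thesis by (simp add: inv_count_def)
qed

lemma lo_less_hi: "lo i < hi i" and gen_s_lo [simp]: "gen_s i (lo i) = hi i" and gen_s_hi [simp]: "gen_s i (hi i) = lo i"
  by (auto simp: lo_def hi_def gen_s_eq)

lemma lo_hi_cases: "w \<in> Winf \<Longrightarrow> w (lo i) < w (hi i) \<or> w (hi i) < w (lo i)"
  using Winf_inj[of w "lo i" "hi i"] lo_less_hi[of i] by (cases "w (lo i)" "w (hi i)" rule: linorder_cases) auto

lemma inv_count_descent:
  assumes w: "w \<in> Winf" and desc: "w (hi i) < w (lo i)"
  shows "inv_count w = inv_count (w \<circ> gen_s i) + 2"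
  using inv_count_ascent[of "w \<circ> gen_s i" i] desc comp_in_Winf[OF w gen_s_in_Winf] by simp

lemma inv_count_wprod_le: "inv_count (wprod is) \<le> 2 * length is"
proof (induction "is" rule: rev_induct)
  case Nil
  show ?case unfolding wprod_Nil inv_count_id by simp
next
  case (snoc i "is")
  then have "inv_count (wprod is) \<le> 2 * length is" by simp
  then have "inv_count (wprod is \<circ> gen_s i) \<le> 2 * length (is @ [i])"
    using inv_count_ascent[OF wprod_in_Winf, of "is" i] inv_count_descent[OF wprod_in_Winf, of "is" i]
      lo_hi_cases[OF wprod_in_Winf, of "is" i] by auto
  then show ?case unfolding wprod_snoc .
qed

text \<open>Without descents w is positive and strictly increasing on the positive integers, so it
  never falls below the identity; agreement with the identity far out forces equality.\<close>

lemma no_descents_imp_id: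
  assumes w: "w \<in> Winf" and asc: "\<And>i. w (lo i) < w (hi i)"
  shows "w = id"
proof -
  have w1: "w 1 > 0" using asc[of 0] Winf_uminus[OF w, of 1] by (simp add: lo_def hi_def)
  have step: "w (int i) < w (int i + 1)" if "i \<ge> 1" for i
    using asc[of i] that by (simp add: lo_def hi_def)
  obtain M where M: "M \<ge> 0" "\<forall>x. \<bar>x\<bar> > M \<longrightarrow> w x = x" using Winf_bound[OF w] by blast
  have grow: "w (int m + int d) \<ge> w (int m) + int d" if "m \<ge> 1" for m d
  proof (induction d)
    case (Suc d)
    then show ?case using step[of "m + d"] that by (simp add: algebra_simps)
  qed simp
  have pos: "w (int m) = int m" if "m \<ge> 1" for m
  proof -
    have "w (int m) \<ge> int m"
      using grow[of 1 "m - 1"] w1 that by (simp add: of_nat_diff)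
    moreover have "w (int m + int (nat (M + 1))) = int m + int (nat (M + 1))"
      using M that by simp
    then have "w (int m) \<le> int m" using grow[OF that, of "nat (M + 1)"] by linarith
    ultimately show ?thesis by simp
  qed
  have "w x = x" for x
  proof (cases x rule: int_cases3)
    case (pos n)
    then show ?thesis using \<open>\<And>m. m \<ge> 1 \<Longrightarrow> w (int m) = int m\<close>[of n] by simp
  next
    case (neg n)
    then show ?thesis using \<open>\<And>m. m \<ge> 1 \<Longrightarrow> w (int m) = int m\<close>[of n] Winf_uminus[OF w, of "int n"] by simp
  qed (simp add: w)
  then show ?thesis by (simp add: fun_eq_iff)
qed

lemma ex_reduced_word_inv_count:
  "w \<in> Winf \<Longrightarrow> \<exists>is. w = wprod is \<and> 2 * length is = inv_count w"
proof (induction "inv_count w" arbitrary: w rule: less_induct)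
  case less
  show ?case
  proof (cases "\<forall>i. w (lo i) < w (hi i)")
    case True
    then have "w = id" using no_descents_imp_id less.prems by blast
    then show ?thesis by (intro exI[of _ "[]"]) simp
  next
    case False
    then obtain i where i: "w (hi i) < w (lo i)" using lo_hi_cases[OF less.prems] by blast
    note d = inv_count_descent[OF less.prems i]
    then obtain "is" where "w \<circ> gen_s i = wprod is" "2 * length is = inv_count (w \<circ> gen_s i)"
      using less.hyps[of "w \<circ> gen_s i"] comp_in_Winf[OF less.prems gen_s_in_Winf] by auto
    then have "w = wprod (is @ [i])" "2 * length (is @ [i]) = inv_count w"
      using d by (auto simp: wprod_snoc) (metis comp_gen_s_gen_s)
    then show ?thesis by blast
  qed
qed

lemma len_eq_Least: "len w = (LEAST l. \<exists>is. length is = l \<and> w = wprod is)"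
  by (simp add: len_def wprod_def)

text \<open>Undoing descents one by one yields a word of half that length, and no word can be
  shorter because a letter raises the count by at most 2.\<close>

lemma inv_count_eq: "w \<in> Winf \<Longrightarrow> inv_count w = 2 * len w"
proof -
  assume "w \<in> Winf"
  then obtain js where js: "w = wprod js" "2 * length js = inv_count w"
    using ex_reduced_word_inv_count by blast
  have "len w = length js"
    unfolding len_eq_Least
  proof (rule Least_equality)
    show "\<exists>ks. length ks = length js \<and> w = wprod ks" using js by blast
    fix l assume "\<exists>ks. length ks = l \<and> w = wprod ks"
    then obtain ks where "length ks = l" "w = wprod ks" by blast
    then show "length js \<le> l" using inv_count_wprod_le[of ks] js by simp
  qed
  then show ?thesis using js by simp
qed

lemma ex_reduced_word: "w \<in> Winf \<Longrightarrow> \<exists>is. w = wprod is \<and> length is = len w"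
  using ex_reduced_word_inv_count[of w] inv_count_eq[of w] by auto

lemma len_wprod_le: "len (wprod is) \<le> length is"
  using inv_count_wprod_le[of "is"] inv_count_eq[OF wprod_in_Winf, of "is"] by simp

lemma len_ascent: "w \<in> Winf \<Longrightarrow> w (lo i) < w (hi i) \<Longrightarrow> len (w \<circ> gen_s i) = len w + 1"
  using inv_count_ascent[of w i] by (simp add: inv_count_eq comp_in_Winf gen_s_in_Winf)

lemma len_descent: "w \<in> Winf \<Longrightarrow> w (hi i) < w (lo i) \<Longrightarrow> len w = len (w \<circ> gen_s i) + 1"
  using inv_count_descent[of w i] by (simp add: inv_count_eq comp_in_Winf gen_s_in_Winf)

lemma len_id [simp]: "len id = 0"
  using len_wprod_le[of "[]"] by simp

lemma len_comp_gen_s: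
  assumes "w \<in> Winf"
  shows "len (w \<circ> gen_s i) = len w + 1 \<or> len w = len (w \<circ> gen_s i) + 1"
  using len_ascent[OF assms, of i] len_descent[OF assms, of i] lo_hi_cases[OF assms, of i] by blast

lemma ascent_iff: "w \<in> Winf \<Longrightarrow> len w < len (w \<circ> gen_s i) \<longleftrightarrow> w (lo i) < w (hi i)"
  using len_ascent[of w i] len_descent[of w i] lo_hi_cases[of w i] by fastforce

lemma len_comp_le: "u \<in> Winf \<Longrightarrow> v \<in> Winf \<Longrightarrow> len (u \<circ> v) \<le> len u + len v"
proof -
  assume "u \<in> Winf" "v \<in> Winf"
  then obtain a b where "u = wprod a" "length a = len u" "v = wprod b" "length b = len v"
    using ex_reduced_word by metis
  then show ?thesis using len_wprod_le[of "a @ b"] by (simp add: wprod_append)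
qed

lemma len_inverse_le:
  assumes "u \<in> Winf" "u \<circ> v = id"
  shows "len v \<le> len u"
proof -
  obtain a where a: "u = wprod a" "length a = len u" using ex_reduced_word assms by metis
  have "v = (wprod (rev a) \<circ> wprod a) \<circ> v" by (simp add: wprod_rev)
  also have "\<dots> = wprod (rev a)" using assms(2) a by (simp add: comp_assoc)
  finally show ?thesis using len_wprod_le[of "rev a"] a by simp
qed

section \<open>The longest element and coset representatives\<close>

definition w0 :: "nat \<Rightarrow> int \<Rightarrow> int"
  where "w0 n x = (if \<bar>x\<bar> \<le> int n then - x else x)"

lemma Wn_imp_Winf: "w \<in> Wn n \<Longrightarrow> w \<in> Winf"
  by (simp add: Wn_def)

lemma Wn_fixes:
  assumes "w \<in> Wn n"
  shows "\<forall>x. \<bar>x\<bar> > int n \<longrightarrow> w x = x"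
proof (intro allI impI)
  fix x assume "\<bar>x\<bar> > int n"
  then show "w x = x"
    using assms Winf_uminus[of w "- x"] by (cases "x \<ge> 0") (auto simp: Wn_def)
qed

lemma comp_in_Wn: "u \<in> Wn n \<Longrightarrow> v \<in> Wn n \<Longrightarrow> u \<circ> v \<in> Wn n"
  by (auto simp: Wn_def comp_in_Winf)

lemma wprod_in_Wn: "set is \<subseteq> {..<n} \<Longrightarrow> wprod is \<in> Wn n"
proof (induction "is")
  case (Cons i "is")
  then have "gen_s i \<in> Wn n" by (auto simp: Wn_def gen_s_in_Winf gen_s_eq)
  moreover have "wprod is \<in> Wn n" using Cons by simp
  ultimately show ?case unfolding wprod_Cons by (rule comp_in_Wn)
next
  case Nil
  have "id \<in> Wn n" by (simp add: Wn_def id_in_Winf)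
  then show ?case unfolding wprod_Nil .
qed

text \<open>There are n (2 n - 1) pairs of nonzero positions and n possible negatives, together
  twice the square of n. If all occur, w is strictly decreasing on the nonzero positions, which
  leaves only \<open>w0 n\<close>.\<close>

lemma len_Wn_le:
  assumes w: "w \<in> Wn n"
  shows "len w \<le> n\<^sup>2" and "len w = n\<^sup>2 \<Longrightarrow> w = w0 n"
proof -
  let ?S = "{- int n..int n} - {0}"
  let ?P = "{(a, b). a \<in> ?S \<and> b \<in> ?S \<and> a < b}"
  have W: "w \<in> Winf" using w by (rule Wn_imp_Winf)
  note sub = inversions_bounded[OF W Wn_fixes[OF w]]
  have finP: "finite ?P" by (rule finite_subset[of _ "?S \<times> ?S"]) auto
  have cardP: "card ?P + n = 2 * n\<^sup>2"
  proof -
    have "?S \<times> ?S = ?P \<union> (prod.swap ` ?P \<union> (\<lambda>a. (a, a)) ` ?S)"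
      by (auto simp: image_iff)
    moreover have "?P \<inter> (prod.swap ` ?P \<union> (\<lambda>a. (a, a)) ` ?S) = {}" "prod.swap ` ?P \<inter> (\<lambda>a. (a, a)) ` ?S = {}"
      by auto
    ultimately have "card (?S \<times> ?S) = card ?P + (card (prod.swap ` ?P) + card ((\<lambda>a. (a, a)) ` ?S))"
      using finP by (simp add: card_Un_disjoint)
    moreover have "card (prod.swap ` ?P) = card ?P" by (rule card_image) simp
    moreover have "card ((\<lambda>a. (a, a)) ` ?S) = card ?S" by (rule card_image) (simp add: inj_on_def)
    moreover have "card ?S = 2 * n" by simp
    ultimately show ?thesis by (simp add: card_cartesian_product power2_eq_square)
  qed
  have le: "card (inversions w) \<le> card ?P" "card (negatives w) \<le> n"
    using card_mono[OF finP sub(1)] card_mono[OF _ sub(2)] by auto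
  then show "len w \<le> n\<^sup>2"
    using inv_count_eq[OF W] cardP by (simp add: inv_count_def)
  assume "len w = n\<^sup>2"
  then have "card (inversions w) = card ?P" "card (negatives w) = n"
    using inv_count_eq[OF W] cardP le by (auto simp: inv_count_def)
  then have eq: "inversions w = ?P" "negatives w = {1..int n}"
    using card_subset_eq[OF finP sub(1)] card_subset_eq[OF _ sub(2)] by auto
  have dec: "w b < w a" if "a \<in> ?S" "b \<in> ?S" "a < b" for a b
  proof -
    have "(a, b) \<in> inversions w" unfolding eq using that by simp
    then show ?thesis by (simp add: inversions_def)
  qed
  \<comment> \<open>Strict decrease starting from \<open>w 1 \<le> -1\<close> bounds the values from
    above; going back from \<open>w n \<ge> - n\<close> bounds them from below.\<close>
  have neg: "w (int a) \<le> - int a" if "1 \<le> a" "a \<le> n" for a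
    using that
  proof (induction a)
    case (Suc a)
    show ?case
    proof (cases "a = 0")
      case True
      have "int 1 \<in> negatives w" unfolding eq using Suc by simp
      then show ?thesis using True by (simp add: negatives_def)
    next
      case False
      then show ?thesis using Suc dec[of "int a" "int (Suc a)"] by simp
    qed
  qed simp
  have neg': "w (int (n - d)) \<ge> - int (n - d)" if "d < n" for d
    using that
  proof (induction d)
    case 0
    then show ?case using Winf_abs_le[OF W Wn_fixes[OF w], of "int n"] by simp
  next
    case (Suc d)
    have "w (int (n - d)) < w (int (n - Suc d))" using Suc by (intro dec) auto
    then show ?case using Suc by (simp add: of_nat_diff)
  qed
  have pos: "w (int a) = - int a" if "1 \<le> a" "a \<le> n" for a
    using neg[OF that] neg'[of "n - a"] that by simp
  have "w x = w0 n x" for x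
  proof (cases "\<bar>x\<bar> \<le> int n \<and> x \<noteq> 0")
    case True
    then consider "1 \<le> nat x" "nat x \<le> n" "int (nat x) = x" | "1 \<le> nat (- x)" "nat (- x) \<le> n" "int (nat (- x)) = - x"
      by linarith
    then have "w x = - x"
      using pos[of "nat x"] pos[of "nat (- x)"] Winf_uminus[OF W, of x] by cases simp_all
    then show ?thesis using True by (simp add: w0_def)
  next
    case False
    then show ?thesis using Wn_fixes[OF w] W by (cases "x = 0") (auto simp: w0_def)
  qed
  then show "w = w0 n" by (simp add: fun_eq_iff)
qed

lemma w0_comp_gen_s: "i < n \<Longrightarrow> w0 n \<circ> gen_s i = gen_s i \<circ> w0 n"
  by (auto simp: fun_eq_iff w0_def gen_s_eq)

lemma w0_comp_w0: "w0 n \<circ> w0 n = id"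
  by (auto simp: fun_eq_iff w0_def)

text \<open>Each k in J puts walls between k and k + 1 and between -k - 1 and -k; the ascents at
  indices outside J chain together between consecutive walls.\<close>

lemma WJ_increasing:
  assumes w: "w \<in> WJ J" and "a \<noteq> 0" "b \<noteq> 0" "a < b"
    and "\<And>k. k \<in> J \<Longrightarrow> (a > int k \<longleftrightarrow> b > int k) \<and> (a < - int k \<longleftrightarrow> b < - int k)"
  shows "w a < w b"
proof -
  have W: "w \<in> Winf" using w by (simp add: WJ_def)
  have asc: "w (lo i) < w (hi i)" if "i \<notin> J" for i
    using w that ascent_iff[OF W] by (auto simp: WJ_def)
  have step: "w x < w y"
    if side: "\<And>k. k \<in> J \<Longrightarrow> (x > int k \<longleftrightarrow> y > int k) \<and> (x < - int k \<longleftrightarrow> y < - int k)"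
      and xy: "x \<noteq> 0" "y \<noteq> 0" "y = x + 1 \<or> x = - 1 \<and> y = 1" for x y
  proof -
    consider "x \<ge> 1" "y = x + 1" | "x = - 1" "y = 1" | "x \<le> - 2" "y = x + 1" using xy by linarith
    then show ?thesis
    proof cases
      case 1
      then have "nat x \<notin> J" using side[of "nat x"] by auto
      from asc[OF this] show ?thesis using 1 by (simp add: lo_def hi_def)
    next
      case 2
      then have "0 \<notin> J" using side[of 0] by auto
      from asc[OF this] show ?thesis using 2 by (simp add: lo_def hi_def)
    next
      case 3
      then have "nat (- y) \<notin> J" using side[of "nat (- y)"] by auto
      from asc[OF this] have "w (- y) < w (- x)" using 3 by (simp add: lo_def hi_def)
      then show ?thesis by (simp add: Winf_uminus[OF W])
    qed
  qed
  show ?thesis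
    using assms(2-)
  proof (induction "nat (b - a)" arbitrary: b rule: less_induct)
    case less
    \<comment> \<open>The position just before b, with 0 skipped.\<close>
    define c where "c = (if b = 1 then - 1 else b - 1)"
    have c: "c \<noteq> 0" "c < b" "a \<le> c" "b = c + 1 \<or> c = - 1 \<and> b = 1" using less.prems by (auto simp: c_def)
    have side: "(a > int k \<longleftrightarrow> c > int k) \<and> (a < - int k \<longleftrightarrow> c < - int k) \<and>
        (c > int k \<longleftrightarrow> b > int k) \<and> (c < - int k \<longleftrightarrow> b < - int k)" if "k \<in> J" for k
      using less.prems(4)[OF that] c by auto
    have cb: "w c < w b"
      by (rule step) (use side in blast, use c less.prems(2) in auto)
    show ?case
    proof (cases "a = c")
      case False
      have "w a < w c"
      proof (rule less.hyps)
        show "nat (c - a) < nat (b - a)" "a < c" using False c by auto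
        show "(a > int k \<longleftrightarrow> c > int k) \<and> (a < - int k \<longleftrightarrow> c < - int k)" if "k \<in> J" for k
          using side[OF that] by blast
      qed (use c less.prems in auto)
      with cb show ?thesis by simp
    qed (use cb in simp)
  qed
qed

text \<open>A generator with index different from k exchanges no two positions on different sides of
  the walls belonging to k.\<close>

lemma wprod_side:
  assumes "set is \<inter> J = {}" "k \<in> J"
  shows "(wprod is x > int k \<longleftrightarrow> x > int k) \<and> (wprod is x < - int k \<longleftrightarrow> x < - int k)"
  using assms(1)
proof (induction "is")
  case (Cons i "is")
  have "(gen_s i y > int k \<longleftrightarrow> y > int k) \<and> (gen_s i y < - int k \<longleftrightarrow> y < - int k)" for y
  proof -
    have "i \<noteq> k" using Cons.prems assms(2) by auto
    then show ?thesis by (auto simp: gen_s_eq)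
  qed
  with Cons show ?case by (simp add: wprod_Cons)
qed simp

text \<open>Each letter of the reduced word is an ascent of the preceding product. The two values
  compared lie between the same walls, where w is increasing, so the ascent persists after composing
  with w.\<close>

lemma len_WJ_comp:
  assumes w: "w \<in> WJ J" and "set is \<inter> J = {}" "len (wprod is) = length is"
  shows "len (w \<circ> wprod is) = len w + length is"
  using assms(2-)
proof (induction "is" rule: rev_induct)
  case (snoc i "is")
  let ?x = "wprod is"
  have W: "w \<in> Winf" using w by (simp add: WJ_def)
  have x: "?x \<in> Winf" by (rule wprod_in_Winf)
  have "len (?x \<circ> gen_s i) = length is + 1"
  proof -
    have "len (wprod (is @ [i])) = length (is @ [i])" by (rule snoc.prems(2))
    then show ?thesis unfolding wprod_snoc by simp
  qed
  then have red: "len ?x = length is" "len ?x < len (?x \<circ> gen_s i)"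
    using len_wprod_le[of "is"] len_comp_gen_s[OF x, of i] by linarith+
  have i: "i \<notin> J" using snoc.prems(1) by auto
  have "w (?x (lo i)) < w (?x (hi i))"
  proof (rule WJ_increasing[OF w])
    show "?x (lo i) < ?x (hi i)" using red ascent_iff[OF x] by blast
    show "?x (lo i) \<noteq> 0" "?x (hi i) \<noteq> 0"
      using Winf_inj[OF x, of _ 0] x by (auto simp: lo_def hi_def)
    fix k assume k: "k \<in> J"
    with i have "k \<noteq> i" by auto
    then have "(lo i > int k \<longleftrightarrow> hi i > int k) \<and> (lo i < - int k \<longleftrightarrow> hi i < - int k)"
      by (auto simp: lo_def hi_def)
    then show "(?x (lo i) > int k \<longleftrightarrow> ?x (hi i) > int k) \<and> (?x (lo i) < - int k \<longleftrightarrow> ?x (hi i) < - int k)"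
      using wprod_side[of "is" J k] snoc.prems k by auto
  qed
  then have "len ((w \<circ> ?x) \<circ> gen_s i) = len (w \<circ> ?x) + 1"
    using comp_in_Winf[OF W x] by (intro len_ascent) auto
  moreover have "len (w \<circ> ?x) = len w + length is"
  proof (rule snoc.IH)
    show "set is \<inter> J = {}" using snoc.prems(1) by auto
  qed (rule red(1))
  ultimately have "len (w \<circ> wprod (is @ [i])) = len w + length (is @ [i])"
    unfolding wprod_snoc comp_assoc by simp
  then show ?case .
next
  case Nil
  show ?case unfolding wprod_Nil by simp
qed

section \<open>Iterated divided differences\<close>

text \<open>Letters act from left to right, so that on Schubert polynomials the index is multiplied
  on the right by \<open>wprod is\<close>.\<close>

definition ddz_word :: "nat list \<Rightarrow> ring_elt \<Rightarrow> ring_elt"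
  where "ddz_word is f = foldl (\<lambda>f i. ddz i f) f is"

definition ddt_word :: "nat list \<Rightarrow> ring_elt \<Rightarrow> ring_elt"
  where "ddt_word is f = foldl (\<lambda>f i. ddt i f) f is"

lemma ddz_word_Nil [simp]: "ddz_word [] f = f"
  and ddz_word_Cons: "ddz_word (i # is) f = ddz_word is (ddz i f)"
  and ddz_word_append: "ddz_word (is @ js) f = ddz_word js (ddz_word is f)"
  by (simp_all add: ddz_word_def)

lemma ddz_word_snoc: "ddz_word (is @ [i]) f = ddz i (ddz_word is f)"
  by (simp add: ddz_word_def)

lemma ddt_word_Nil [simp]: "ddt_word [] f = f"
  and ddt_word_Cons: "ddt_word (i # is) f = ddt_word is (ddt i f)"
  by (simp_all add: ddt_word_def)

lemma ddz_word_zero [simp]: "ddz_word is 0 = 0"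
  by (induction "is") (auto simp: ddz_word_Cons)

lemma ddt_word_zero [simp]: "ddt_word is 0 = 0"
  by (induction "is") (auto simp: ddt_word_Cons)

lemma ddz_word_diff:
  "f \<in> Rinf \<Longrightarrow> g \<in> Rinf \<Longrightarrow> ddz_word is (f - g) = ddz_word is f - ddz_word is g"
  by (induction "is" arbitrary: f g) (auto simp: ddz_word_Cons ddz_diff ddz_Rinf)

lemma ddz_word_sum:
  "(\<And>x. x \<in> A \<Longrightarrow> h x \<in> Rinf) \<Longrightarrow> ddz_word is (sum h A) = (\<Sum>x\<in>A. ddz_word is (h x))"
  by (induction "is" arbitrary: h) (auto simp: ddz_word_Cons ddz_sum ddz_Rinf)

lemma ddz_word_Zt_mult:
  "a \<in> Zt \<Longrightarrow> f \<in> Rinf \<Longrightarrow> ddz_word is (a * f) = a * ddz_word is f"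
  by (induction "is" arbitrary: f) (auto simp: ddz_word_Cons ddz_Zt_mult ddz_Rinf)

lemma ord_ge_ddz_word: "f \<in> Rinf \<Longrightarrow> ord_ge (d + length is) f \<Longrightarrow> ord_ge d (ddz_word is f)"
  by (induction "is" arbitrary: f) (auto simp: ddz_word_Cons ddz_Rinf ord_ge_ddz)

lemma ddz_ddt_word_commute: "f \<in> Rinf \<Longrightarrow> ddz i (ddt_word js f) = ddt_word js (ddz i f)"
  by (induction js arbitrary: f) (auto simp: ddt_word_Cons ddt_Rinf ddz_ddt_commute)

text \<open>The last \<open>ddz i\<close> commutes past the \<open>ddt\<close> operators until it
  meets f, where it may be replaced by \<open>ddt i\<close>; therefore the word is reversed.\<close>

lemma ddz_word_eq_ddt_word:
  assumes "f \<in> Rinf" "\<And>i. ddz i f = ddt i f"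
  shows "ddz_word is f = ddt_word (rev is) f"
proof (induction "is" rule: rev_induct)
  case (snoc i "is")
  have "ddz_word (is @ [i]) f = ddz i (ddz_word is f)" by (simp add: ddz_word_snoc)
  also have "\<dots> = ddt_word (rev is) (ddz i f)" using snoc assms(1) by (simp add: ddz_ddt_word_commute)
  also have "\<dots> = ddt_word (rev (is @ [i])) f" by (simp add: ddt_word_Cons assms(2))
  finally show ?case .
qed simp

text \<open>Letters applied before j can be rewritten as \<open>ddt\<close> operators, which commute
  with \<open>ddz j\<close>. This disposes of reduced words that leave
  \<open>{..<n}\<close>.\<close>

lemma ddz_word_eq_0:
  assumes f: "f \<in> Rinf" "\<And>i. ddz i f = ddt i f" and j: "ddz j f = 0" "j \<in> set is"
  shows "ddz_word is f = 0"
proof -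
  obtain a b where "is": "is = a @ j # b" using split_list[OF j(2)] by blast
  have "ddz j (ddz_word a f) = ddt_word (rev a) (ddz j f)"
    using f(1) unfolding ddz_word_eq_ddt_word[OF f] by (rule ddz_ddt_word_commute)
  then show ?thesis by (simp add: "is" ddz_word_append ddz_word_Cons j(1))
qed

section \<open>Recognising the Schubert polynomial of the longest element\<close>

lemma len_le_len_comp_wprod: "w \<in> Winf \<Longrightarrow> len w \<le> len (w \<circ> wprod is) + length is"
proof (induction "is" rule: rev_induct)
  case (snoc i "is")
  have "len w \<le> len (w \<circ> wprod is) + length is" by (rule snoc.IH[OF snoc.prems])
  also have "len (w \<circ> wprod is) \<le> len ((w \<circ> wprod is) \<circ> gen_s i) + 1"
    using len_comp_gen_s[OF comp_in_Winf[OF snoc.prems wprod_in_Winf], of "is" i] by linarith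
  finally have "len w \<le> len (w \<circ> wprod (is @ [i])) + length (is @ [i])"
    unfolding wprod_snoc comp_assoc by simp
  then show ?case .
next
  case Nil
  show ?case unfolding wprod_Nil by simp
qed

lemma comp_wprod_cancel:
  assumes "u \<circ> wprod is = v \<circ> wprod is"
  shows "u = v"
proof -
  have r: "wprod is \<circ> wprod (rev is) = id" using wprod_rev[of "rev is"] by simp
  have "u \<circ> (wprod is \<circ> wprod (rev is)) = v \<circ> (wprod is \<circ> wprod (rev is))"
    unfolding comp_assoc[symmetric] assms ..
  then show ?thesis unfolding r by simp
qed

section \<open>Expansion in the Schubert basis\<close>

locale schubert =
  fixes C :: "(int \<Rightarrow> int) \<Rightarrow> ring_elt"
  assumes C: "double_Schubert C"
begin

lemma C_Rinf: "w \<in> Winf \<Longrightarrow> C w \<in> Rinf"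
  using C by (auto simp: double_Schubert_def is_Zt_basis_def)

lemma ddz_C: "w \<in> Winf \<Longrightarrow> ddz i (C w) = (if len (w \<circ> gen_s i) < len w then C (w \<circ> gen_s i) else 0)"
  using C by (simp add: double_Schubert_def)

lemma ddt_C: "w \<in> Winf \<Longrightarrow> ddt i (C w) = (if len (gen_s i \<circ> w) < len w then C (gen_s i \<circ> w) else 0)"
  using C by (simp add: double_Schubert_def)

lemma C_id: "C id = 1"
  using C by (simp add: double_Schubert_def)

lemma C_const: "w \<in> Winf \<Longrightarrow> mcoeff (C w) 0 = (if w = id then 1 else 0)"
  using C by (auto simp: double_Schubert_def mcoeff_one)

lemma Zt_mult_C_Rinf: "a \<in> Zt \<Longrightarrow> w \<in> Winf \<Longrightarrow> a * C w \<in> Rinf"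
  by (simp add: Rinf_closed Zt_in_Rinf C_Rinf)

definition expands :: "ring_elt \<Rightarrow> ((int \<Rightarrow> int) \<Rightarrow> ring_elt) \<Rightarrow> bool"
  where "expands f a \<longleftrightarrow> range a \<subseteq> Zt \<and> {w. a w \<noteq> 0} \<subseteq> Winf \<and> finite {w. a w \<noteq> 0} \<and>
    f = (\<Sum>w | a w \<noteq> 0. a w * C w)"

definition coef :: "ring_elt \<Rightarrow> (int \<Rightarrow> int) \<Rightarrow> ring_elt"
  where "coef f = (THE a. expands f a)"

lemma expands_ex1: "f \<in> Rinf \<Longrightarrow> \<exists>!a. expands f a"
  using C unfolding expands_def double_Schubert_def is_Zt_basis_def by blast

lemma expands_coef: "f \<in> Rinf \<Longrightarrow> expands f (coef f)"
  unfolding coef_def by (rule theI'[OF expands_ex1])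

lemma coef_eqI: "f \<in> Rinf \<Longrightarrow> expands f a \<Longrightarrow> coef f = a"
  using expands_ex1 expands_coef by blast

lemma coef_Zt: "f \<in> Rinf \<Longrightarrow> coef f w \<in> Zt"
  and finite_coef: "f \<in> Rinf \<Longrightarrow> finite {w. coef f w \<noteq> 0}"
  and coef_Winf: "f \<in> Rinf \<Longrightarrow> coef f w \<noteq> 0 \<Longrightarrow> w \<in> Winf"
  and coef_expand: "f \<in> Rinf \<Longrightarrow> f = (\<Sum>w | coef f w \<noteq> 0. coef f w * C w)"
  using expands_coef[of f] unfolding expands_def by blast+

lemma coef_expand_superset:
  assumes "f \<in> Rinf" "finite S" "{w. coef f w \<noteq> 0} \<subseteq> S"
  shows "f = (\<Sum>w\<in>S. coef f w * C w)"
  by (subst coef_expand[OF assms(1)], rule sum.mono_neutral_left) (use assms in auto)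

lemma coef_lincomb:
  assumes "finite S" "S \<subseteq> Winf" "\<And>w. w \<in> S \<Longrightarrow> a w \<in> Zt"
  shows "coef (\<Sum>w\<in>S. a w * C w) = (\<lambda>w. if w \<in> S then a w else 0)"
proof (rule coef_eqI)
  show "(\<Sum>w\<in>S. a w * C w) \<in> Rinf"
    by (rule Rinf_closed(7), rule Zt_mult_C_Rinf) (use assms in auto)
  let ?a = "\<lambda>w. if w \<in> S then a w else 0"
  have "(\<Sum>w\<in>S. a w * C w) = (\<Sum>w | ?a w \<noteq> 0. ?a w * C w)"
    by (rule sum.mono_neutral_cong_right) (use assms(1) in auto)
  then show "expands (\<Sum>w\<in>S. a w * C w) ?a"
    using assms by (auto simp: expands_def Zt_closed)
qed

lemma coef_mult_C: "a \<in> Zt \<Longrightarrow> w \<in> Winf \<Longrightarrow> coef (a * C w) v = (if v = w then a else 0)"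
  using coef_lincomb[of "{w}" "\<lambda>_. a"] by simp

lemma coef_zero [simp]: "coef 0 v = 0"
  using coef_lincomb[of "{}"] by simp

lemma coef_add:
  assumes "f \<in> Rinf" "g \<in> Rinf"
  shows "coef (f + g) v = coef f v + coef g v"
proof -
  let ?S = "{w. coef f w \<noteq> 0} \<union> {w. coef g w \<noteq> 0}"
  have S: "finite ?S" "?S \<subseteq> Winf"
    using assms finite_coef coef_Winf by auto
  have "f + g = (\<Sum>w\<in>?S. (coef f w + coef g w) * C w)"
    unfolding distrib_right sum.distrib
    using coef_expand_superset[OF assms(1) S(1)] coef_expand_superset[OF assms(2) S(1)] by simp
  moreover have "coef (\<Sum>w\<in>?S. (coef f w + coef g w) * C w) v = (if v \<in> ?S then coef f v + coef g v else 0)"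
    using coef_lincomb[OF S] assms by (simp add: coef_Zt Zt_closed)
  ultimately show ?thesis by auto
qed

lemma coef_sum:
  "(\<And>x. x \<in> A \<Longrightarrow> h x \<in> Rinf) \<Longrightarrow> coef (sum h A) v = (\<Sum>x\<in>A. coef (h x) v)"
  by (induction A rule: infinite_finite_induct) (auto simp: coef_add Rinf_closed)

lemma C_nonzero: "w \<in> Winf \<Longrightarrow> C w \<noteq> 0"
  using coef_mult_C[of 1 w w] by (auto simp: Zt_closed)

lemma ddz_word_C:
  assumes w: "w \<in> Winf"
  shows "ddz_word is (C w) = (if len (w \<circ> wprod is) + length is = len w then C (w \<circ> wprod is) else 0)"
proof (induction "is" rule: rev_induct)
  case Nil
  show ?case unfolding wprod_Nil by simp
next
  case (snoc i "is")
  let ?v = "w \<circ> wprod is"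
  have v: "?v \<in> Winf" using w wprod_in_Winf by (rule comp_in_Winf)
  have ge: "len w \<le> len ?v + length is" by (rule len_le_len_comp_wprod[OF w])
  have pm: "len (?v \<circ> gen_s i) = len ?v + 1 \<or> len ?v = len (?v \<circ> gen_s i) + 1"
    by (rule len_comp_gen_s[OF v])
  have "ddz_word is (C w) = (if len ?v + length is = len w then C ?v else 0)"
    by (rule snoc.IH)
  then have "ddz_word (is @ [i]) (C w) = ddz i (if len ?v + length is = len w then C ?v else 0)"
    by (simp only: ddz_word_snoc)
  also have "\<dots> = (if len (?v \<circ> gen_s i) + (length is + 1) = len w then C (?v \<circ> gen_s i) else 0)"
    using ge pm ddz_C[OF v, of i] by (cases "len ?v + length is = len w") auto
  finally have "ddz_word (is @ [i]) (C w) =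
      (if len (w \<circ> wprod (is @ [i])) + length (is @ [i]) = len w then C (w \<circ> wprod (is @ [i])) else 0)"
    unfolding wprod_snoc comp_assoc by simp
  then show ?case .
qed

text \<open>Along a reduced word of the inverse of v, \<open>C v\<close> becomes 1, while any other
  basis element becomes 0 or a Schubert polynomial different from \<open>C id\<close>, which has no
  constant term. Coefficients in \<open>Zt\<close> pass through \<open>ddz\<close>
  unchanged.\<close>

lemma const_ddz_word:
  assumes f: "f \<in> Rinf" and v: "v \<in> Winf" "v \<circ> wprod is = id" "length is = len v"
  shows "mcoeff (ddz_word is f) 0 = mcoeff (coef f v) 0"
proof -
  let ?S = "insert v {w. coef f w \<noteq> 0}"
  have S: "finite ?S" "?S \<subseteq> Winf" using f v(1) finite_coef coef_Winf by auto
  have "ddz_word is f = ddz_word is (\<Sum>w\<in>?S. coef f w * C w)"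
    by (rule arg_cong[where f = "ddz_word is"], rule coef_expand_superset[OF f S(1)]) blast
  also have "\<dots> = (\<Sum>w\<in>?S. coef f w * ddz_word is (C w))"
    using S f by (subst ddz_word_sum)
      (auto intro!: Zt_mult_C_Rinf C_Rinf coef_Zt sum.cong ddz_word_Zt_mult)
  finally have "mcoeff (ddz_word is f) 0 = (\<Sum>w\<in>?S. mcoeff (coef f w) 0 * mcoeff (ddz_word is (C w)) 0)"
    by (simp add: mcoeff_sum mcoeff_mult_0)
  also have "\<dots> = (\<Sum>w\<in>?S. if w = v then mcoeff (coef f w) 0 else 0)"
  proof (rule sum.cong[OF refl])
    fix w assume "w \<in> ?S"
    then have w: "w \<in> Winf" using S by blast
    have "w \<circ> wprod is = id \<longleftrightarrow> w = v"
      using comp_wprod_cancel[of w "is" v] v(2) by auto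
    then have "mcoeff (ddz_word is (C w)) 0 = (if w = v then 1 else 0)"
      using v(2,3) C_const[OF comp_in_Winf[OF w wprod_in_Winf], of "is"]
      by (auto simp: ddz_word_C[OF w] C_id mcoeff_one)
    then show "mcoeff (coef f w) 0 * mcoeff (ddz_word is (C w)) 0 = (if w = v then mcoeff (coef f w) 0 else 0)"
      by simp
  qed
  also have "\<dots> = mcoeff (coef f v) 0" using S(1) by simp
  finally show ?thesis .
qed

text \<open>
  At an element \<open>w\<close> of maximal length in the expansion of \<open>g\<close> the symmetry of \<open>g\<close> forces all
  divided differences of the coefficient to vanish.
\<close>

lemma ddt_coef_max:
  assumes g: "g \<in> Rinf" "ddz i g = ddt i g" and w: "w \<in> Winf"
    and max: "\<And>v. coef g v \<noteq> 0 \<Longrightarrow> len v \<le> len w"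
  shows "ddt i (coef g w) = 0"
proof -
  let ?S = "insert w {v. coef g v \<noteq> 0}" and ?a = "coef g"
  have S: "finite ?S" "?S \<subseteq> Winf" using g w finite_coef coef_Winf by auto
  have ge: "g = (\<Sum>v\<in>?S. ?a v * C v)" by (rule coef_expand_superset) (use g S in auto)
  have a: "?a v \<in> Zt" for v using g by (simp add: coef_Zt)
  have CS: "C v \<in> Rinf" if "v \<in> ?S" for v using that S by (blast intro: C_Rinf)
  \<comment> \<open>An element shorter than some member of the support cannot be w, whose length is
    maximal there; divided differences of basis elements therefore never contribute to
    \<open>C w\<close>.\<close>
  have low: "coef (b * C u) w = 0" if "b \<in> Zt" "u \<in> Winf" "v \<in> ?S" "len u < len v" for b u v
    using that max[of v] by (auto simp: coef_mult_C)
  have aCS: "?a v * C v \<in> Rinf" if "v \<in> ?S" for v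
    using that S by (blast intro: Zt_mult_C_Rinf a)
  have "ddz i g = (\<Sum>v\<in>?S. ddz i (?a v * C v))"
    by (subst ge, rule ddz_sum, rule aCS)
  also have "\<dots> = (\<Sum>v\<in>?S. ?a v * ddz i (C v))"
    by (rule sum.cong[OF refl], rule ddz_Zt_mult[OF a CS])
  finally have dz: "ddz i g = (\<Sum>v\<in>?S. ?a v * ddz i (C v))" .
  have "coef (ddz i g) w = (\<Sum>v\<in>?S. coef (?a v * ddz i (C v)) w)"
    unfolding dz by (rule coef_sum, intro Rinf_closed(2) Zt_in_Rinf a ddz_Rinf CS)
  also have "\<dots> = 0"
  proof (rule sum.neutral, rule ballI)
    fix v assume v: "v \<in> ?S"
    then have "v \<in> Winf" using S by blast
    then show "coef (?a v * ddz i (C v)) w = 0"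
      using low[OF a _ v, of "v \<circ> gen_s i" v] by (simp add: ddz_C comp_in_Winf gen_s_in_Winf)
  qed
  finally have z: "coef (ddz i g) w = 0" .
  have parts: "ddt i (?a v) * C v \<in> Rinf" "tau i (?a v) * ddt i (C v) \<in> Rinf" if "v \<in> ?S" for v
    using CS[OF that] by (simp_all add: Rinf_closed Zt_in_Rinf a ddt_Rinf tau_Rinf)
  have "ddt i g = (\<Sum>v\<in>?S. ddt i (?a v * C v))"
    by (subst ge, rule ddt_sum, rule aCS)
  also have "\<dots> = (\<Sum>v\<in>?S. ddt i (?a v) * C v + tau i (?a v) * ddt i (C v))"
    by (rule sum.cong[OF refl], rule ddt_mult[OF Zt_in_Rinf[OF a] CS])
  finally have dt: "ddt i g = (\<Sum>v\<in>?S. ddt i (?a v) * C v + tau i (?a v) * ddt i (C v))" .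
  have "coef (ddt i g) w = (\<Sum>v\<in>?S. coef (ddt i (?a v) * C v + tau i (?a v) * ddt i (C v)) w)"
    unfolding dt by (rule coef_sum, intro Rinf_closed(6) parts)
  also have "\<dots> = (\<Sum>v\<in>?S. coef (ddt i (?a v) * C v) w + coef (tau i (?a v) * ddt i (C v)) w)"
    by (rule sum.cong[OF refl], rule coef_add[OF parts])
  \<comment> \<open>Of the Leibniz rule only the term that differentiates the coefficient of
    \<open>C w\<close> itself survives.\<close>
  also have "\<dots> = (\<Sum>v\<in>?S. if v = w then ddt i (?a v) else 0)"
  proof (rule sum.cong[OF refl])
    fix v assume v: "v \<in> ?S"
    then have vW: "v \<in> Winf" using S by blast
    then have "coef (tau i (?a v) * ddt i (C v)) w = 0"
      using low[OF tau_Zt[OF a] _ v, of "gen_s i \<circ> v" i v] by (simp add: ddt_C comp_in_Winf gen_s_in_Winf)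
    then show "coef (ddt i (?a v) * C v) w + coef (tau i (?a v) * ddt i (C v)) w = (if v = w then ddt i (?a v) else 0)"
      using vW by (auto simp: coef_mult_C ddt_Zt a)
  qed
  also have "\<dots> = ddt i (?a w)" using S(1) by simp
  finally show ?thesis using z g(2) by simp
qed

text \<open>Some basis element survives b and loses length \<open>n\<^sup>2\<close> on the way, so
  the reversed word must have a product of at least that length, which inside \<open>Wn n\<close>
  leaves only \<open>w0 n\<close>. Membership and length of \<open>w0 n\<close> are thus read off
  from f.\<close>

lemma w0_props:
  assumes f: "f \<in> Rinf" and b: "set b \<subseteq> {..<n}" "length b = n\<^sup>2" "ddz_word b f \<noteq> 0"
  shows "w0 n \<in> Wn n" "len (w0 n) = n\<^sup>2" "w0 n \<circ> wprod b = id"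
proof -
  let ?S = "{w. coef f w \<noteq> 0}"
  have "ddz_word b f = ddz_word b (\<Sum>w\<in>?S. coef f w * C w)"
    using coef_expand[OF f] by auto
  also have "\<dots> = (\<Sum>w\<in>?S. coef f w * ddz_word b (C w))"
    using coef_Winf f by (subst ddz_word_sum)
      (auto intro!: Zt_mult_C_Rinf C_Rinf coef_Zt sum.cong ddz_word_Zt_mult)
  finally have "(\<Sum>w\<in>?S. coef f w * ddz_word b (C w)) \<noteq> 0" using b(3) by simp
  then obtain w where "w \<in> ?S" "coef f w * ddz_word b (C w) \<noteq> 0"
    by (meson sum.not_neutral_contains_not_neutral)
  then have w: "w \<in> Winf" "ddz_word b (C w) \<noteq> 0" using coef_Winf[OF f] by auto
  then have l: "len (w \<circ> wprod b) + n\<^sup>2 = len w"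
    using b(2) by (auto simp: ddz_word_C split: if_splits)
  have r: "wprod b \<circ> wprod (rev b) = id" using wprod_rev[of "rev b"] by simp
  have "len w = len ((w \<circ> wprod b) \<circ> wprod (rev b))" by (simp add: comp_assoc r)
  also have "\<dots> \<le> len (w \<circ> wprod b) + len (wprod (rev b))"
    by (intro len_comp_le comp_in_Winf w wprod_in_Winf)
  finally have "len (wprod (rev b)) \<ge> n\<^sup>2" using l by simp
  moreover have W: "wprod (rev b) \<in> Wn n" by (rule wprod_in_Wn) (use b in auto)
  ultimately have l': "len (wprod (rev b)) = n\<^sup>2" using len_Wn_le(1)[OF W] by simp
  then have "wprod (rev b) = w0 n" by (rule len_Wn_le(2)[OF W])
  with W l' wprod_rev[of b] show "w0 n \<in> Wn n" "len (w0 n) = n\<^sup>2" "w0 n \<circ> wprod b = id" by auto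
qed

text \<open>For \<open>i < n\<close> the generator commutes with \<open>w0 n\<close>. Otherwise it
  is an ascent on the right, hence also on the left, since \<open>w0 n\<close> is an involution and
  inversion does not change the length.\<close>

lemma ddz_C_w0_eq_ddt_C_w0:
  assumes "w0 n \<in> Winf"
  shows "ddz i (C (w0 n)) = ddt i (C (w0 n))"
proof (cases "i < n")
  case True
  then show ?thesis using assms by (simp add: ddz_C ddt_C w0_comp_gen_s)
next
  case False
  then have "w0 n (lo i) < w0 n (hi i)" by (auto simp: w0_def lo_def hi_def)
  then have r: "len (w0 n) < len (w0 n \<circ> gen_s i)" using ascent_iff[OF assms] by blast
  have "(gen_s i \<circ> w0 n) \<circ> (w0 n \<circ> gen_s i) = gen_s i \<circ> (w0 n \<circ> w0 n) \<circ> gen_s i"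
    by (simp add: comp_assoc)
  also have "\<dots> = id" by (simp add: w0_comp_w0)
  finally have "len (w0 n \<circ> gen_s i) \<le> len (gen_s i \<circ> w0 n)"
    using len_inverse_le comp_in_Winf[OF gen_s_in_Winf assms] by blast
  with r show ?thesis using assms by (simp add: ddz_C ddt_C)
qed

lemma eq_C_w0:
  assumes f: "f \<in> Rinf" "\<And>i. ddz i f = ddt i f" and zero: "\<And>i. i \<ge> n \<Longrightarrow> ddz i f = 0"
    and ord: "ord_ge (n\<^sup>2) f"
    and b: "set b \<subseteq> {..<n}" "length b = n\<^sup>2" "ddz_word b f = 1"
  shows "f = C (w0 n)"
proof (rule ccontr)
  assume ne: "f \<noteq> C (w0 n)"
  have bn: "ddz_word b f \<noteq> 0" using b(3) by simp
  note w0 = w0_props[OF f(1) b(1,2) bn]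
  have w0W: "w0 n \<in> Winf" by (rule Wn_imp_Winf[OF w0(1)])
  define g where "g = f - C (w0 n)"
  have g: "g \<in> Rinf" using f C_Rinf[OF w0W] by (simp add: g_def Rinf_closed)
  have sym: "ddz i g = ddt i g" for i
    using f C_Rinf[OF w0W] ddz_C_w0_eq_ddt_C_w0[OF w0W] by (simp add: g_def ddz_diff ddt_diff)
  let ?S = "{w. coef g w \<noteq> 0}"
  have "g \<noteq> 0" using ne by (simp add: g_def)
  have "?S \<noteq> {}"
  proof
    assume e: "?S = {}"
    have "g = 0" using coef_expand[OF g] unfolding e by simp
    with \<open>g \<noteq> 0\<close> show False ..
  qed
  then have "Max (len ` ?S) \<in> len ` ?S" using finite_coef[OF g] by (intro Max_in) auto
  then obtain w where w: "coef g w \<noteq> 0" "len w = Max (len ` ?S)" by auto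
  have max: "len v \<le> len w" if "coef g v \<noteq> 0" for v
    unfolding w(2) using that finite_coef[OF g] by (intro Max_ge) auto
  have wW: "w \<in> Winf" using coef_Winf[OF g w(1)] .
  have const: "mcoeff (coef g w) 0 = 0"
  proof -
    have *: "mcoeff (coef g w) 0 = mcoeff (ddz_word js f) 0 - (if w = w0 n then 1 else 0)"
      if js: "w \<circ> wprod js = id" "length js = len w" for js
    proof -
      have "coef (C (w0 n)) w = (if w = w0 n then 1 else 0)"
        using coef_mult_C[of 1 "w0 n" w] w0W by (simp add: Zt_closed)
      then have "mcoeff (ddz_word js (C (w0 n))) 0 = (if w = w0 n then 1 else 0)"
        using const_ddz_word[OF C_Rinf[OF w0W] wW js] by (simp add: mcoeff_one)
      then show ?thesis
        using const_ddz_word[OF g wW js] f(1) C_Rinf[OF w0W] by (simp add: g_def ddz_word_diff)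
    qed
    show ?thesis
    proof (cases "w = w0 n")
      case True
      \<comment> \<open>Here the constant terms of f and of \<open>C (w0 n)\<close> along b are both
        1 and cancel.\<close>
      then show ?thesis using *[of b] w0 b by (simp add: mcoeff_one)
    next
      case False
      obtain ks where ks: "w = wprod ks" "length ks = len w" using ex_reduced_word[OF wW] by blast
      have js: "w \<circ> wprod (rev ks) = id" "length (rev ks) = len w"
        using wprod_rev[of "rev ks"] ks by auto
      have "mcoeff (ddz_word (rev ks) f) 0 = 0"
      \<comment> \<open>Inside \<open>Wn n\<close> every element other than \<open>w0 n\<close> is
        shorter than the order of f, so the order survives as positive; outside, a letter at least n
        kills f.\<close>
      proof (cases "set ks \<subseteq> {..<n}")
        case True
        then have "w \<in> Wn n" using wprod_in_Wn ks(1) by blast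
        then have "len w < n\<^sup>2" using len_Wn_le[of w n] False by fastforce
        then have "ord_ge (1 + length (rev ks)) f" using ord js(2) by (auto intro: ord_ge_mono)
        then have "ord_ge 1 (ddz_word (rev ks) f)" by (rule ord_ge_ddz_word[OF f(1)])
        then show ?thesis by (simp add: ord_ge_def)
      next
        case False
        then obtain j where "j \<in> set (rev ks)" "j \<ge> n" by (auto simp: subset_iff not_less)
        then have "ddz_word (rev ks) f = 0" using ddz_word_eq_0[OF f zero] by blast
        then show ?thesis by simp
      qed
      then show ?thesis using *[OF js] False by simp
    qed
  qed
  have "coef g w = 0"
    by (rule Zt_invariant_const[OF coef_Zt[OF g] _ const]) (rule ddt_coef_max[OF g sym wW max])
  with w(1) show False by simp
qed

end

section \<open>Divided differences of Pfaffians of theta polynomials\<close>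

text \<open>The triples are ordered as first index, upper index, degree, unlike those of
  \<open>vartheta\<close>, and the first index may be negative.\<close>

definition theta_Pf :: "(int \<times> int \<times> int) list \<Rightarrow> ring_elt"
  where "theta_Pf ts = Pf (map (\<lambda>(\<kappa>, l, r). (Theta \<kappa> l, r)) ts)"

lemma theta_Pf_Rinf: "theta_Pf ts \<in> Rinf"
  unfolding theta_Pf_def by (rule Pf_Rinf) (auto simp: Theta_Rinf)

lemma theta_Pf_Nil [simp]: "theta_Pf [] = 1"
  by (simp add: theta_Pf_def)

lemma theta_Pf_snoc_unit: "theta_Pf (ts @ [(\<kappa>, l, 0)]) = theta_Pf ts"
  by (simp add: theta_Pf_def Pf_snoc_unit)

lemma Omega_theta_Pf: "Omega (theta_Pf ts) = theta_Pf (map (\<lambda>(\<kappa>, l, r). (l, \<kappa>, r)) ts)"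
  by (simp add: theta_Pf_def Omega.Pf case_prod_unfold o_def)

lemma ord_ge_theta_Pf:
  assumes "\<And>\<kappa> l r. (\<kappa>, l, r) \<in> set ts \<Longrightarrow> r \<ge> 0"
  shows "ord_ge (\<Sum>(\<kappa>, l, r)\<leftarrow>ts. nat r) (theta_Pf ts)"
proof -
  have "ord_ge (\<Sum>(c, r)\<leftarrow>map (\<lambda>(\<kappa>, l, r). (Theta \<kappa> l, r)) ts. nat r) (theta_Pf ts)"
    unfolding theta_Pf_def by (rule Pf_ord_ge) (use assms in \<open>auto simp: ord_ge_Theta\<close>)
  then show ?thesis by (simp add: case_prod_unfold o_def)
qed

lemma sigma_theta_entries:
  assumes "\<And>\<kappa> l r. (\<kappa>, l, r) \<in> set ts \<Longrightarrow> \<bar>\<kappa>\<bar> \<noteq> int i"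
  shows "map (\<lambda>(c, r). (\<lambda>k. sigma i (c k), r)) (map (\<lambda>(\<kappa>, l, r). (Theta \<kappa> l, r)) ts) =
    map (\<lambda>(\<kappa>, l, r). (Theta \<kappa> l, r)) ts"
  using assms by (auto simp: sigma_Theta)

lemma ddz_theta_Pf_0:
  assumes "\<And>\<kappa> l r. (\<kappa>, l, r) \<in> set ts \<Longrightarrow> \<bar>\<kappa>\<bar> \<noteq> int i"
  shows "ddz i (theta_Pf ts) = 0"
proof -
  have "sigma i (theta_Pf ts) = theta_Pf ts"
    unfolding theta_Pf_def sigma.Pf by (subst sigma_theta_entries) (use assms in auto)
  then show ?thesis by (intro ddz_eqI theta_Pf_Rinf Rinf_closed) simp
qed

text \<open>Only one entry is moved by \<open>sigma i\<close>, so linearity of the Pfaffian in that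
  entry reduces the claim to a single theta polynomial.\<close>

lemma ddz_theta_Pf:
  assumes \<kappa>: "\<bar>\<kappa>\<bar> = int i"
    and us: "\<And>\<kappa> l r. (\<kappa>, l, r) \<in> set us \<Longrightarrow> \<bar>\<kappa>\<bar> \<noteq> int i"
    and vs: "\<And>\<kappa> l r. (\<kappa>, l, r) \<in> set vs \<Longrightarrow> \<bar>\<kappa>\<bar> \<noteq> int i"
  shows "ddz i (theta_Pf (us @ (\<kappa>, l, r) # vs)) = theta_Pf (us @ (\<kappa> - 1, l, r - 1) # vs)"
proof (rule ddz_eqI[OF theta_Pf_Rinf theta_Pf_Rinf])
  let ?t = "map (\<lambda>(\<kappa>, l, r). (Theta \<kappa> l, r))"
  have s: "sigma i (theta_Pf (us @ (\<kappa>, l, r) # vs)) = Pf (?t us @ (\<lambda>k. sigma i (Theta \<kappa> l k), r) # ?t vs)"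
    unfolding theta_Pf_def sigma.Pf map_append list.map case_prod_conv
    by (subst (1 2) sigma_theta_entries) (use us vs in auto)
  have "Pf (?t us @ (Theta \<kappa> l, r) # ?t vs) =
      Pf (?t us @ (\<lambda>k. sigma i (Theta \<kappa> l k), r) # ?t vs) + zalpha i * Pf (?t us @ (Theta (\<kappa> - 1) l, r - 1) # ?t vs)"
  proof (rule Pf_linear)
    show "Theta \<kappa> l k = sigma i (Theta \<kappa> l k) + zalpha i * Theta (\<kappa> - 1) l (k - 1)" for k
      using Theta_ddz[OF \<kappa>, of l k] by (simp add: algebra_simps)
  qed simp
  then show "zalpha i * theta_Pf (us @ (\<kappa> - 1, l, r - 1) # vs) =
      theta_Pf (us @ (\<kappa>, l, r) # vs) - sigma i (theta_Pf (us @ (\<kappa>, l, r) # vs))"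
    unfolding s by (simp add: theta_Pf_def)
qed

text \<open>An entry with first index j is lowered by the operator of index
  \<open>\<bar>j\<bar>\<close>. For \<open>\<kappa> = e\<close> and \<open>d = 2 e + 1\<close> the
  word is e, ..., 1, 0, 1, ..., e.\<close>

definition lowering_word :: "int \<Rightarrow> nat \<Rightarrow> nat list"
  where "lowering_word \<kappa> d = map (\<lambda>s. nat \<bar>\<kappa> - int s\<bar>) [0..<d]"

lemma length_lowering_word [simp]: "length (lowering_word \<kappa> d) = d"
  by (simp add: lowering_word_def)

lemma ddz_word_lowering:
  assumes "\<And>\<kappa>' l r i. (\<kappa>', l, r) \<in> set (us @ vs) \<Longrightarrow> i \<in> set (lowering_word \<kappa> d) \<Longrightarrow> \<bar>\<kappa>'\<bar> \<noteq> int i"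
  shows "ddz_word (lowering_word \<kappa> d) (theta_Pf (us @ (\<kappa>, l, r) # vs)) =
    theta_Pf (us @ (\<kappa> - int d, l, r - int d) # vs)"
  using assms
proof (induction d)
  case 0
  then show ?case by (simp add: lowering_word_def)
next
  case (Suc d)
  let ?i = "nat \<bar>\<kappa> - int d\<bar>"
  have w: "lowering_word \<kappa> (Suc d) = lowering_word \<kappa> d @ [?i]"
    by (simp add: lowering_word_def)
  have "ddz_word (lowering_word \<kappa> (Suc d)) (theta_Pf (us @ (\<kappa>, l, r) # vs)) =
      ddz ?i (theta_Pf (us @ (\<kappa> - int d, l, r - int d) # vs))"
    unfolding w ddz_word_snoc using Suc.prems by (subst Suc.IH) (auto simp: w)
  also have "\<dots> = theta_Pf (us @ (\<kappa> - int d - 1, l, r - int d - 1) # vs)"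
  proof (rule ddz_theta_Pf)
    show "\<bar>\<kappa>'\<bar> \<noteq> int ?i" if "(\<kappa>', l', r') \<in> set us" for \<kappa>' l' r'
      using Suc.prems[of \<kappa>' l' r' ?i] that by (simp add: w)
    show "\<bar>\<kappa>'\<bar> \<noteq> int ?i" if "(\<kappa>', l', r') \<in> set vs" for \<kappa>' l' r'
      using Suc.prems[of \<kappa>' l' r' ?i] that by (simp add: w)
  qed simp
  finally show ?case by (simp add: algebra_simps)
qed

text \<open>The first indices at which an operator is applied run from e down to at least -e. This
  is the origin of the bound \<open>rf e \<le> 2 * e + 1\<close> required of degrees below.\<close>

lemma set_lowering_word_le: "d \<le> 2 * e + 1 \<Longrightarrow> set (lowering_word (int e) d) \<subseteq> {..e}"
  by (auto simp: lowering_word_def)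

text \<open>
  The last entry is lowered to degree 0, where it is the unit entry and can be dropped; its word
  only involves letters that do not affect the preceding entries.
\<close>

lemma ddz_word_remove_last:
  assumes "m < n" "\<And>e. rf e \<le> 2 * e + 1"
  shows "ddz_word (lowering_word (int m) (rf m)) (theta_Pf (map (\<lambda>e. (int e, lf e, int (rf e))) (rev [m..<n]))) =
    theta_Pf (map (\<lambda>e. (int e, lf e, int (rf e))) (rev [Suc m..<n]))"
proof -
  let ?us = "map (\<lambda>e. (int e, lf e, int (rf e))) (rev [Suc m..<n])"
  have "map (\<lambda>e. (int e, lf e, int (rf e))) (rev [m..<n]) = ?us @ (int m, lf m, int (rf m)) # []"
    using assms(1) by (simp add: upt_conv_Cons)
  moreover have "ddz_word (lowering_word (int m) (rf m)) (theta_Pf (?us @ (int m, lf m, int (rf m)) # [])) =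
      theta_Pf (?us @ (int m - int (rf m), lf m, int (rf m) - int (rf m)) # [])"
  proof (rule ddz_word_lowering)
    fix \<kappa>' l r i assume *: "(\<kappa>', l, r) \<in> set (?us @ [])" "i \<in> set (lowering_word (int m) (rf m))"
    have "i \<le> m" using set_lowering_word_le[OF assms(2)[of m]] *(2) by blast
    then show "\<bar>\<kappa>'\<bar> \<noteq> int i" using *(1) by auto
  qed
  ultimately show ?thesis by (simp add: theta_Pf_snoc_unit)
qed

definition removal_word :: "(nat \<Rightarrow> nat) \<Rightarrow> nat \<Rightarrow> nat list"
  where "removal_word rf k = concat (map (\<lambda>e. lowering_word (int e) (rf e)) [0..<k])"

lemma removal_word_Suc: "removal_word rf (Suc k) = removal_word rf k @ lowering_word (int k) (rf k)"
  by (simp add: removal_word_def)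

lemma set_removal_word: "(\<And>e. rf e \<le> 2 * e + 1) \<Longrightarrow> set (removal_word rf k) \<subseteq> {..<k}"
proof (induction k)
  case (Suc k)
  then show ?case
    using set_lowering_word_le[OF Suc.prems[of k]] by (auto simp: removal_word_Suc)
qed (simp add: removal_word_def)

lemma ddz_word_removal:
  assumes "k \<le> n" "\<And>e. rf e \<le> 2 * e + 1"
  shows "ddz_word (removal_word rf k) (theta_Pf (map (\<lambda>e. (int e, lf e, int (rf e))) (rev [0..<n]))) =
    theta_Pf (map (\<lambda>e. (int e, lf e, int (rf e))) (rev [k..<n]))"
  using assms(1)
proof (induction k)
  case 0
  then show ?case by (simp add: removal_word_def)
next
  case (Suc k)
  then show ?case
    unfolding removal_word_Suc ddz_word_append
    using ddz_word_remove_last[of k n rf lf] assms(2) by simp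
qed

lemma ddz_word_removal_from:
  assumes "m \<le> n" "\<And>e. rf e \<le> 2 * e + 1"
  shows "\<exists>is. ddz_word is (theta_Pf (map (\<lambda>e. (int e, lf e, int (rf e))) (rev [m..<n]))) = 1"
  using assms(1)
proof (induction m rule: inc_induct)
  case base
  show ?case by (intro exI[of _ "[]"]) simp
next
  case (step m)
  let ?f = "\<lambda>m. theta_Pf (map (\<lambda>e. (int e, lf e, int (rf e))) (rev [m..<n]))"
  let ?w = "lowering_word (int m) (rf m)"
  obtain js where js: "ddz_word js (?f (Suc m)) = 1" using step.IH by blast
  have "ddz_word ?w (?f m) = ?f (Suc m)"
    by (rule ddz_word_remove_last[OF step.hyps(2) assms(2)])
  then have "ddz_word (?w @ js) (?f m) = 1" unfolding ddz_word_append using js by simp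
  then show ?case by blast
qed

text \<open>The Pfaffian of the theorem for J = {0, ..., n - 1}, where each block has a single
  entry.\<close>

definition w0_theta :: "nat \<Rightarrow> ring_elt"
  where "w0_theta n = theta_Pf (map (\<lambda>e. (int e, int e, int (2 * e + 1))) (rev [0..<n]))"

lemma length_removal_word_w0: "length (removal_word (\<lambda>e. 2 * e + 1) n) = n\<^sup>2"
  by (induction n) (auto simp: removal_word_Suc removal_word_def power2_eq_square)

lemma w0_theta_Rinf: "w0_theta n \<in> Rinf"
  by (simp add: w0_theta_def theta_Pf_Rinf)

lemma Omega_w0_theta: "Omega (w0_theta n) = w0_theta n"
  by (simp add: w0_theta_def Omega_theta_Pf o_def)

lemma ddz_w0_theta_0: "i \<ge> n \<Longrightarrow> ddz i (w0_theta n) = 0"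
  unfolding w0_theta_def by (rule ddz_theta_Pf_0) auto

lemma ord_ge_w0_theta: "ord_ge (n\<^sup>2) (w0_theta n)"
proof -
  have "(\<Sum>(\<kappa>, l, r)\<leftarrow>map (\<lambda>e. (int e, int e, int (2 * e + 1))) (rev [0..<n]). nat r) = n\<^sup>2"
    by (induction n) (auto simp: power2_eq_square nat_add_distrib nat_mult_distrib)
  moreover have "r \<ge> 0"
    if "(\<kappa>, l, r) \<in> set (map (\<lambda>e. (int e, int e, int (2 * e + 1))) (rev [0..<n]))" for \<kappa> l r
    using that by auto
  ultimately show ?thesis
    unfolding w0_theta_def by (metis (no_types, lifting) ord_ge_theta_Pf)
qed

text \<open>
  \<open>Omega\<close> exchanges the indices \<open>i - 1\<close> and \<open>i\<close> of the entry lowered by \<open>ddz i\<close>; this changes the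
  Pfaffian by a multiple of one with two equal adjacent entries.
\<close>

lemma Omega_ddz_w0_theta: "Omega (ddz i (w0_theta n)) = ddz i (w0_theta n)"
proof (cases "i < n")
  case False
  then show ?thesis by (simp add: ddz_w0_theta_0)
next
  case True
  let ?h = "\<lambda>e. (int e, int e, int (2 * e + 1))"
  let ?us = "map ?h (rev [Suc i..<n])" and ?vs = "map ?h (rev [0..<i])"
  have "[0..<n] = [0..<i] @ i # [Suc i..<n]"
    using True upt_add_eq_append[of 0 i "n - i"] by (simp add: upt_conv_Cons)
  then have l: "map ?h (rev [0..<n]) = ?us @ (int i, int i, int (2 * i + 1)) # ?vs" by simp
  have "ddz i (theta_Pf (?us @ (int i, int i, int (2 * i + 1)) # ?vs)) =
      theta_Pf (?us @ (int i - 1, int i, int (2 * i + 1) - 1) # ?vs)"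
    by (rule ddz_theta_Pf) auto
  then have d: "ddz i (w0_theta n) = theta_Pf (?us @ (int i - 1, int i, 2 * int i) # ?vs)"
    unfolding w0_theta_def l by simp
  have O: "Omega (ddz i (w0_theta n)) = theta_Pf (?us @ (int i, int i - 1, 2 * int i) # ?vs)"
    by (simp add: d Omega_theta_Pf o_def)
  show ?thesis
  proof (cases i)
    case 0
    then show ?thesis
      unfolding O unfolding d
      using theta_Pf_snoc_unit[of ?us 0 "- 1"] theta_Pf_snoc_unit[of ?us "- 1" 0] by simp
  next
    case (Suc j)
    let ?t = "map (\<lambda>(\<kappa>, l, r). (Theta \<kappa> l, r))"
    let ?e = "(Theta (int j) (int j), int (2 * j + 1))"
    have vs: "?t ?vs = ?e # ?t (map ?h (rev [0..<j]))" by (simp add: Suc)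
    \<comment> \<open>The correction term from exchanging i - 1 and i has the same entry as its
      right neighbour; its degree 2 j + 1 exceeds j + j, so the quadratic relation applies.\<close>
    have "pf_pair ?e ?e = 0"
      unfolding pf_pair_def prod.case nat_int by (rule Theta_quadratic) auto
    then have zero: "Pf (?t ?us @ ?e # ?e # ?t (map ?h (rev [0..<j]))) = 0"
      by (rule Pf_adjacent_equal)
    have "Pf (?t ?us @ (Theta (int i - 1) (int i), 2 * int i) # ?t ?vs) =
        Pf (?t ?us @ (Theta (int i) (int i - 1), 2 * int i) # ?t ?vs) +
        - (tv i + zv i) * Pf (?t ?us @ (Theta (int i - 1) (int i - 1), 2 * int i - 1) # ?t ?vs)"
    proof (rule Pf_linear)
      show "Theta (int i - 1) (int i) k = Theta (int i) (int i - 1) k +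
          - (tv i + zv i) * Theta (int i - 1) (int i - 1) (k - 1)" for k
        using Theta_swap_diff[of i k] Suc by (simp add: algebra_simps)
    qed simp
    also have "(Theta (int i - 1) (int i - 1), 2 * int i - 1) = ?e" by (simp add: Suc)
    also have "Pf (?t ?us @ ?e # ?t ?vs) = 0" unfolding vs by (rule zero)
    finally show ?thesis
      unfolding O unfolding d by (simp add: theta_Pf_def)
  qed
qed

lemma ddt_w0_theta: "ddz i (w0_theta n) = ddt i (w0_theta n)"
  by (simp add: ddt_eq w0_theta_Rinf Omega_w0_theta Omega_ddz_w0_theta)

section \<open>Schubert polynomials of longest elements\<close>

context schubert
begin

lemma C_w0: "C (w0 n) = w0_theta n"
proof (rule eq_C_w0[symmetric])
  show "ddz_word (removal_word (\<lambda>e. 2 * e + 1) n) (w0_theta n) = 1"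
    unfolding w0_theta_def by (subst ddz_word_removal) auto
  show "set (removal_word (\<lambda>e. 2 * e + 1) n) \<subseteq> {..<n}"
    by (rule set_removal_word) simp
qed (rule w0_theta_Rinf ddt_w0_theta ddz_w0_theta_0 ord_ge_w0_theta length_removal_word_w0; assumption?)+

lemma w0_in_Wn: "w0 n \<in> Wn n" and len_w0: "len (w0 n) = n\<^sup>2"
proof -
  have "ddz_word (removal_word (\<lambda>e. 2 * e + 1) n) (w0_theta n) \<noteq> 0"
    unfolding w0_theta_def by (subst ddz_word_removal) auto
  from w0_props[OF w0_theta_Rinf set_removal_word length_removal_word_w0 this]
  show "w0 n \<in> Wn n" "len (w0 n) = n\<^sup>2" by auto
qed

text \<open>Lengths add along the cosets of the subgroup generated by the letters outside J.\<close>

lemma longest_WnJ: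
  assumes x: "set b \<subseteq> {..<n} - J" "ddz_word b (C (w0 n)) \<noteq> 0"
    and zero: "\<And>i. i \<notin> J \<Longrightarrow> ddz i (ddz_word b (C (w0 n))) = 0"
    and w: "is_arg_max len (\<lambda>v. v \<in> WnJ n J) w"
  shows "C w = ddz_word b (C (w0 n))"
proof -
  let ?w = "w0 n \<circ> wprod b" and ?u = "wprod (rev b)"
  have w0W: "w0 n \<in> Winf" by (rule Wn_imp_Winf[OF w0_in_Wn])
  have lw: "len ?w + length b = n\<^sup>2" and Cw: "ddz_word b (C (w0 n)) = C ?w"
    using x(2) unfolding ddz_word_C[OF w0W] len_w0 by (auto split: if_splits)
  have "wprod b \<in> Wn n" "?u \<in> Wn n" using x(1) by (auto intro!: wprod_in_Wn)
  then have wn: "?w \<in> Wn n" using comp_in_Wn[OF w0_in_Wn] by blast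
  have wW: "?w \<in> Winf" by (rule Wn_imp_Winf[OF wn])
  \<comment> \<open>A descent at i would make \<open>ddz i\<close> yield a member of the basis,
    which is not zero.\<close>
  have "len ?w < len (?w \<circ> gen_s i)" if "i \<notin> J" for i
  proof -
    have "\<not> len (?w \<circ> gen_s i) < len ?w"
      using zero[OF that] ddz_C[OF wW, of i] C_nonzero[OF comp_in_Winf[OF wW gen_s_in_Winf], of i]
      unfolding Cw by auto
    then show ?thesis using len_comp_gen_s[OF wW, of i] by linarith
  qed
  then have "?w \<in> WnJ n J" using wn wW by (simp add: WnJ_def WJ_def)
  then have ge: "len ?w \<le> len w" and wJ: "w \<in> Wn n" "w \<in> WJ J"
    using w by (auto simp: is_arg_max_def WnJ_def not_less)
  have wu: "?w \<circ> ?u = w0 n"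
    using wprod_rev[of "rev b"] by (simp add: comp_assoc)
  have "n\<^sup>2 \<le> len ?w + len ?u"
    using len_comp_le[OF wW wprod_in_Winf, of "rev b"] unfolding wu len_w0 .
  then have "len ?u = length (rev b)"
    using lw len_wprod_le[of "rev b"] by simp
  then have l: "len (w \<circ> ?u) = len w + length b"
    using len_WJ_comp[OF wJ(2), of "rev b"] x(1) by auto
  have "w \<circ> ?u \<in> Wn n" by (rule comp_in_Wn[OF wJ(1) \<open>?u \<in> Wn n\<close>])
  \<comment> \<open>Since w is at least as long as \<open>?w\<close>, the product reaches length
    \<open>n\<^sup>2\<close>, which only \<open>w0 n\<close> has inside \<open>Wn n\<close>.
    Cancelling \<open>?u\<close> identifies w with \<open>?w\<close>.\<close>
  then have "w \<circ> ?u = w0 n"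
    using len_Wn_le[of "w \<circ> ?u" n] l ge lw by linarith
  then have "w = ?w" using comp_wprod_cancel[of w "rev b" ?w] wu by simp
  then show ?thesis using Cw by simp
qed

end

section \<open>Lowering to the Pfaffian for J\<close>

text \<open>For e from \<open>k i\<close> up to \<open>k (i + 1) - 1\<close> this is
  \<open>k i\<close>. It gives the first index of the entry belonging to e without enumerating the
  blocks.\<close>

definition prev_elem :: "nat set \<Rightarrow> nat \<Rightarrow> nat"
  where "prev_elem J e = Max {k \<in> J. k \<le> e}"

lemma prev_elem:
  assumes "j \<in> J" "j \<le> e"
  shows "prev_elem J e \<in> J" "prev_elem J e \<le> e" "j \<le> prev_elem J e"
proof -
  have fin: "finite {k \<in> J. k \<le> e}" by (rule finite_subset[of _ "{..e}"]) auto
  have "prev_elem J e \<in> {k \<in> J. k \<le> e}"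
    unfolding prev_elem_def by (rule Max_in[OF fin]) (use assms in blast)
  then show "prev_elem J e \<in> J" "prev_elem J e \<le> e" by auto
  show "j \<le> prev_elem J e"
    unfolding prev_elem_def by (rule Max_ge[OF fin]) (use assms in blast)
qed

definition parabolic_theta :: "nat set \<Rightarrow> nat \<Rightarrow> nat \<Rightarrow> ring_elt"
  where "parabolic_theta J m n = theta_Pf (map (\<lambda>e. (int (prev_elem J e), int e, int (e + prev_elem J e + 1))) (rev [m..<n]))"

text \<open>An intermediate stage: entries with e below m already have their final first index, the
  others are still those of \<open>w0_theta\<close>.\<close>

definition partial_entry :: "nat set \<Rightarrow> nat \<Rightarrow> nat \<Rightarrow> int \<times> int \<times> int"
  where "partial_entry J m e = (if e < m then (int (prev_elem J e), int e, int (e + prev_elem J e + 1))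
    else (int e, int e, int (2 * e + 1)))"

text \<open>The letters m, m - 1, ... stop just above the largest element of J not exceeding m, so
  they avoid J. All other first indices lie in J or exceed m, and those entries are left
  alone.\<close>

lemma ddz_word_parabolic_step:
  assumes k: "k \<in> J" "\<And>j. j \<in> J \<Longrightarrow> k \<le> j" and m: "k \<le> m" "m < n"
  shows "set (lowering_word (int m) (m - prev_elem J m)) \<subseteq> {..<n} - J"
    and "ddz_word (lowering_word (int m) (m - prev_elem J m)) (theta_Pf (map (partial_entry J m) (rev [k..<n]))) =
      theta_Pf (map (partial_entry J (Suc m)) (rev [k..<n]))"
proof -
  let ?q = "prev_elem J m"
  note q = prev_elem[OF k(1) m(1)]
  have w: "i \<notin> J \<and> i \<le> m \<and> ?q < i" if "i \<in> set (lowering_word (int m) (m - ?q))" for i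
  proof -
    from that have "?q < i" "i \<le> m" by (auto simp: lowering_word_def)
    moreover have "i \<notin> J" using prev_elem(3)[of i J m] \<open>?q < i\<close> \<open>i \<le> m\<close> by auto
    ultimately show ?thesis by simp
  qed
  show "set (lowering_word (int m) (m - ?q)) \<subseteq> {..<n} - J" using w m by fastforce
  have split: "[k..<n] = [k..<m] @ m # [Suc m..<n]"
    using m upt_add_eq_append[of k m "n - m"] by (simp add: upt_conv_Cons)
  let ?us = "map (partial_entry J m) (rev [Suc m..<n])" and ?vs = "map (partial_entry J m) (rev [k..<m])"
  have start: "map (partial_entry J m) (rev [k..<n]) = ?us @ (int m, int m, int (2 * m + 1)) # ?vs"
    by (simp add: split partial_entry_def)
  have "ddz_word (lowering_word (int m) (m - ?q)) (theta_Pf (map (partial_entry J m) (rev [k..<n]))) =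
      theta_Pf (?us @ (int m - int (m - ?q), int m, int (2 * m + 1) - int (m - ?q)) # ?vs)"
    unfolding start
  proof (rule ddz_word_lowering)
    fix \<kappa>' l r i assume *: "(\<kappa>', l, r) \<in> set (?us @ ?vs)" "i \<in> set (lowering_word (int m) (m - ?q))"
    note i = w[OF *(2)]
    from *(1) consider e where "\<kappa>' = int e" "e > m" | e where "\<kappa>' = int (prev_elem J e)" "k \<le> e"
      by (auto simp: partial_entry_def)
    then show "\<bar>\<kappa>'\<bar> \<noteq> int i"
    proof cases
      case 2
      then have "prev_elem J e \<in> J" using prev_elem(1)[OF k(1)] by blast
      then show ?thesis using 2 i by auto
    qed (use i in auto)
  qed
  also have "?us @ (int m - int (m - ?q), int m, int (2 * m + 1) - int (m - ?q)) # ?vs =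
      map (partial_entry J (Suc m)) (rev [k..<n])"
    using q(2) by (auto simp: split partial_entry_def of_nat_diff)
  finally show "ddz_word (lowering_word (int m) (m - ?q)) (theta_Pf (map (partial_entry J m) (rev [k..<n]))) =
      theta_Pf (map (partial_entry J (Suc m)) (rev [k..<n]))" .
qed

lemma ex_word_parabolic_theta:
  assumes k: "k \<in> J" "\<And>j. j \<in> J \<Longrightarrow> k \<le> j" "k \<le> n"
  shows "\<exists>b. set b \<subseteq> {..<n} - J \<and> ddz_word b (w0_theta n) = parabolic_theta J k n"
proof -
  let ?ent = "partial_entry J"
  \<comment> \<open>Entries with e below the least element k of J have no counterpart in the target
    and are removed; this uses only letters below k, which are outside J.\<close>
  let ?b = "removal_word (\<lambda>e. 2 * e + 1) k"
  have "\<exists>b. set b \<subseteq> {..<n} - J \<and> ddz_word b (theta_Pf (map (?ent k) (rev [k..<n]))) =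
      theta_Pf (map (?ent (k + d)) (rev [k..<n]))" if "k + d \<le> n" for d
    using that
  proof (induction d)
    case 0
    show ?case by (intro exI[of _ "[]"]) simp
  next
    case (Suc d)
    then obtain b where b: "set b \<subseteq> {..<n} - J"
      "ddz_word b (theta_Pf (map (?ent k) (rev [k..<n]))) = theta_Pf (map (?ent (k + d)) (rev [k..<n]))"
      by auto
    let ?c = "lowering_word (int (k + d)) (k + d - prev_elem J (k + d))"
    have c: "set ?c \<subseteq> {..<n} - J" "ddz_word ?c (theta_Pf (map (?ent (k + d)) (rev [k..<n]))) =
        theta_Pf (map (?ent (Suc (k + d))) (rev [k..<n]))"
      by (rule ddz_word_parabolic_step[OF k(1,2)]; use Suc.prems in simp)+
    then show ?case
      using b by (intro exI[of _ "b @ ?c"]) (simp add: ddz_word_append)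
  qed
  from this[of "n - k"] k(3) obtain b where b: "set b \<subseteq> {..<n} - J"
    "ddz_word b (theta_Pf (map (?ent k) (rev [k..<n]))) = theta_Pf (map (?ent n) (rev [k..<n]))"
    by auto
  have e: "map (?ent k) (rev [k..<n]) = map (\<lambda>e. (int e, int e, int (2 * e + 1))) (rev [k..<n])"
    by (rule map_cong) (auto simp: partial_entry_def)
  have "ddz_word ?b (w0_theta n) = theta_Pf (map (?ent k) (rev [k..<n]))"
    unfolding w0_theta_def e by (rule ddz_word_removal[OF k(3)]) simp
  moreover have "theta_Pf (map (?ent n) (rev [k..<n])) = parabolic_theta J k n"
    unfolding parabolic_theta_def
    by (rule arg_cong[where f = theta_Pf], rule map_cong) (auto simp: partial_entry_def)
  moreover have "set ?b \<subseteq> {..<n} - J"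
  proof -
    have "set ?b \<subseteq> {..<k}" by (rule set_removal_word) simp
    then show ?thesis using k by fastforce
  qed
  ultimately show ?thesis
    using b by (intro exI[of _ "?b @ b"]) (simp add: ddz_word_append)
qed

text \<open>The image under \<open>Omega\<close> has pairwise different first indices, so that it can be lowered to 1.\<close>

lemma parabolic_theta_nonzero:
  assumes "k \<in> J" "k \<le> n"
  shows "parabolic_theta J k n \<noteq> 0"
proof
  \<comment> \<open>For e at least k the minimum is \<open>prev_elem J e\<close>; it is taken so
    that the degree bound \<open>2 * e + 1\<close> holds for every e.\<close>
  let ?q = "\<lambda>e. min e (prev_elem J e)"
  assume 0: "parabolic_theta J k n = 0"
  have "Omega (parabolic_theta J k n) =
      theta_Pf (map (\<lambda>e. (int e, int (?q e), int (e + ?q e + 1))) (rev [k..<n]))"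
    unfolding parabolic_theta_def Omega_theta_Pf map_map
    by (intro arg_cong[where f = theta_Pf] map_cong) (use prev_elem(2)[OF assms(1)] in \<open>auto simp: min_absorb2\<close>)
  then have "theta_Pf (map (\<lambda>e. (int e, int (?q e), int (e + ?q e + 1))) (rev [k..<n])) = 0"
    by (simp add: 0)
  moreover have "\<exists>is. ddz_word is (theta_Pf (map (\<lambda>e. (int e, int (?q e), int (e + ?q e + 1))) (rev [k..<n]))) = 1"
    by (rule ddz_word_removal_from[OF assms(2)]) auto
  ultimately show False by simp
qed

lemma ddz_parabolic_theta_0:
  assumes "k \<in> J" "i \<notin> J"
  shows "ddz i (parabolic_theta J k n) = 0"
  unfolding parabolic_theta_def
  by (rule ddz_theta_Pf_0) (use prev_elem(1)[OF assms(1)] assms(2) in auto)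

lemma (in schubert) C_longest_WnJ:
  assumes k: "k \<in> J" "\<And>j. j \<in> J \<Longrightarrow> k \<le> j" "k \<le> n"
    and w: "is_arg_max len (\<lambda>v. v \<in> WnJ n J) w"
  shows "C w = parabolic_theta J k n"
proof -
  obtain b where b: "set b \<subseteq> {..<n} - J" "ddz_word b (w0_theta n) = parabolic_theta J k n"
    using ex_word_parabolic_theta[OF k] by blast
  then have "ddz_word b (C (w0 n)) = parabolic_theta J k n" by (simp add: C_w0)
  then show ?thesis
    using longest_WnJ[OF b(1) _ _ w] parabolic_theta_nonzero[OF k(1,3)] ddz_parabolic_theta_0[OF k(1)] by simp
qed

section \<open>Matching the block form of the theorem\<close>

lemma vartheta_Btilde:
  assumes "k i \<le> k (i + 1)"
  shows "vartheta (Btilde k i) = map (\<lambda>e. (Theta (int (k i)) (int e), int (e + k i + 1))) (rev [k i..<k (i + 1)])"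
proof -
  have "map (\<lambda>(\<kappa>, r, l). (theta \<kappa> l, r)) (Btilde k i) =
      map (\<lambda>e. (Theta (int (k i)) (int e), int (e + k i + 1))) [k i..<k (i + 1)]"
  proof (rule nth_equalityI)
    show "length (map (\<lambda>(\<kappa>, r, l). (theta \<kappa> l, r)) (Btilde k i)) =
        length (map (\<lambda>e. (Theta (int (k i)) (int e), int (e + k i + 1))) [k i..<k (i + 1)])"
      using assms by (simp add: Btilde_def)
    fix j assume "j < length (map (\<lambda>(\<kappa>, r, l). (theta \<kappa> l, r)) (Btilde k i))"
    then have "j < k (i + 1) - k i" by (simp add: Btilde_def)
    then show "map (\<lambda>(\<kappa>, r, l). (theta \<kappa> l, r)) (Btilde k i) ! j =
        map (\<lambda>e. (Theta (int (k i)) (int e), int (e + k i + 1))) [k i..<k (i + 1)] ! j"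
      using assms by (simp add: Btilde_def theta_eq_Theta nth_upto algebra_simps)
  qed
  then show ?thesis unfolding vartheta_def by (simp only: rev_map)
qed

text \<open>The two reversals, inside each block by \<open>vartheta\<close> and of the order of the
  blocks, combine to one reversal of the whole interval.\<close>

lemma concat_rev_upt:
  assumes "\<And>i. 1 \<le> i \<Longrightarrow> i \<le> p \<Longrightarrow> k i \<le> k (i + 1)"
  shows "concat (map (\<lambda>i. rev [k i..<k (i + 1)]) (rev [1..<p + 1])) = rev [k 1..<k (p + 1)]"
  using assms
proof (induction p)
  case (Suc p)
  have "k 1 \<le> k (q + 1)" if "q \<le> p" for q
    using that
  proof (induction q)
    case (Suc q)
    then show ?case using Suc.prems assms(1) \<open>\<And>i. 1 \<le> i \<Longrightarrow> i \<le> Suc p \<Longrightarrow> k i \<le> k (i + 1)\<close>[of "Suc q"] by simp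
  qed simp
  then have "k 1 \<le> k (p + 1)" by blast
  moreover have "k (p + 1) \<le> k (p + 2)" using Suc.prems[of "p + 1"] by simp
  ultimately have "[k 1..<k (p + 2)] = [k 1..<k (p + 1)] @ [k (p + 1)..<k (p + 2)]"
    using upt_add_eq_append[of "k 1" "k (p + 1)" "k (p + 2) - k (p + 1)"] by simp
  then show ?case using Suc by simp
qed simp

theorem theorem8p10:
  fixes C :: "(int \<Rightarrow> int) \<Rightarrow> ring_elt"
    and n p :: nat and k :: "nat \<Rightarrow> nat" and J :: "nat set" and w :: "int \<Rightarrow> int"
  assumes "double_Schubert C"
    and "n \<ge> 1"
    and "J \<subseteq> {0..<n}" and "J \<noteq> {}"
    and "strict_mono_on {1..p} k" and "k ` {1..p} = J" and "k (p + 1) = n"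
    and "is_arg_max len (\<lambda>v. v \<in> WnJ n J) w"
  shows "C w = Pf (concat (map (\<lambda>i. vartheta (Btilde k i)) (rev [1..<p + 1])))"
proof -
  interpret schubert C by unfold_locales fact
  have p: "p \<ge> 1" using assms(4,6) by (cases p) auto
  have mono: "k i \<le> k j" if "1 \<le> i" "i \<le> j" "j \<le> p" for i j
    using strict_mono_on_leD[OF assms(5), of i j] that by simp
  have lt: "k i < n" if "1 \<le> i" "i \<le> p" for i
    using assms(3,6) that by fastforce
  have step: "k i \<le> k (i + 1)" if "1 \<le> i" "i \<le> p" for i
    using mono[of i "i + 1"] lt[OF that] assms(7) that by (cases "i = p") auto
  have k1: "k 1 \<in> J" using assms(6) p by auto
  have min: "k 1 \<le> j" if "j \<in> J" for j
    using that mono[of 1] unfolding assms(6)[symmetric] by auto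
  \<comment> \<open>For \<open>i = p\<close> the upper bound is \<open>k (p + 1) = n\<close>, which
    is not an element of J; the last block is therefore covered by the same argument.\<close>
  have prev: "prev_elem J e = k i" if "1 \<le> i" "i \<le> p" "k i \<le> e" "e < k (i + 1)" for i e
  proof -
    have kJ: "k i \<in> J" using assms(6) that by auto
    note q = prev_elem[OF kJ that(3)]
    obtain j where j: "1 \<le> j" "j \<le> p" "prev_elem J e = k j" using q(1) assms(6) by auto
    have "j \<le> i"
    proof (rule ccontr)
      assume "\<not> j \<le> i"
      then have "k (i + 1) \<le> k j" using mono[of "i + 1" j] j by simp
      then show False using q(2) j(3) that(4) by simp
    qed
    then have "k j \<le> k i" using mono[of j i] j that by simp
    then show ?thesis using q(3) j(3) by simp
  qed
  let ?t = "\<lambda>e. (Theta (int (prev_elem J e)) (int e), int (e + prev_elem J e + 1))"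
  have "vartheta (Btilde k i) = map ?t (rev [k i..<k (i + 1)])" if "i \<in> set (rev [1..<p + 1])" for i
    unfolding vartheta_Btilde[OF step[of i]] using that prev[of i] step[of i]
    by (subst vartheta_Btilde) (auto intro!: map_cong)
  then have "concat (map (\<lambda>i. vartheta (Btilde k i)) (rev [1..<p + 1])) =
      concat (map (\<lambda>i. map ?t (rev [k i..<k (i + 1)])) (rev [1..<p + 1]))"
    by (intro arg_cong[where f = concat] map_cong refl) auto
  also have "\<dots> = map ?t (concat (map (\<lambda>i. rev [k i..<k (i + 1)]) (rev [1..<p + 1])))"
    by (simp only: map_concat map_map o_def)
  also have "\<dots> = map ?t (rev [k 1..<n])"
    using concat_rev_upt[of p k] step assms(7) by simp
  finally have "Pf (concat (map (\<lambda>i. vartheta (Btilde k i)) (rev [1..<p + 1]))) = parabolic_theta J (k 1) n"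
    unfolding parabolic_theta_def theta_Pf_def map_map o_def case_prod_conv by simp
  then show ?thesis
    using C_longest_WnJ[OF k1 min _ assms(8)] lt[of 1] p by simp
qed

end
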